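(* Let $d=1$ and $U\subset\mathbb R$ a bounded open interval. Let $\{f^\lambda_j\}$ be a parametrized IFS satisfying (MA1)–(MA4) and (MT) on $U$, and let $\{\mu_\lambda\}_{\lambda\in\overline U}$ be finite Borel measures on $\Sigma$ satisfying (M) with constants $c,\theta$. Fix $\lambda_0\in U$, $\beta>0$, $\gamma>0$, $\varepsilon>0$ and $q>1$ with $1+2\gamma+\varepsilon<q<1+\min\{\delta,\theta\}$. Then there exists an open interval $J\subset U$ containing $\lambda_0$ such that for every smooth function $\rho$ on $\mathbb R$ with $0\le\rho\le1$ and $\mathrm{supp}(\rho)\subset J$ there exist constants $\widetilde C_1,\widetilde C_2>0$ with $$\int_J\|\nu_\lambda\|_{2,\gamma}^2\rho(\lambda)\,d\lambda\le\widetilde C_1\,\mathcal E_{q(1+a_0\beta)}(\mu_{\lambda_0},d_{\lambda_0})+\widetilde C_2,\qquad a_0=\frac{8+4\delta}{1+\min\{\delta,\theta\}},$$ where $\nu_\lambda=(\Pi^\lambda)_*\mu_\lambda$.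
   Context: Setup: $X\subset\mathbb R$ compact nondegenerate interval, $\mathcal A=\{1,\dots,m\}$, $\Sigma=\mathcal A^{\mathbb N}$, $\Sigma^*$ finite words, $[\omega]$ cylinder, $\mathbf i|_n$ prefix, $\mathbf i\wedge\mathbf j$ longest common prefix. $f^\lambda_j:X\to X$, $f^\lambda_\omega$ compositions, $\Pi^\lambda(\mathbf i)=\lim_nf^\lambda_{\mathbf i|_n}(x)$, $d_\lambda(\mathbf i,\mathbf j)=|f^\lambda_{\mathbf i\wedge\mathbf j}(X)|$. $\delta\in(0,1)$. (MA1) $f_j^\lambda\in C^{2+\delta}(X)$, second $x$-derivatives uniformly bounded and uniformly $\delta$-Hölder in $x$ and $\lambda$; (MA2) $\lambda\mapsto f_j^\lambda(x)$ is $C^{1+\delta}$ with derivative uniformly $\delta$-Hölder in $\lambda$; (MA3) mixed partials $\partial^2 f/\partial x\partial\lambda$ exist, continuous, uniformly bounded, uniformly $\delta$-Hölder in $x$ and $\lambda$; (MA4) $0<\gamma_1\le|\frac d{dx}f^\lambda_j|\le\gamma_2<1$. (MT): $\exists\eta>0$ $\forall\lambda\in\overline U$, $\mathbf i,\mathbf j$ with $i_1\ne j_1$: $|\Pi^\lambda(\mathbf i)-\Pi^\lambda(\mathbf j)|<\eta\Rightarrow|\frac d{d\lambda}(\Pi^\lambda(\mathbf i)-\Pi^\lambda(\mathbf j))|\ge\eta$. (M): $\exists c>0,\theta\in(0,1]$: $e^{-c|\lambda-\lambda'|^\theta|\omega|}\mu_{\lambda'}([\omega])\le\mu_\lambda([\omega])\le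 e^{c|\lambda-\lambda'|^\theta|\omega|}\mu_{\lambda'}([\omega])$ for all $\omega\in\Sigma^*$, $\lambda,\lambda'\in\overline U$. Energy: $\mathcal E_s(\mu,d)=\iint d(\mathbf i,\mathbf j)^{-s}d\mu(\mathbf i)d\mu(\mathbf j)$. Homogeneous Sobolev norm: $\|\nu\|_{2,\gamma}^2=\int_{\mathbb R}|\widehat\nu(\xi)|^2|\xi|^{2\gamma}d\xi$, $\widehat\nu(\xi)=\int e^{i\xi x}d\nu(x)$. *)

theory Defs
  imports "HOL-Analysis.Analysis" "HOL-Probability.Probability"
begin

text \<open>Symbolic space: alphabet {0..<m} (the paper's {1..m}, shifted),
  Sigma = sequences nat => nat with values in {0..<m}, with the
  product (= cylinder = Borel) sigma-algebra.\<close>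

definition SigmaM :: "nat \<Rightarrow> (nat \<Rightarrow> nat) measure" where
  "SigmaM m = PiM UNIV (\<lambda>_. count_space {0..<m})"

definition words :: "nat \<Rightarrow> nat list set" where
  "words m = {w. \<forall>a\<in>set w. a < m}"

definition cyl :: "nat \<Rightarrow> nat list \<Rightarrow> (nat \<Rightarrow> nat) set" where
  "cyl m w = {i \<in> space (SigmaM m). \<forall>k<length w. i k = w ! k}"

fun comp_word :: "(real \<Rightarrow> nat \<Rightarrow> real \<Rightarrow> real) \<Rightarrow> real \<Rightarrow> nat list \<Rightarrow> real \<Rightarrow> real" where
  "comp_word f lam [] = id"
| "comp_word f lam (j # w) = f lam j \<circ> comp_word f lam w"

definition prefix_word :: "(nat \<Rightarrow> nat) \<Rightarrow> nat \<Rightarrow> nat list" where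
  "prefix_word i n = map i [0..<n]"

definition Proj :: "(real \<Rightarrow> nat \<Rightarrow> real \<Rightarrow> real) \<Rightarrow> real \<Rightarrow> real \<Rightarrow> (nat \<Rightarrow> nat) \<Rightarrow> real" where
  "Proj f x0 lam i = lim (\<lambda>n. comp_word f lam (prefix_word i n) x0)"

definition dlam :: "(real \<Rightarrow> nat \<Rightarrow> real \<Rightarrow> real) \<Rightarrow> real set \<Rightarrow> real \<Rightarrow> (nat \<Rightarrow> nat) \<Rightarrow> (nat \<Rightarrow> nat) \<Rightarrow> real" where
  "dlam f X lam i j = (if i = j then 0
     else diameter (comp_word f lam (prefix_word i (LEAST k. i k \<noteq> j k)) ` X))"

definition energy :: "'a measure \<Rightarrow> ('a \<Rightarrow> 'a \<Rightarrow> real) \<Rightarrow> real \<Rightarrow> ennreal" where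
  "energy M d s = (\<integral>\<^sup>+ i. (\<integral>\<^sup>+ j. (if d i j = 0 then \<infinity> else ennreal (d i j powr (- s))) \<partial>M) \<partial>M)"

definition fourier :: "real measure \<Rightarrow> real \<Rightarrow> complex" where
  "fourier \<nu> \<xi> = (\<integral>x. cis (\<xi> * x) \<partial>\<nu>)"

definition sobolev_sq :: "real measure \<Rightarrow> real \<Rightarrow> ennreal" where
  "sobolev_sq \<nu> \<gamma> = (\<integral>\<^sup>+ \<xi>. ennreal ((cmod (fourier \<nu> \<xi>))\<^sup>2 * \<bar>\<xi>\<bar> powr (2 * \<gamma>)) \<partial>lborel)"

definition smooth_fun :: "(real \<Rightarrow> real) \<Rightarrow> bool" where
  "smooth_fun g \<longleftrightarrow> (\<forall>k x. ((deriv ^^ k) g) differentiable (at x))"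


end

(*
  For a finite energy it suffices to show that the integral is finite. Split the frequencies into dyadic
  shells and, at frequency t = 2^N, replace mu_lambda by its discretisation on cylinders of length
  proportional to N. The shell is then dominated by a finite sum over pairs of words (v, w) of
  mu_lambda[v] mu_lambda[w] psi(t (Pi(v) - Pi(w))), where psi is a compactly supported kernel of mean zero.
  Factor Pi(v) - Pi(w) = Q p, with Q the slope of the common prefix and p transversal. As psi has mean zero,
  integrating in lambda gains the factor (t |Q|)^(-q), q < 1 + min(delta, theta), which only needs Taylor
  expansions of order 1 + delta of p at single points and Hoelder continuity of the weights. On a small
  window the dependence of Q and of the weights on lambda costs exp(kappa N) with kappa as small as desired,
  and summing |Q|^(-q) against the weights at lambda_0 gives the energy.
*)
theory Submission imports Defs "HOL-Real_Asymp.Real_Asymp"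
begin

section \<open>The kernel\<close>

text \<open>The obstacle is low regularity. In \<open>lam\<close> the weights are only Hoelder
  continuous, (M) compares them only on cylinders and at a cost exponential in the word length, and
  p is controlled only to order 1 + \<delta>. So a single cancellation against a kernel of mean zero
  must do: the length R of the support gives one factor and freezing gives
  \<open>R powr min \<delta> \<theta>\<close>, whence the upper bound on q. Discretising turns the
  Sobolev norm into finite sums whose dependence on \<open>lam\<close> is explicit. The words have
  length proportional to N, so the loss exp(kappa N) can be paid from the surplus \<epsilon> in 1 +
  2 \<gamma> + \<epsilon> < q once the window is small. The kernel has to be nonnegative on the
  Fourier side, to dominate a shell, and compactly supported in space, so that only parameters at
  which Pi(v) and Pi(w) are close contribute. Being piecewise linear, it has an explicit
  antiderivative and an explicit Fourier transform. The energy enters because its exponent is at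
  least q and slopes are at most 1 in absolute value, so |Q|^(-q) is at most the power of |Q| that
  the energy controls.\<close>

text \<open>Up to scaling, the autocorrelation of the Haar wavelet: it has compact support and mean zero, and its
  Fourier transform is nonnegative and bounded below on a dyadic shell.\<close>

definition kernel :: "real \<Rightarrow> real" where
  "kernel x = 4 * \<bar>x + 1\<bar> + 4 * \<bar>x - 1\<bar> - 6 * \<bar>x\<bar> - \<bar>x + 2\<bar> - \<bar>x - 2\<bar>"

text \<open>\<open>kernel\<close> is minus the fourth central difference (weights 1, -4, 6, -4, 1)
  of the absolute value. Fourth differences annihilate linear functions, and for
  \<open>2 \<le> \<bar>x\<bar>\<close> all five nodes lie weakly on one side of 0.\<close>

lemma kernel_eq_0: "2 \<le> \<bar>x\<bar> \<Longrightarrow> kernel x = 0"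
  by (auto simp: kernel_def abs_if split: if_splits)

lemma kernel_0: "kernel 0 = 4"
  by (simp add: kernel_def)

text \<open>The constant is the sum of the absolute weights, 4 + 4 + 6 + 1 + 1.\<close>

lemma kernel_lipschitz: "\<bar>kernel x - kernel y\<bar> \<le> 16 * \<bar>x - y\<bar>"
proof -
  define S where "S k = \<bar>x + k\<bar> - \<bar>y + k\<bar>" for k
  define d where "d = \<bar>x - y\<bar>"
  have *: "S k \<le> d \<and> - d \<le> S k" for k unfolding S_def d_def by linarith
  have "kernel x - kernel y = 4 * S 1 + 4 * S (-1) - 6 * S 0 - S 2 - S (-2)"
    unfolding kernel_def S_def by simp
  then show ?thesis
    unfolding d_def[symmetric] abs_le_iff
    using *[of 1] *[of "-1"] *[of 0] *[of 2] *[of "-2"] by auto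
qed

lemma abs_kernel_le: "\<bar>kernel x\<bar> \<le> 4"
proof (cases "2 \<le> \<bar>x\<bar>")
  case False
  then have "-2 < x" "x < 2" by auto
  then consider "-2 < x" "x \<le> -1" | "-1 < x" "x \<le> 0" | "0 < x" "x \<le> 1" | "1 < x" "x < 2" by linarith
  then show ?thesis by cases (simp_all add: kernel_def abs_if)
qed (simp add: kernel_eq_0)

lemma continuous_on_kernel [continuous_intros]:
  "continuous_on A g \<Longrightarrow> continuous_on A (\<lambda>x. kernel (g x))"
  unfolding kernel_def by (intro continuous_intros)

lemma DERIV_mult_abs: "((\<lambda>x::real. x * \<bar>x\<bar>) has_real_derivative 2 * \<bar>x\<bar>) (at x)"
proof (cases "x = 0")
  case True
  have "((\<lambda>h::real. \<bar>h\<bar>) \<longlongrightarrow> \<bar>0\<bar>) (at 0)"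
    by (intro tendsto_intros)
  moreover have "eventually (\<lambda>h::real. \<bar>h\<bar> = ((0 + h) * \<bar>0 + h\<bar> - 0 * \<bar>0\<bar>) / h) (at 0)"
    by (auto simp: eventually_at_filter)
  ultimately have "((\<lambda>h::real. ((0 + h) * \<bar>0 + h\<bar> - 0 * \<bar>0\<bar>) / h) \<longlongrightarrow> \<bar>0\<bar>) (at 0)"
    by (rule Lim_transform_eventually)
  then show ?thesis using True by (simp add: DERIV_def)
next
  case False
  then consider "x > 0" | "x < 0" by linarith
  then show ?thesis
  proof cases
    case 1
    have "((\<lambda>x::real. x * x) has_real_derivative 2 * \<bar>x\<bar>) (at x)"
      using 1 by (auto intro!: derivative_eq_intros)
    then show ?thesis
      by (rule has_field_derivative_transform_within_open[where S="{0<..}"]) (use 1 in auto)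
  next
    case 2
    have "((\<lambda>x::real. - (x * x)) has_real_derivative 2 * \<bar>x\<bar>) (at x)"
      using 2 by (auto intro!: derivative_eq_intros)
    then show ?thesis
      by (rule has_field_derivative_transform_within_open[where S="{..<0}"]) (use 2 in auto)
  qed
qed

text \<open>Mean zero, in the form needed for a linearised phase: \<open>sup\<close> says that the
  affine argument sweeps across the whole support [-2, 2]. \<open>G\<close>, the same fourth
  difference of \<open>y * \<bar>y\<bar>\<close>, is an antiderivative of \<open>2 * kernel\<close>,
  and it vanishes off the support because fourth differences annihilate quadratics too.\<close>

lemma kernel_affine_has_integral_0:
  assumes R: "0 \<le> R" and D: "D \<noteq> 0" and sup: "\<bar>p\<bar> + 2 \<le> \<bar>D\<bar> * R"
  shows "((\<lambda>x. kernel (p + D * (x - z))) has_integral 0) {z - R..z + R}"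
proof -
  define S where "S y = y * \<bar>y\<bar>" for y :: real
  define G where "G y = 4 * S (y + 1) + 4 * S (y - 1) - 6 * S y - S (y + 2) - S (y - 2)" for y
  have dS: "(S has_real_derivative 2 * \<bar>y\<bar>) (at y)" for y
    unfolding S_def by (rule DERIV_mult_abs)
  have dSk: "((\<lambda>y. S (y + k)) has_real_derivative 2 * \<bar>y + k\<bar>) (at y)" for y k
    using DERIV_shift[of S "2 * \<bar>y + k\<bar>" y k] dS by auto
  have dSd: "((\<lambda>y. S (y - k)) has_real_derivative 2 * \<bar>y - k\<bar>) (at y)" for y k
    using dSk[of "- k" y] by simp
  have dG: "(G has_real_derivative 2 * kernel y) (at y)" for y
  proof -
    have "(G has_real_derivative 4 * (2 * \<bar>y + 1\<bar>) + 4 * (2 * \<bar>y - 1\<bar>) - 6 * (2 * \<bar>y\<bar>) - 2 * \<bar>y + 2\<bar> - 2 * \<bar>y - 2\<bar>) (at y)"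
      unfolding G_def by (intro DERIV_add DERIV_diff DERIV_cmult dS dSk dSd)
    then show ?thesis by (simp add: kernel_def)
  qed
  have G0: "G y = 0" if "2 \<le> \<bar>y\<bar>" for y
  proof (cases "y \<ge> 0")
    case True
    then have "y \<ge> 2" using that by simp
    then show ?thesis by (simp add: G_def S_def algebra_simps)
  next
    case False
    then have "y \<le> -2" using that by simp
    then show ?thesis by (simp add: G_def S_def algebra_simps)
  qed
  have dGc: "((\<lambda>x. G (p + D * (x - z)) / (2 * D)) has_real_derivative kernel (p + D * (x - z))) (at x)" for x
    using D by (auto intro!: derivative_eq_intros DERIV_chain2[OF dG])
  have "((\<lambda>x. kernel (p + D * (x - z))) has_integral
     (G (p + D * (z + R - z)) / (2 * D) - G (p + D * (z - R - z)) / (2 * D))) {z - R..z + R}"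
    using R by (intro fundamental_theorem_of_calculus)
      (auto simp flip: has_real_derivative_iff_has_vector_derivative intro: DERIV_subset[OF dGc])
  moreover have "2 \<le> \<bar>p + D * (z + R - z)\<bar>" "2 \<le> \<bar>p + D * (z - R - z)\<bar>"
    using sup R abs_mult[of D R] by (auto simp: abs_if split: if_splits)
  ultimately show ?thesis by (simp add: G0)
qed

section \<open>The Fourier transform of the kernel\<close>

text \<open>Write 1 / \<xi>^2 as the integral of u exp(-u \<xi>) over u > 0 and exchange the
  integrals by Tonelli, everything being nonnegative. The integral over \<xi> becomes a Laplace
  transform, which leaves x^2 / (u^2 + x^2), and this integrates to an arctangent.\<close>

lemma nn_integral_one_minus_cos_half:
  assumes "x \<noteq> 0"
  shows "(\<integral>\<^sup>+\<xi>. ennreal ((1 - cos (x * \<xi>)) / \<xi>\<^sup>2) * indicator {0..} \<xi> \<partial>lborel) = ennreal (pi * \<bar>x\<bar> / 2)"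
proof -
  define H where "H u \<xi> = (1 - cos (x * \<xi>)) * (u * exp (- u * \<xi>)) * (indicator {0..} u * indicator {0..} \<xi>)" for u \<xi> :: real
  have inner1: "(\<integral>\<^sup>+u. ennreal (H u \<xi>) \<partial>lborel) = ennreal ((1 - cos (x * \<xi>)) / \<xi>\<^sup>2) * indicator {0..} \<xi>"
    if "\<xi> \<noteq> 0" for \<xi>
  proof (cases "\<xi> > 0")
    case True
    have "(\<integral>\<^sup>+u. ennreal (u * exp (- u * \<xi>)) * indicator {0..} u \<partial>lborel)
      = ennreal (0 - (- (0 / \<xi> + 1 / \<xi>\<^sup>2) * exp (- 0 * \<xi>)))"
    proof (rule nn_integral_FTC_atLeast)
      show "((\<lambda>u. - (u / \<xi> + 1 / \<xi>\<^sup>2) * exp (- u * \<xi>)) \<longlongrightarrow> 0) at_top"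
        using True by real_asymp
      show "((\<lambda>u. - (u / \<xi> + 1 / \<xi>\<^sup>2) * exp (- u * \<xi>)) has_real_derivative u * exp (- u * \<xi>)) (at u)" for u
        using True by (auto intro!: derivative_eq_intros simp: field_simps power2_eq_square)
    qed auto
    then have e: "(\<integral>\<^sup>+u. ennreal (u * exp (- u * \<xi>)) * indicator {0..} u \<partial>lborel) = ennreal (1 / \<xi>\<^sup>2)" by simp
    have "(\<integral>\<^sup>+u. ennreal (H u \<xi>) \<partial>lborel) =
      (\<integral>\<^sup>+u. ennreal (1 - cos (x * \<xi>)) * (ennreal (u * exp (- u * \<xi>)) * indicator {0..} u) \<partial>lborel)"
      using True by (intro nn_integral_cong) (auto simp: H_def ennreal_mult' split: split_indicator)
    also have "\<dots> = ennreal (1 - cos (x * \<xi>)) * ennreal (1 / \<xi>\<^sup>2)"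
      by (subst nn_integral_cmult) (use e in auto)
    finally show ?thesis using True by (simp add: ennreal_mult'[symmetric])
  next
    case False
    then show ?thesis using that by (simp add: H_def)
  qed
  have inner2: "(\<integral>\<^sup>+\<xi>. ennreal (H u \<xi>) \<partial>lborel) = ennreal (x\<^sup>2 / (u\<^sup>2 + x\<^sup>2)) * indicator {0..} u"
    if "u \<noteq> 0" for u
  proof (cases "u > 0")
    case True
    have nz: "u\<^sup>2 + x\<^sup>2 \<noteq> 0" using True by (simp add: sum_power2_eq_zero_iff)
    define F where "F \<xi> = exp (- u * \<xi>) * ((u * cos (x * \<xi>) - x * sin (x * \<xi>)) / (u\<^sup>2 + x\<^sup>2) - 1 / u)" for \<xi>
    have "(\<integral>\<^sup>+\<xi>. ennreal ((1 - cos (x * \<xi>)) * exp (- u * \<xi>)) * indicator {0..} \<xi> \<partial>lborel)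
      = ennreal (0 - F 0)"
    proof (rule nn_integral_FTC_atLeast)
      have "Bfun (\<lambda>\<xi>. (u * cos (x * \<xi>) - x * sin (x * \<xi>)) / (u\<^sup>2 + x\<^sup>2) - 1 / u) at_top"
      proof (rule BfunI[where K="(\<bar>u\<bar> + \<bar>x\<bar>) / (u\<^sup>2 + x\<^sup>2) + 1 / u"], intro always_eventually allI)
        fix \<xi>
        have "\<bar>u * cos (x * \<xi>) - x * sin (x * \<xi>)\<bar> \<le> \<bar>u\<bar> * 1 + \<bar>x\<bar> * 1"
          by (intro order_trans[OF abs_triangle_ineq4] add_mono) (auto simp: abs_mult intro!: mult_left_le)
        then show "norm ((u * cos (x * \<xi>) - x * sin (x * \<xi>)) / (u\<^sup>2 + x\<^sup>2) - 1 / u) \<le> (\<bar>u\<bar> + \<bar>x\<bar>) / (u\<^sup>2 + x\<^sup>2) + 1 / u"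
          using True unfolding real_norm_def
          by (intro order_trans[OF abs_triangle_ineq4] add_mono) (auto simp: abs_divide intro!: divide_right_mono)
      qed
      moreover have "((\<lambda>\<xi>. exp (- u * \<xi>)) \<longlongrightarrow> 0) at_top"
        using True by real_asymp
      ultimately have "Zfun (\<lambda>\<xi>. exp (- u * \<xi>) * ((u * cos (x * \<xi>) - x * sin (x * \<xi>)) / (u\<^sup>2 + x\<^sup>2) - 1 / u)) at_top"
        by (intro bounded_bilinear.Zfun_prod_Bfun[OF bounded_bilinear_mult]) (auto simp: tendsto_Zfun_iff)
      then show "(F \<longlongrightarrow> 0) at_top"
        unfolding F_def by (simp add: tendsto_Zfun_iff)
      show "(F has_real_derivative (1 - cos (x * \<xi>)) * exp (- u * \<xi>)) (at \<xi>)" for \<xi>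
        unfolding F_def using True nz
        by (auto intro!: derivative_eq_intros simp: divide_simps) (simp add: algebra_simps power2_eq_square)
    qed auto
    moreover have "- F 0 = x\<^sup>2 / (u * (u\<^sup>2 + x\<^sup>2))"
      using True nz by (simp add: F_def divide_simps) (simp add: power2_eq_square)
    ultimately have e: "(\<integral>\<^sup>+\<xi>. ennreal ((1 - cos (x * \<xi>)) * exp (- u * \<xi>)) * indicator {0..} \<xi> \<partial>lborel) = ennreal (x\<^sup>2 / (u * (u\<^sup>2 + x\<^sup>2)))" by simp
    have "(\<integral>\<^sup>+\<xi>. ennreal (H u \<xi>) \<partial>lborel) =
      (\<integral>\<^sup>+\<xi>. ennreal u * (ennreal ((1 - cos (x * \<xi>)) * exp (- u * \<xi>)) * indicator {0..} \<xi>) \<partial>lborel)"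
      using True by (intro nn_integral_cong) (auto simp: H_def ennreal_mult'[symmetric] ac_simps split: split_indicator)
    also have "\<dots> = ennreal u * ennreal (x\<^sup>2 / (u * (u\<^sup>2 + x\<^sup>2)))"
      by (subst nn_integral_cmult) (use e in auto)
    finally show ?thesis using True by (simp add: ennreal_mult'[symmetric])
  next
    case False
    then show ?thesis using that by (simp add: H_def)
  qed
  have "(\<integral>\<^sup>+\<xi>. ennreal ((1 - cos (x * \<xi>)) / \<xi>\<^sup>2) * indicator {0..} \<xi> \<partial>lborel)
      = (\<integral>\<^sup>+\<xi>. \<integral>\<^sup>+u. ennreal (H u \<xi>) \<partial>lborel \<partial>lborel)"
    by (intro nn_integral_cong_AE, rule AE_mp[OF AE_lborel_singleton[of 0]]) (auto simp: inner1)
  also have "\<dots> = (\<integral>\<^sup>+u. \<integral>\<^sup>+\<xi>. ennreal (H u \<xi>) \<partial>lborel \<partial>lborel)"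
    by (intro lborel_pair.Fubini') (auto simp: H_def)
  also have "\<dots> = (\<integral>\<^sup>+u. ennreal (x\<^sup>2 / (u\<^sup>2 + x\<^sup>2)) * indicator {0..} u \<partial>lborel)"
    by (intro nn_integral_cong_AE, rule AE_mp[OF AE_lborel_singleton[of 0]]) (auto simp: inner2)
  also have "\<dots> = ennreal (\<bar>x\<bar> * (pi / 2) - \<bar>x\<bar> * arctan (0 / \<bar>x\<bar>))"
  proof (rule nn_integral_FTC_atLeast)
    show "((\<lambda>u. \<bar>x\<bar> * arctan (u / \<bar>x\<bar>)) \<longlongrightarrow> \<bar>x\<bar> * (pi / 2)) at_top"
    proof (intro tendsto_mult tendsto_const filterlim_compose[OF tendsto_arctan_at_top])
      show "filterlim (\<lambda>u. u / \<bar>x\<bar>) at_top at_top"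
        using assms by real_asymp
    qed
    show "((\<lambda>u. \<bar>x\<bar> * arctan (u / \<bar>x\<bar>)) has_real_derivative x\<^sup>2 / (u\<^sup>2 + x\<^sup>2)) (at u)" for u
    proof -
      have "1 + (u / \<bar>x\<bar>)\<^sup>2 = (u\<^sup>2 + x\<^sup>2) / x\<^sup>2"
        using assms by (simp add: field_simps power_divide)
      then show ?thesis
      using assms by (auto intro!: derivative_eq_intros simp: mult.assoc)
    qed
  qed auto
  finally show ?thesis by simp
qed

lemma has_bochner_integral_one_minus_cos:
  "has_bochner_integral lborel (\<lambda>\<xi>. (1 - cos (x * \<xi>)) / \<xi>\<^sup>2) (pi * \<bar>x\<bar>)"
proof (cases "x = 0")
  case False
  let ?g = "\<lambda>\<xi>. (1 - cos (x * \<xi>)) / \<xi>\<^sup>2"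
  have half: "has_bochner_integral lborel (\<lambda>\<xi>. indicator {0..} \<xi> *\<^sub>R ?g \<xi>) (pi * \<bar>x\<bar> / 2)"
  proof (rule has_bochner_integral_nn_integral)
    show "(\<integral>\<^sup>+\<xi>. ennreal (indicator {0..} \<xi> *\<^sub>R ?g \<xi>) \<partial>lborel) = ennreal (pi * \<bar>x\<bar> / 2)"
      by (subst nn_integral_one_minus_cos_half[OF False, symmetric])
         (auto intro!: nn_integral_cong split: split_indicator)
  qed (auto split: split_indicator)
  have "has_bochner_integral lborel ?g (2 *\<^sub>R (pi * \<bar>x\<bar> / 2))"
    using has_bochner_integral_even_function[OF half] by simp
  then show ?thesis by simp
qed (simp add: has_bochner_integral_zero)


text \<open>By the addition formulas, (2 - 2 cos A)^2 cos Y is the combination of 1 - cos at the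
  nodes Y, Y + A, Y - A, Y + 2 A, Y - 2 A with the weights of \<open>kernel\<close>; constants drop
  out as the weights sum to 0. After division by \<xi>^2 each node integrates to pi times an
  absolute value, and these reassemble the kernel.\<close>

lemma has_bochner_integral_kernel_cos:
  assumes t: "0 < t"
  shows "has_bochner_integral lborel
     (\<lambda>\<xi>. (2 - 2 * cos (\<xi> / t))\<^sup>2 / (\<xi> / t)\<^sup>2 * cos (\<xi> * y)) (pi * t * kernel (t * y))"
proof -
  define H where "H z \<xi> = (1 - cos (z * \<xi>)) / \<xi>\<^sup>2" for z \<xi> :: real
  have hH: "has_bochner_integral lborel (H z) (pi * \<bar>z\<bar>)" for z
    unfolding H_def by (rule has_bochner_integral_one_minus_cos)
  let ?C = "\<lambda>A Y. 4 * (1 - cos (Y + A)) + 4 * (1 - cos (Y - A)) - 6 * (1 - cos Y)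
       - (1 - cos (Y + 2 * A)) - (1 - cos (Y - 2 * A)) :: real"
  have trig: "(2 - 2 * cos A)\<^sup>2 * cos Y = ?C A Y" for A Y :: real
    unfolding cos_add cos_diff cos_double_cos
    by (simp add: algebra_simps power2_eq_square)
  have "has_bochner_integral lborel
      (\<lambda>\<xi>. t\<^sup>2 * (4 * H (y + 1 / t) \<xi> + 4 * H (y - 1 / t) \<xi> - 6 * H y \<xi> - H (y + 2 / t) \<xi> - H (y - 2 / t) \<xi>))
      (t\<^sup>2 * (4 * (pi * \<bar>y + 1 / t\<bar>) + 4 * (pi * \<bar>y - 1 / t\<bar>) - 6 * (pi * \<bar>y\<bar>)
         - pi * \<bar>y + 2 / t\<bar> - pi * \<bar>y - 2 / t\<bar>))"
    by (intro has_bochner_integral_mult_right has_bochner_integral_add has_bochner_integral_diff hH)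
  moreover have "t\<^sup>2 * (4 * H (y + 1 / t) \<xi> + 4 * H (y - 1 / t) \<xi> - 6 * H y \<xi> - H (y + 2 / t) \<xi> - H (y - 2 / t) \<xi>)
      = (2 - 2 * cos (\<xi> / t))\<^sup>2 / (\<xi> / t)\<^sup>2 * cos (\<xi> * y)" for \<xi>
  proof -
    have "(y + k / t) * \<xi> = \<xi> * y + k * (\<xi> / t)" "(y - k / t) * \<xi> = \<xi> * y - k * (\<xi> / t)" for k
      by (simp_all add: algebra_simps)
    note e = this[of 1] this[of 2]
    have "4 * H (y + 1 / t) \<xi> + 4 * H (y - 1 / t) \<xi> - 6 * H y \<xi> - H (y + 2 / t) \<xi> - H (y - 2 / t) \<xi>
       = ?C (\<xi> / t) (\<xi> * y) / \<xi>\<^sup>2"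
      unfolding H_def e by (simp add: diff_divide_distrib add_divide_distrib mult.commute[of \<xi> y])
    then show ?thesis
      unfolding trig[symmetric] by (simp add: power_divide)
  qed
  moreover have "t\<^sup>2 * (4 * (pi * \<bar>y + 1 / t\<bar>) + 4 * (pi * \<bar>y - 1 / t\<bar>) - 6 * (pi * \<bar>y\<bar>)
         - pi * \<bar>y + 2 / t\<bar> - pi * \<bar>y - 2 / t\<bar>) = pi * t * kernel (t * y)"
  proof -
    have at: "t * \<bar>z\<bar> = \<bar>t * z\<bar>" for z using t by (simp add: abs_mult)
    have "t * \<bar>y + k / t\<bar> = \<bar>t * y + k\<bar>" "t * \<bar>y - k / t\<bar> = \<bar>t * y - k\<bar>" for k
      using at[of "y + k / t"] at[of "y - k / t"] t by (simp_all add: distrib_left right_diff_distrib)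
    note e = this[of 1] this[of 2]
    have "pi * t * kernel (t * y) = pi * t * (4 * (t * \<bar>y + 1 / t\<bar>) + 4 * (t * \<bar>y - 1 / t\<bar>)
        - 6 * (t * \<bar>y\<bar>) - t * \<bar>y + 2 / t\<bar> - t * \<bar>y - 2 / t\<bar>)"
      unfolding e at[of y] kernel_def by simp
    then show ?thesis by (simp add: power2_eq_square algebra_simps)
  qed
  ultimately show ?thesis by simp
qed

text \<open>With \<open>F\<close> frozen at \<open>z\<close> and \<phi> linearised there the
  integral is 0, so only the freezing errors remain: \<open>e2\<close> meets the bound 4 on the
  kernel, \<open>e1\<close> its Lipschitz constant 16, and \<open>2 * R\<close> is the length of the
  interval.\<close>

lemma kernel_almost_affine_bound:
  assumes R: "0 \<le> R" and t: "0 < t" and D: "D \<noteq> 0" and sup: "t * \<bar>\<phi> z\<bar> + 2 \<le> t * \<bar>D\<bar> * R"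
    and cont: "continuous_on {z - R..z + R} F" "continuous_on {z - R..z + R} \<phi>"
    and \<phi>: "\<And>x. x \<in> {z - R..z + R} \<Longrightarrow> \<bar>\<phi> x - \<phi> z - D * (x - z)\<bar> \<le> e1"
    and F: "\<And>x. x \<in> {z - R..z + R} \<Longrightarrow> \<bar>F x - F z\<bar> \<le> e2"
    and F0: "\<bar>F z\<bar> \<le> B"
  shows "\<bar>integral {z - R..z + R} (\<lambda>x. F x * kernel (t * \<phi> x))\<bar> \<le> 2 * R * (4 * e2 + 16 * B * (t * e1))"
proof -
  let ?I = "{z - R..z + R}"
  let ?a = "\<lambda>x. F z * kernel (t * \<phi> z + t * D * (x - z))"
  have a0: "(?a has_integral 0) ?I"
    using has_integral_mult_right[OF kernel_affine_has_integral_0[of R "t * D" "t * \<phi> z" z], of "F z"]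
    using R t D sup by (auto simp: abs_mult)
  have i1: "(\<lambda>x. F x * kernel (t * \<phi> x)) integrable_on ?I"
    by (intro integrable_continuous_interval continuous_intros cont)
  have "integral ?I (\<lambda>x. F x * kernel (t * \<phi> x) - ?a x) = integral ?I (\<lambda>x. F x * kernel (t * \<phi> x)) - 0"
    using integral_diff[OF i1 has_integral_integrable[OF a0]] integral_unique[OF a0] by simp
  moreover have "norm (integral ?I (\<lambda>x. F x * kernel (t * \<phi> x) - ?a x)) \<le> (4 * e2 + 16 * B * (t * e1)) * (z + R - (z - R))"
  proof (rule integral_bound)
    show "continuous_on ?I (\<lambda>x. F x * kernel (t * \<phi> x) - ?a x)"
      by (intro continuous_intros cont)
    fix x assume x: "x \<in> ?I"
    have e: "F x * kernel (t * \<phi> x) - ?a x = (F x - F z) * kernel (t * \<phi> x)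
        + F z * (kernel (t * \<phi> x) - kernel (t * \<phi> z + t * D * (x - z)))"
      by (simp add: algebra_simps)
    have "\<bar>(F x - F z) * kernel (t * \<phi> x)\<bar> \<le> e2 * 4"
      unfolding abs_mult by (intro mult_mono F x abs_kernel_le order_trans[OF _ F[OF x]]) auto
    moreover have "\<bar>kernel (t * \<phi> x) - kernel (t * \<phi> z + t * D * (x - z))\<bar> \<le> 16 * (t * e1)"
    proof -
      have "\<bar>t * \<phi> x - (t * \<phi> z + t * D * (x - z))\<bar> = t * \<bar>\<phi> x - \<phi> z - D * (x - z)\<bar>"
        using abs_mult[of t "\<phi> x - \<phi> z - D * (x - z)"] t by (simp add: right_diff_distrib mult.assoc)
      also have "\<dots> \<le> t * e1" using t \<phi>[OF x] by simp
      finally show ?thesis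
        using kernel_lipschitz[of "t * \<phi> x" "t * \<phi> z + t * D * (x - z)"]
        by (elim order_trans) simp
    qed
    then have "\<bar>F z * (kernel (t * \<phi> x) - kernel (t * \<phi> z + t * D * (x - z)))\<bar> \<le> B * (16 * (t * e1))"
      unfolding abs_mult using F0 by (intro mult_mono) auto
    ultimately show "norm (F x * kernel (t * \<phi> x) - ?a x) \<le> 4 * e2 + 16 * B * (t * e1)"
      unfolding e real_norm_def by (intro order_trans[OF abs_triangle_ineq]) linarith
  qed (use R in auto)
  ultimately show ?thesis by (simp add: algebra_simps)
qed

section \<open>Slopes of compositions\<close>

lemma space_SigmaM: "space (SigmaM m) = {i. \<forall>k. i k < m}"
  by (auto simp: SigmaM_def space_PiM PiE_def Pi_def extensional_def)

lemma length_prefix_word [simp]: "length (prefix_word i n) = n"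
  by (simp add: prefix_word_def)

lemma nth_prefix_word [simp]: "k < n \<Longrightarrow> prefix_word i n ! k = i k"
  by (simp add: prefix_word_def)

lemma prefix_word_in_words: "i \<in> space (SigmaM m) \<Longrightarrow> prefix_word i n \<in> words m"
  by (auto simp: words_def prefix_word_def space_SigmaM)

lemma prefix_word_add: "prefix_word i (n + k) = prefix_word i n @ prefix_word (\<lambda>l. i (n + l)) k"
  by (rule nth_equalityI) (auto simp: nth_append)

lemma prefix_word_eq_iff: "prefix_word i n = prefix_word j n \<longleftrightarrow> (\<forall>k<n. i k = j k)"
  by (auto simp: list_eq_iff_nth_eq)

lemma comp_word_append: "comp_word f lam (v @ w) x = comp_word f lam v (comp_word f lam w x)"
  by (induction v) auto

lemma exp_minus_1_le: "exp y - 1 \<le> y * exp y" for y :: real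
  using exp_ge_add_one_self[of "- y"] by (simp add: exp_minus field_simps)

text \<open>(MA1)-(MA4) in the form in which they act below, with one constant \<open>K\<close>:
  \<open>f1\<close> is the derivative in the point, \<open>fl\<close> the first-order coefficient in
  the parameter, and regularity is expressed by increments.\<close>

locale parametrized_ifs =
  fixes m :: nat and a b u0 u1 :: real and f f1 fl :: "real \<Rightarrow> nat \<Rightarrow> real \<Rightarrow> real"
    and K \<gamma>1 \<gamma>2 \<delta> :: real
  assumes ab: "a < b" and U: "u0 < u1"
    and delta: "0 < \<delta>" "\<delta> < 1"
    and K: "0 \<le> K" and gam1: "0 < \<gamma>1" and gam2: "0 < \<gamma>2" "\<gamma>2 < 1"
    and maps: "\<And>lam j x. lam \<in> {u0..u1} \<Longrightarrow> j < m \<Longrightarrow> x \<in> {a..b} \<Longrightarrow> f lam j x \<in> {a..b}"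
    and deriv: "\<And>lam j x. lam \<in> {u0..u1} \<Longrightarrow> j < m \<Longrightarrow> x \<in> {a..b} \<Longrightarrow>
        (f lam j has_real_derivative f1 lam j x) (at x within {a..b})"
    and f1_ge: "\<And>lam j x. lam \<in> {u0..u1} \<Longrightarrow> j < m \<Longrightarrow> x \<in> {a..b} \<Longrightarrow> \<gamma>1 \<le> \<bar>f1 lam j x\<bar>"
    and f1_le: "\<And>lam j x. lam \<in> {u0..u1} \<Longrightarrow> j < m \<Longrightarrow> x \<in> {a..b} \<Longrightarrow> \<bar>f1 lam j x\<bar> \<le> \<gamma>2"
    and f1_lipschitz: "\<And>lam lam' j x x'. lam \<in> {u0..u1} \<Longrightarrow> lam' \<in> {u0..u1} \<Longrightarrow> j < m \<Longrightarrow>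
        x \<in> {a..b} \<Longrightarrow> x' \<in> {a..b} \<Longrightarrow> \<bar>f1 lam j x - f1 lam' j x'\<bar> \<le> K * (\<bar>x - x'\<bar> + \<bar>lam - lam'\<bar>)"
    and f_lipschitz: "\<And>lam lam' j x. lam \<in> {u0..u1} \<Longrightarrow> lam' \<in> {u0..u1} \<Longrightarrow> j < m \<Longrightarrow>
        x \<in> {a..b} \<Longrightarrow> \<bar>f lam j x - f lam' j x\<bar> \<le> K * \<bar>lam - lam'\<bar>"
    and fl_le: "\<And>lam j x. lam \<in> {u0..u1} \<Longrightarrow> j < m \<Longrightarrow> x \<in> {a..b} \<Longrightarrow> \<bar>fl lam j x\<bar> \<le> K"
    and f_taylor: "\<And>lam lam' j x. lam \<in> {u0..u1} \<Longrightarrow> lam' \<in> {u0..u1} \<Longrightarrow> j < m \<Longrightarrow>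
        x \<in> {a..b} \<Longrightarrow> \<bar>f lam j x - f lam' j x - fl lam' j x * (lam - lam')\<bar> \<le> K * \<bar>lam - lam'\<bar> powr (1 + \<delta>)"
begin

text \<open>Averaging the derivative over the segment, instead of taking the difference quotient, gives the
  right value also on the diagonal \<open>x = y\<close>, which is where the projections of two sequences meet.\<close>

definition slope :: "real \<Rightarrow> nat \<Rightarrow> real \<Rightarrow> real \<Rightarrow> real" where
  "slope lam j x y = integral {0..1} (\<lambda>s. f1 lam j (y + s * (x - y)))"

lemma segment_in:
  assumes "x \<in> {a..b}" "y \<in> {a..b}" "s \<in> {0..1}" shows "y + s * (x - y) \<in> {a..b}"
proof -
  have "(1 - s) *\<^sub>R y + s *\<^sub>R x \<in> {a..b}"
    using assms by (intro convexD[OF convex_real_interval(5)]) auto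
  then show ?thesis by (simp add: algebra_simps)
qed

lemma continuous_on_f1: "lam \<in> {u0..u1} \<Longrightarrow> j < m \<Longrightarrow> continuous_on {a..b} (f1 lam j)"
  by (rule lipschitz_on_continuous_on[where L=K], rule lipschitz_onI)
     (use f1_lipschitz[of lam lam j] K in \<open>auto simp: dist_real_def\<close>)

lemma continuous_on_f1_segment:
  assumes "lam \<in> {u0..u1}" "j < m" "x \<in> {a..b}" "y \<in> {a..b}"
  shows "continuous_on {0..1} (\<lambda>s. f1 lam j (y + s * (x - y)))"
  by (rule continuous_on_compose2[OF continuous_on_f1])
     (use assms segment_in in \<open>auto intro!: continuous_intros\<close>)

lemma f_diff_eq_slope:
  assumes "lam \<in> {u0..u1}" "j < m" "x \<in> {a..b}" "y \<in> {a..b}"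
  shows "f lam j x - f lam j y = slope lam j x y * (x - y)"
proof -
  have "((\<lambda>s. f1 lam j (y + s * (x - y)) * (x - y)) has_integral
      f lam j (y + 1 * (x - y)) - f lam j (y + 0 * (x - y))) {0..1}"
  proof (intro fundamental_theorem_of_calculus)
    fix s :: real assume s: "s \<in> {0..1}"
    have "((\<lambda>s. f lam j (y + s * (x - y))) has_real_derivative f1 lam j (y + s * (x - y)) * (x - y)) (at s within {0..1})"
    proof -
      have "(f lam j has_real_derivative f1 lam j (y + s * (x - y))) (at (y + s * (x - y)) within (\<lambda>s. y + s * (x - y)) ` {0..1})"
        by (rule DERIV_subset[OF deriv]) (use assms segment_in s in auto)
      moreover have "((\<lambda>s. y + s * (x - y)) has_real_derivative (x - y)) (at s within {0..1})"
        by (auto intro!: derivative_eq_intros)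
      ultimately show ?thesis
        using DERIV_image_chain[of "f lam j" _ "\<lambda>s. y + s * (x - y)" s "{0..1}"] by (simp add: o_def)
    qed
    then show "((\<lambda>s. f lam j (y + s * (x - y))) has_vector_derivative f1 lam j (y + s * (x - y)) * (x - y)) (at s within {0..1})"
      by (simp add: has_real_derivative_iff_has_vector_derivative)
  qed auto
  then show ?thesis by (simp add: slope_def integral_unique flip: integral_mult_left)
qed

text \<open>A change of sign could make the average in \<open>slope\<close> cancel. Since the image
  of the interval under \<open>f1\<close> is connected and avoids 0, there is none, and the slope
  inherits the lower bound \<gamma>1.\<close>

lemma f1_sgn:
  assumes "lam \<in> {u0..u1}" "j < m"
  shows "(\<forall>x\<in>{a..b}. f1 lam j x > 0) \<or> (\<forall>x\<in>{a..b}. f1 lam j x < 0)"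
proof (rule ccontr)
  assume "\<not> ?thesis"
  then obtain x y where xy: "x \<in> {a..b}" "y \<in> {a..b}" "f1 lam j x \<le> 0" "f1 lam j y \<ge> 0"
    by (auto simp: not_less)
  have "connected (f1 lam j ` {a..b})"
    by (intro connected_continuous_image continuous_on_f1 assms) auto
  then have "0 \<in> f1 lam j ` {a..b}"
    using xy by (auto simp: connected_iff_interval)
  then show False using f1_ge[OF assms] gam1 by force
qed

lemma slope_bounds:
  assumes "lam \<in> {u0..u1}" "j < m" "x \<in> {a..b}" "y \<in> {a..b}"
  shows "\<gamma>1 \<le> \<bar>slope lam j x y\<bar>" "\<bar>slope lam j x y\<bar> \<le> \<gamma>2"
proof -
  let ?g = "\<lambda>s. f1 lam j (y + s * (x - y))"
  have i: "?g integrable_on {0..1}"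
    by (intro integrable_continuous_interval continuous_on_f1_segment assms)
  have seg: "y + s * (x - y) \<in> {a..b}" if "s \<in> {0..1}" for s
    using segment_in assms that by auto
  have "norm (integral {0..1} ?g) \<le> \<gamma>2 * (1 - 0)"
    by (rule integral_bound) (use continuous_on_f1_segment[OF assms] f1_le[OF assms(1,2) seg] in auto)
  then show "\<bar>slope lam j x y\<bar> \<le> \<gamma>2" by (simp add: slope_def)
  consider "\<forall>x\<in>{a..b}. f1 lam j x > 0" | "\<forall>x\<in>{a..b}. f1 lam j x < 0"
    using f1_sgn[OF assms(1,2)] by auto
  then show "\<gamma>1 \<le> \<bar>slope lam j x y\<bar>"
  proof cases
    case 1
    have "integral {0..1} (\<lambda>s::real. \<gamma>1) \<le> integral {0..1} ?g"
      by (rule integral_le[OF _ i]) (use 1 f1_ge[OF assms(1,2) seg] seg in force)+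
    then show ?thesis using gam1 by (simp add: slope_def)
  next
    case 2
    have "integral {0..1} ?g \<le> integral {0..1} (\<lambda>s::real. - \<gamma>1)"
      by (rule integral_le[OF i]) (use 2 f1_ge[OF assms(1,2) seg] seg in force)+
    then show ?thesis using gam1 by (simp add: slope_def)
  qed
qed

lemma slope_lipschitz:
  assumes "lam \<in> {u0..u1}" "lam' \<in> {u0..u1}" "j < m" "x \<in> {a..b}" "y \<in> {a..b}" "x' \<in> {a..b}" "y' \<in> {a..b}"
    and e: "\<bar>x - x'\<bar> \<le> e" "\<bar>y - y'\<bar> \<le> e"
  shows "\<bar>slope lam j x y - slope lam' j x' y'\<bar> \<le> K * (e + \<bar>lam - lam'\<bar>)"
proof -
  let ?g = "\<lambda>s. f1 lam j (y + s * (x - y))" and ?h = "\<lambda>s. f1 lam' j (y' + s * (x' - y'))"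
  have c: "continuous_on {0..1} ?g" "continuous_on {0..1} ?h"
    using assms by (auto intro!: continuous_on_f1_segment)
  have "norm (integral {0..1} (\<lambda>s. ?g s - ?h s)) \<le> (K * (e + \<bar>lam - lam'\<bar>)) * (1 - 0)"
  proof (rule integral_bound)
    fix s :: real assume s: "s \<in> {0..1}"
    have "\<bar>y + s * (x - y) - (y' + s * (x' - y'))\<bar> = \<bar>(1 - s) * (y - y') + s * (x - x')\<bar>"
      by (simp add: algebra_simps)
    also have "\<dots> \<le> (1 - s) * e + s * e"
      using s e by (intro order_trans[OF abs_triangle_ineq] add_mono) (auto simp: abs_mult intro!: mult_left_mono)
    finally have "\<bar>y + s * (x - y) - (y' + s * (x' - y'))\<bar> \<le> e" by (simp add: algebra_simps)
    then have "K * (\<bar>y + s * (x - y) - (y' + s * (x' - y'))\<bar> + \<bar>lam - lam'\<bar>) \<le> K * (e + \<bar>lam - lam'\<bar>)"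
      using K by (intro mult_left_mono) auto
    then show "norm (?g s - ?h s) \<le> K * (e + \<bar>lam - lam'\<bar>)"
      using f1_lipschitz[OF assms(1-3) segment_in[OF assms(4,5) s] segment_in[OF assms(6,7) s]]
      by simp
  qed (use c in \<open>auto intro!: continuous_intros\<close>)
  then show ?thesis
    using c by (simp add: slope_def integral_diff integrable_continuous_interval)
qed

lemma comp_word_in:
  "lam \<in> {u0..u1} \<Longrightarrow> w \<in> words m \<Longrightarrow> x \<in> {a..b} \<Longrightarrow> comp_word f lam w x \<in> {a..b}"
proof (induction w)
  case (Cons j w)
  then show ?case using maps[of lam j "comp_word f lam w x"] by (simp add: words_def)
qed simp

text \<open>The chain rule for difference quotients: each letter contributes its slope between the
  images of the two points under the remaining suffix. Applied to a common prefix, this is the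
  factor Q.\<close>

fun word_slope :: "real \<Rightarrow> nat list \<Rightarrow> real \<Rightarrow> real \<Rightarrow> real" where
  "word_slope lam [] x y = 1"
| "word_slope lam (j # w) x y = slope lam j (comp_word f lam w x) (comp_word f lam w y) * word_slope lam w x y"

lemma comp_word_diff_eq:
  assumes "lam \<in> {u0..u1}" "w \<in> words m" "x \<in> {a..b}" "y \<in> {a..b}"
  shows "comp_word f lam w x - comp_word f lam w y = word_slope lam w x y * (x - y)"
  using assms(2)
proof (induction w)
  case (Cons j w)
  then have "w \<in> words m" "j < m" by (auto simp: words_def)
  then show ?case
    using Cons.IH f_diff_eq_slope[of lam j "comp_word f lam w x" "comp_word f lam w y"]
      comp_word_in assms by simp
qed simp

lemma word_slope_bounds:
  assumes "lam \<in> {u0..u1}" "w \<in> words m" "x \<in> {a..b}" "y \<in> {a..b}"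
  shows "0 < \<bar>word_slope lam w x y\<bar>" "\<bar>word_slope lam w x y\<bar> \<le> \<gamma>2 ^ length w"
proof -
  have "0 < \<bar>word_slope lam w x y\<bar> \<and> \<bar>word_slope lam w x y\<bar> \<le> \<gamma>2 ^ length w"
    using assms(2)
  proof (induction w)
    case (Cons j w)
    then have w: "w \<in> words m" "j < m" by (auto simp: words_def)
    note s = slope_bounds[OF assms(1) w(2) comp_word_in[OF assms(1) w(1) assms(3)] comp_word_in[OF assms(1) w(1) assms(4)]]
    show ?case
      using Cons.IH[OF w(1)] s gam1 gam2 by (auto simp: abs_mult intro!: mult_mono)
  qed simp
  then show "0 < \<bar>word_slope lam w x y\<bar>" "\<bar>word_slope lam w x y\<bar> \<le> \<gamma>2 ^ length w" by auto
qed

text \<open>The solution of \<open>L = K + \<gamma>2 * L\<close>: a letter contracts the parameter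
  dependence of the suffix and adds its own, so the Lipschitz constant in the parameter is uniform
  in the word length.\<close>

definition lip_const :: real where "lip_const = K / (1 - \<gamma>2)"

lemma lip_const: "0 \<le> lip_const" "K + \<gamma>2 * lip_const = lip_const"
  using K gam2 by (auto simp: lip_const_def field_simps)

lemma f_contract:
  assumes "lam \<in> {u0..u1}" "j < m" "x \<in> {a..b}" "y \<in> {a..b}"
  shows "\<bar>f lam j x - f lam j y\<bar> \<le> \<gamma>2 * \<bar>x - y\<bar>"
  using f_diff_eq_slope[OF assms] slope_bounds[OF assms] by (auto simp: abs_mult intro!: mult_right_mono)

lemma comp_word_lipschitz:
  assumes "lam \<in> {u0..u1}" "lam' \<in> {u0..u1}" "w \<in> words m" "x \<in> {a..b}" "x' \<in> {a..b}"
  shows "\<bar>comp_word f lam w x - comp_word f lam' w x'\<bar> \<le> \<gamma>2 ^ length w * \<bar>x - x'\<bar> + lip_const * \<bar>lam - lam'\<bar>"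
  using assms(3)
proof (induction w)
  case (Cons j w)
  then have w: "w \<in> words m" "j < m" by (auto simp: words_def)
  let ?p = "comp_word f lam w x" and ?q = "comp_word f lam' w x'"
  have pq: "?p \<in> {a..b}" "?q \<in> {a..b}" using comp_word_in w assms by auto
  have "\<bar>f lam j ?p - f lam' j ?q\<bar> \<le> \<bar>f lam j ?p - f lam j ?q\<bar> + \<bar>f lam j ?q - f lam' j ?q\<bar>" by simp
  also have "\<dots> \<le> \<gamma>2 * \<bar>?p - ?q\<bar> + K * \<bar>lam - lam'\<bar>"
    by (intro add_mono f_contract f_lipschitz pq assms w)
  also have "\<dots> \<le> \<gamma>2 * (\<gamma>2 ^ length w * \<bar>x - x'\<bar> + lip_const * \<bar>lam - lam'\<bar>) + K * \<bar>lam - lam'\<bar>"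
    using Cons.IH[OF w(1)] gam2 by auto
  also have "\<dots> = \<gamma>2 ^ length (j # w) * \<bar>x - x'\<bar> + (K + \<gamma>2 * lip_const) * \<bar>lam - lam'\<bar>"
    by (simp add: algebra_simps)
  finally show ?case unfolding lip_const(2) by simp
qed (use lip_const in auto)

text \<open>Bounded distortion, jointly in the points and the parameter. A letter followed by k
  others changes its slope by a relative error of at most K / \<gamma>1 times (e \<gamma>2^k +
  (lip_const + 1) |lam - lam'|). The first term sums geometrically; the second accumulates linearly
  in the word length, which is where the loss exp(kappa N) for Q originates.\<close>

lemma word_slope_ratio:
  assumes "lam \<in> {u0..u1}" "lam' \<in> {u0..u1}" "w \<in> words m" "x \<in> {a..b}" "y \<in> {a..b}" "x' \<in> {a..b}" "y' \<in> {a..b}"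
    and e: "\<bar>x - x'\<bar> \<le> e" "\<bar>y - y'\<bar> \<le> e"
  defines "S \<equiv> \<lambda>k. K / \<gamma>1 * (e * (1 - \<gamma>2 ^ k) / (1 - \<gamma>2) + real k * (lip_const + 1) * \<bar>lam - lam'\<bar>)"
  shows "\<bar>word_slope lam w x y - word_slope lam' w x' y'\<bar> \<le> \<bar>word_slope lam' w x' y'\<bar> * (exp (S (length w)) - 1)"
  using assms(3)
proof (induction w)
  case Nil
  then show ?case by (simp add: S_def)
next
  case (Cons j w)
  then have w: "w \<in> words m" "j < m" by (auto simp: words_def)
  have e0: "0 \<le> e" using e by auto
  define q q' where "q = slope lam j (comp_word f lam w x) (comp_word f lam w y)"
    and "q' = slope lam' j (comp_word f lam' w x') (comp_word f lam' w y')"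
  define Q Q' where "Q = word_slope lam w x y" and "Q' = word_slope lam' w x' y'"
  define d where "d = K / \<gamma>1 * (e * \<gamma>2 ^ length w + (lip_const + 1) * \<bar>lam - lam'\<bar>)"
  define T where "T = exp (S (length w)) - 1"
  note cw = comp_word_in[OF _ w(1)]
  have d0: "0 \<le> d" unfolding d_def using K gam1 gam2 e0 lip_const(1) by (intro mult_nonneg_nonneg add_nonneg_nonneg) auto
  have l: "\<bar>comp_word f lam w z - comp_word f lam' w z'\<bar> \<le> \<gamma>2 ^ length w * e + lip_const * \<bar>lam - lam'\<bar>"
    if "z \<in> {a..b}" "z' \<in> {a..b}" "\<bar>z - z'\<bar> \<le> e" for z z'
    using comp_word_lipschitz[OF assms(1,2) w(1) that(1,2)] that(3) gam2
    by (elim order_trans) (auto intro!: mult_left_mono)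
  have "\<bar>q - q'\<bar> \<le> K * (\<gamma>2 ^ length w * e + lip_const * \<bar>lam - lam'\<bar> + \<bar>lam - lam'\<bar>)"
    unfolding q_def q'_def by (intro slope_lipschitz l cw assms w)
  also have "\<dots> = \<gamma>1 * d" using gam1 by (simp add: d_def algebra_simps)
  also have "\<dots> \<le> \<bar>q'\<bar> * d"
    unfolding q'_def by (intro mult_right_mono slope_bounds cw assms w d0)
  finally have 1: "\<bar>q - q'\<bar> \<le> \<bar>q'\<bar> * d" .
  have 2: "\<bar>Q - Q'\<bar> \<le> \<bar>Q'\<bar> * T"
    using Cons.IH[OF w(1)] by (simp add: Q_def Q'_def T_def)
  have SS: "S (Suc (length w)) = d + S (length w)"
    using gam2 gam1 by (simp add: S_def d_def field_simps)
  \<comment> \<open>Relative errors \<open>d\<close> and \<open>T\<close> of the two factors combine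
    to \<open>(1 + d) * (1 + T) - 1\<close>, and \<open>1 + d \<le> exp d\<close> turns the product
    into a sum of exponents.\<close>
  have "q * Q - q' * Q' = (q - q') * (Q - Q') + (q - q') * Q' + q' * (Q - Q')"
    by (simp add: algebra_simps)
  also have "\<bar>\<dots>\<bar> \<le> \<bar>q - q'\<bar> * \<bar>Q - Q'\<bar> + \<bar>q - q'\<bar> * \<bar>Q'\<bar> + \<bar>q'\<bar> * \<bar>Q - Q'\<bar>"
    unfolding abs_mult[symmetric] by linarith
  also have "\<dots> \<le> (\<bar>q'\<bar> * d) * (\<bar>Q'\<bar> * T) + (\<bar>q'\<bar> * d) * \<bar>Q'\<bar> + \<bar>q'\<bar> * (\<bar>Q'\<bar> * T)"
    using 1 2 d0 by (intro add_mono mult_mono) auto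
  also have "\<dots> = \<bar>q' * Q'\<bar> * ((1 + d) * (1 + T) - 1)"
    by (simp add: abs_mult algebra_simps)
  also have "\<dots> \<le> \<bar>q' * Q'\<bar> * (exp d * exp (S (length w)) - 1)"
    unfolding T_def using exp_ge_add_one_self[of d] by (intro mult_left_mono diff_right_mono) auto
  also have "\<dots> = \<bar>q' * Q'\<bar> * (exp (S (length (j # w))) - 1)"
    by (simp add: SS exp_add)
  finally show ?case by (simp add: q_def q'_def Q_def Q'_def)
qed

end

section \<open>The projection as a function of the parameter\<close>

lemma sets_cyl: "cyl m w \<in> sets (SigmaM m)"
proof -
  have "{i \<in> space (SigmaM m). \<forall>k\<in>{..<length w}. i k = w ! k} \<in> sets (SigmaM m)"
  proof (rule sets.sets_Collect_finite_All)
    fix k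
    have m: "w ! k < m" if "i \<in> space (SigmaM m)" "i k = w ! k" for i
      using that unfolding space_SigmaM by (metis mem_Collect_eq)
    have "(\<lambda>i. i k) \<in> SigmaM m \<rightarrow>\<^sub>M count_space {0..<m}"
      unfolding SigmaM_def by (rule measurable_component_singleton) simp
    then have "(\<lambda>i. i k) -` ({w ! k} \<inter> {0..<m}) \<inter> space (SigmaM m) \<in> sets (SigmaM m)"
      by (rule measurable_sets) simp
    moreover have "(\<lambda>i. i k) -` ({w ! k} \<inter> {0..<m}) \<inter> space (SigmaM m) = {i \<in> space (SigmaM m). i k = w ! k}"
      using m by auto
    ultimately show "{i \<in> space (SigmaM m). i k = w ! k} \<in> sets (SigmaM m)" by simp
  qed simp
  then show ?thesis unfolding cyl_def Ball_def lessThan_iff .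
qed

lemma mem_cyl_iff: "i \<in> cyl m w \<longleftrightarrow> i \<in> space (SigmaM m) \<and> prefix_word i (length w) = w"
  by (auto simp: cyl_def list_eq_iff_nth_eq)

lemma measurable_prefix_word: "(\<lambda>i. prefix_word i n) \<in> SigmaM m \<rightarrow>\<^sub>M count_space UNIV"
proof (subst measurable_count_space_eq2_countable, intro conjI ballI)
  fix w :: "nat list"
  have "(\<lambda>i. prefix_word i n) -` {w} \<inter> space (SigmaM m) = (if length w = n then cyl m w else {})"
    by (auto simp: mem_cyl_iff)
  then show "(\<lambda>i. prefix_word i n) -` {w} \<inter> space (SigmaM m) \<in> sets (SigmaM m)"
    by (simp add: sets_cyl)
qed auto

context parametrized_ifs
begin

lemma comp_word_prefix_cauchy:
  assumes "lam \<in> {u0..u1}" "i \<in> space (SigmaM m)" "n \<le> p"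
  shows "\<bar>comp_word f lam (prefix_word i n) a - comp_word f lam (prefix_word i p) a\<bar> \<le> \<gamma>2 ^ n * (b - a)"
proof -
  obtain k where p: "p = n + k" using assms(3) le_Suc_ex by blast
  define y where "y = comp_word f lam (prefix_word (\<lambda>l. i (n + l)) k) a"
  have y: "y \<in> {a..b}"
    unfolding y_def using assms ab by (intro comp_word_in prefix_word_in_words) (auto simp: space_SigmaM)
  have "\<bar>comp_word f lam (prefix_word i n) a - comp_word f lam (prefix_word i n) y\<bar> \<le> \<gamma>2 ^ n * \<bar>a - y\<bar>"
    using comp_word_lipschitz[OF assms(1,1) prefix_word_in_words[OF assms(2), of n], of a y] y ab by simp
  also have "\<dots> \<le> \<gamma>2 ^ n * (b - a)" using y gam2 by (intro mult_left_mono) auto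
  finally show ?thesis by (simp add: p prefix_word_add comp_word_append y_def)
qed

lemma Proj_tendsto:
  assumes "lam \<in> {u0..u1}" "i \<in> space (SigmaM m)"
  shows "(\<lambda>n. comp_word f lam (prefix_word i n) a) \<longlonglongrightarrow> Proj f a lam i"
proof -
  have "Cauchy (\<lambda>n. comp_word f lam (prefix_word i n) a)"
    unfolding Cauchy_altdef2
  proof (intro allI impI)
    fix e :: real assume e: "0 < e"
    then obtain N where N: "\<gamma>2 ^ N < e / (b - a)"
      using real_arch_pow_inv[of "e / (b - a)" \<gamma>2] gam2 ab by auto
    have "dist (comp_word f lam (prefix_word i n) a) (comp_word f lam (prefix_word i N) a) < e" if "N \<le> n" for n
      using comp_word_prefix_cauchy[OF assms that] N ab
      by (simp add: dist_real_def abs_minus_commute field_simps)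
    then show "\<exists>N. \<forall>n\<ge>N. dist (comp_word f lam (prefix_word i n) a) (comp_word f lam (prefix_word i N) a) < e"
      by blast
  qed
  then show ?thesis
    unfolding Proj_def using Cauchy_convergent convergent_LIMSEQ_iff by blast
qed

lemma Proj_in:
  assumes "lam \<in> {u0..u1}" "i \<in> space (SigmaM m)"
  shows "Proj f a lam i \<in> {a..b}"
proof (rule closed_sequentially[OF closed_real_atLeastAtMost _ Proj_tendsto[OF assms]])
  show "\<And>n. comp_word f lam (prefix_word i n) a \<in> {a..b}"
    using ab by (intro comp_word_in assms prefix_word_in_words) auto
qed

lemma Proj_split:
  assumes "lam \<in> {u0..u1}" "i \<in> space (SigmaM m)"
  shows "Proj f a lam i = comp_word f lam (prefix_word i n) (Proj f a lam (\<lambda>l. i (n + l)))"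
proof -
  let ?j = "\<lambda>l. i (n + l)"
  have j: "?j \<in> space (SigmaM m)" using assms by (auto simp: space_SigmaM)
  have "continuous_on {a..b} (comp_word f lam (prefix_word i n))"
  proof (rule lipschitz_on_continuous_on[where L="\<gamma>2 ^ n"], rule lipschitz_onI)
    fix x y assume "x \<in> {a..b}" "y \<in> {a..b}"
    then show "dist (comp_word f lam (prefix_word i n) x) (comp_word f lam (prefix_word i n) y) \<le> \<gamma>2 ^ n * dist x y"
      using comp_word_lipschitz[OF assms(1,1) prefix_word_in_words[OF assms(2), of n], of x y]
      by (simp add: dist_real_def)
  qed (use gam2 in auto)
  then have "(\<lambda>k. comp_word f lam (prefix_word i n) (comp_word f lam (prefix_word ?j k) a))
      \<longlonglongrightarrow> comp_word f lam (prefix_word i n) (Proj f a lam ?j)"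
  proof (rule continuous_on_tendsto_compose[OF _ Proj_tendsto[OF assms(1) j] Proj_in[OF assms(1) j]])
    show "\<forall>\<^sub>F k in sequentially. comp_word f lam (prefix_word ?j k) a \<in> {a..b}"
      using ab by (intro always_eventually allI comp_word_in assms prefix_word_in_words j) auto
  qed
  moreover have "(\<lambda>k. comp_word f lam (prefix_word i n) (comp_word f lam (prefix_word ?j k) a)) \<longlonglongrightarrow> Proj f a lam i"
    using LIMSEQ_ignore_initial_segment[OF Proj_tendsto[OF assms], of n]
    by (simp add: prefix_word_add comp_word_append add.commute[of _ n])
  ultimately show ?thesis using LIMSEQ_unique by blast
qed

lemma Proj_prefix:
  assumes "lam \<in> {u0..u1}" "i \<in> space (SigmaM m)" "j \<in> space (SigmaM m)" "prefix_word i n = prefix_word j n"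
  shows "\<bar>Proj f a lam i - Proj f a lam j\<bar> \<le> \<gamma>2 ^ n * (b - a)"
proof -
  have s: "(\<lambda>l. i (n + l)) \<in> space (SigmaM m)" "(\<lambda>l. j (n + l)) \<in> space (SigmaM m)"
    using assms by (auto simp: space_SigmaM)
  let ?x = "Proj f a lam (\<lambda>l. i (n + l))" and ?y = "Proj f a lam (\<lambda>l. j (n + l))"
  note xy = Proj_in[OF assms(1) s(1)] Proj_in[OF assms(1) s(2)]
  have "\<bar>Proj f a lam i - Proj f a lam j\<bar> \<le> \<gamma>2 ^ n * \<bar>?x - ?y\<bar>"
    unfolding Proj_split[OF assms(1,2), of n] Proj_split[OF assms(1,3), of n] assms(4)
    using comp_word_lipschitz[OF assms(1,1) prefix_word_in_words[OF assms(3), of n] xy] by simp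
  also have "\<dots> \<le> \<gamma>2 ^ n * (b - a)"
    using xy gam2 by (intro mult_left_mono) auto
  finally show ?thesis .
qed

lemma Proj_lipschitz:
  assumes "lam \<in> {u0..u1}" "lam' \<in> {u0..u1}" "i \<in> space (SigmaM m)"
  shows "\<bar>Proj f a lam i - Proj f a lam' i\<bar> \<le> lip_const * \<bar>lam - lam'\<bar>"
proof (rule tendsto_upperbound)
  show "(\<lambda>n. \<bar>comp_word f lam (prefix_word i n) a - comp_word f lam' (prefix_word i n) a\<bar>)
      \<longlonglongrightarrow> \<bar>Proj f a lam i - Proj f a lam' i\<bar>"
    by (intro tendsto_intros Proj_tendsto assms)
  show "\<forall>\<^sub>F n in sequentially. \<bar>comp_word f lam (prefix_word i n) a - comp_word f lam' (prefix_word i n) a\<bar> \<le> lip_const * \<bar>lam - lam'\<bar>"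
    using comp_word_lipschitz[OF assms(1,2) prefix_word_in_words[OF assms(3)], of a a] ab
    by (auto intro!: always_eventually)
qed simp

lemma measurable_Proj:
  assumes "lam \<in> {u0..u1}"
  shows "Proj f a lam \<in> borel_measurable (SigmaM m)"
proof (rule borel_measurable_LIMSEQ_real)
  show "(\<lambda>n. comp_word f lam (prefix_word i n) a) \<longlonglongrightarrow> Proj f a lam i" if "i \<in> space (SigmaM m)" for i
    by (rule Proj_tendsto[OF assms that])
  show "(\<lambda>i. comp_word f lam (prefix_word i n) a) \<in> borel_measurable (SigmaM m)" for n
    by (rule measurable_compose[OF measurable_prefix_word]) simp
qed

text \<open>Again a fixed point, of the recursion for remainders in \<open>comp_word_taylor\<close>.
  The factor \<open>1 + (u1 - u0)\<close> pays for replacing the square of an increment by its power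
  1 + \<delta>.\<close>

definition taylor_const :: real where "taylor_const = (K * (lip_const + 1) * lip_const * (1 + (u1 - u0)) + K) / (1 - \<gamma>2)"

lemma taylor_const: "0 \<le> taylor_const" "K * (lip_const + 1) * lip_const * (1 + (u1 - u0)) + K + \<gamma>2 * taylor_const = taylor_const"
proof -
  show "0 \<le> taylor_const"
    unfolding taylor_const_def using K gam2 lip_const U by (intro divide_nonneg_nonneg add_nonneg_nonneg mult_nonneg_nonneg) auto
  show "K * (lip_const + 1) * lip_const * (1 + (u1 - u0)) + K + \<gamma>2 * taylor_const = taylor_const"
    using gam2 by (simp add: taylor_const_def field_simps)
qed

text \<open>Each further letter contracts the remainder by \<gamma>2, so the constant does not grow
  with the word. The uniform bound on \<open>D\<close> is carried along to allow a compactness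
  argument for infinite sequences.\<close>

lemma comp_word_taylor:
  assumes "lam' \<in> {u0..u1}" "w \<in> words m"
  shows "\<exists>D. \<bar>D\<bar> \<le> lip_const \<and> (\<forall>lam\<in>{u0..u1}.
     \<bar>comp_word f lam w a - comp_word f lam' w a - D * (lam - lam')\<bar> \<le> taylor_const * \<bar>lam - lam'\<bar> powr (1 + \<delta>))"
  using assms(2)
proof (induction w)
  case Nil
  then show ?case using lip_const taylor_const by (intro exI[of _ 0]) auto
next
  case (Cons j w)
  then have w: "w \<in> words m" "j < m" by (auto simp: words_def)
  obtain D where D: "\<bar>D\<bar> \<le> lip_const" and IH: "\<And>lam. lam \<in> {u0..u1} \<Longrightarrow>
     \<bar>comp_word f lam w a - comp_word f lam' w a - D * (lam - lam')\<bar> \<le> taylor_const * \<bar>lam - lam'\<bar> powr (1 + \<delta>)"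
    using Cons.IH[OF w(1)] by blast
  have aa: "a \<in> {a..b}" using ab by auto
  define p' where "p' = comp_word f lam' w a"
  have p': "p' \<in> {a..b}" unfolding p'_def by (intro comp_word_in assms w aa)
  define D' where "D' = f1 lam' j p' * D + fl lam' j p'"
  show ?case
  proof (intro exI[of _ D'] conjI ballI)
    have "\<bar>D'\<bar> \<le> \<bar>f1 lam' j p'\<bar> * \<bar>D\<bar> + \<bar>fl lam' j p'\<bar>"
      unfolding D'_def abs_mult[symmetric] by linarith
    also have "\<dots> \<le> \<gamma>2 * lip_const + K"
      using f1_le[OF assms(1) w(2) p'] fl_le[OF assms(1) w(2) p'] D gam2 by (intro add_mono mult_mono) auto
    finally show "\<bar>D'\<bar> \<le> lip_const" using lip_const(2) by simp
    fix lam assume lam: "lam \<in> {u0..u1}"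
    define p where "p = comp_word f lam w a"
    have p: "p \<in> {a..b}" unfolding p_def by (intro comp_word_in lam w aa)
    define dl where "dl = \<bar>lam - lam'\<bar>"
    have dl0: "0 \<le> dl" by (simp add: dl_def)
    have pp: "\<bar>p - p'\<bar> \<le> lip_const * dl"
      using comp_word_lipschitz[OF lam assms(1) w(1) aa aa] by (simp add: p_def p'_def dl_def)
    have s0: "slope lam' j p' p' = f1 lam' j p'" by (simp add: slope_def)
    have "\<bar>slope lam j p p' - slope lam' j p' p'\<bar> \<le> K * (lip_const * dl + dl)"
      unfolding dl_def using pp lip_const by (intro slope_lipschitz lam assms w p p') (auto simp: dl_def)
    then have t1: "\<bar>(slope lam j p p' - f1 lam' j p') * (p - p')\<bar> \<le> K * (lip_const * dl + dl) * (lip_const * dl)"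
      unfolding abs_mult s0 using pp by (intro mult_mono) auto
    \<comment> \<open>The parameter interval may be longer than 1, so
      \<open>dl powr (1 - \<delta>)\<close> is bounded through the base
      \<open>1 + (u1 - u0)\<close>, which is at least 1.\<close>
    have "dl powr (1 - \<delta>) \<le> (1 + (u1 - u0)) powr (1 - \<delta>)"
      using delta lam assms by (intro powr_mono2) (auto simp: dl_def)
    also have "\<dots> \<le> (1 + (u1 - u0)) powr 1" using delta U by (intro powr_mono) auto
    finally have "dl powr (1 - \<delta>) \<le> 1 + (u1 - u0)" using U by simp
    moreover have "dl * dl = dl powr (1 - \<delta>) * dl powr (1 + \<delta>)"
      using dl0 by (cases "dl = 0") (auto simp: powr_add[symmetric] powr_numeral power2_eq_square)
    ultimately have "dl * dl \<le> (1 + (u1 - u0)) * dl powr (1 + \<delta>)"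
      by (simp add: mult_right_mono)
    then have "K * (lip_const + 1) * lip_const * (dl * dl) \<le> K * (lip_const + 1) * lip_const * ((1 + (u1 - u0)) * dl powr (1 + \<delta>))"
      using K lip_const by (intro mult_left_mono) auto
    with t1 have t1: "\<bar>(slope lam j p p' - f1 lam' j p') * (p - p')\<bar> \<le> K * (lip_const + 1) * lip_const * (1 + (u1 - u0)) * dl powr (1 + \<delta>)"
      by (simp add: algebra_simps)
    have t2: "\<bar>f1 lam' j p' * (p - p' - D * (lam - lam'))\<bar> \<le> \<gamma>2 * (taylor_const * dl powr (1 + \<delta>))"
      unfolding abs_mult using IH[OF lam] f1_le[OF assms(1) w(2) p'] gam2
      by (intro mult_mono) (auto simp: p_def p'_def dl_def)
    have t3: "\<bar>f lam j p' - f lam' j p' - fl lam' j p' * (lam - lam')\<bar> \<le> K * dl powr (1 + \<delta>)"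
      unfolding dl_def by (intro f_taylor lam assms w p')
    \<comment> \<open>Three sources of error: the change of slope, quadratic in \<open>dl\<close>;
      the remainder of the suffix, contracted by \<gamma>2; and the explicit dependence of the first
      letter on the parameter.\<close>
    have "f lam j p - f lam' j p' - D' * (lam - lam') =
       (slope lam j p p' - f1 lam' j p') * (p - p') + f1 lam' j p' * (p - p' - D * (lam - lam'))
       + (f lam j p' - f lam' j p' - fl lam' j p' * (lam - lam'))"
      using f_diff_eq_slope[OF lam w(2) p p'] by (simp add: D'_def algebra_simps)
    then have "\<bar>f lam j p - f lam' j p' - D' * (lam - lam')\<bar> \<le>
       K * (lip_const + 1) * lip_const * (1 + (u1 - u0)) * dl powr (1 + \<delta>) + \<gamma>2 * (taylor_const * dl powr (1 + \<delta>)) + K * dl powr (1 + \<delta>)"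
      using t1 t2 t3 by linarith
    also have "\<dots> = (K * (lip_const + 1) * lip_const * (1 + (u1 - u0)) + K + \<gamma>2 * taylor_const) * dl powr (1 + \<delta>)"
      by (simp add: algebra_simps)
    finally show "\<bar>comp_word f lam (j # w) a - comp_word f lam' (j # w) a - D' * (lam - lam')\<bar> \<le> taylor_const * \<bar>lam - lam'\<bar> powr (1 + \<delta>)"
      unfolding taylor_const(2) by (simp add: p_def p'_def dl_def)
  qed
qed

text \<open>The coefficients for the prefixes are known to be bounded, which yields a convergent
  subsequence; the estimate passes to the limit along it because its constant is uniform.\<close>

lemma Proj_taylor:
  assumes "lam' \<in> {u0..u1}" "i \<in> space (SigmaM m)"
  obtains D where "\<And>lam. lam \<in> {u0..u1} \<Longrightarrow>
     \<bar>Proj f a lam i - Proj f a lam' i - D * (lam - lam')\<bar> \<le> taylor_const * \<bar>lam - lam'\<bar> powr (1 + \<delta>)"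
proof -
  have "\<exists>D. \<bar>D\<bar> \<le> lip_const \<and> (\<forall>lam\<in>{u0..u1}.
     \<bar>comp_word f lam (prefix_word i n) a - comp_word f lam' (prefix_word i n) a - D * (lam - lam')\<bar>
       \<le> taylor_const * \<bar>lam - lam'\<bar> powr (1 + \<delta>))" for n
    by (intro comp_word_taylor assms prefix_word_in_words)
  then obtain D where D: "\<And>n. \<bar>D n\<bar> \<le> lip_const" "\<And>n lam. lam \<in> {u0..u1} \<Longrightarrow>
     \<bar>comp_word f lam (prefix_word i n) a - comp_word f lam' (prefix_word i n) a - D n * (lam - lam')\<bar>
       \<le> taylor_const * \<bar>lam - lam'\<bar> powr (1 + \<delta>)"
    by metis
  have "bounded (range D)" using D(1) by (auto simp: bounded_iff)
  then obtain l r where lr: "strict_mono (r :: nat \<Rightarrow> nat)" "(D \<circ> r) \<longlonglongrightarrow> l"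
    using bounded_imp_convergent_subsequence by blast
  show thesis
  proof (rule that[of l])
    fix lam assume lam: "lam \<in> {u0..u1}"
    note sub = LIMSEQ_subseq_LIMSEQ[OF Proj_tendsto lr(1), unfolded o_def]
    show "\<bar>Proj f a lam i - Proj f a lam' i - l * (lam - lam')\<bar> \<le> taylor_const * \<bar>lam - lam'\<bar> powr (1 + \<delta>)"
    proof (rule tendsto_upperbound)
      show "(\<lambda>n. \<bar>comp_word f lam (prefix_word i (r n)) a - comp_word f lam' (prefix_word i (r n)) a - D (r n) * (lam - lam')\<bar>)
        \<longlonglongrightarrow> \<bar>Proj f a lam i - Proj f a lam' i - l * (lam - lam')\<bar>"
        using lr(2) by (intro tendsto_intros sub lam assms) (simp add: o_def)
    qed (use D(2)[OF lam] in auto)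
  qed
qed

section \<open>The metric and the slope of the common prefix\<close>

lemma diameter_comp_word_le:
  assumes "lam \<in> {u0..u1}" "w \<in> words m"
    and C: "\<And>x y. x \<in> {a..b} \<Longrightarrow> y \<in> {a..b} \<Longrightarrow> \<bar>word_slope lam w x y\<bar> \<le> C"
  shows "diameter (comp_word f lam w ` {a..b}) \<le> C * (b - a)"
proof (rule diameter_le)
  have C0: "0 \<le> C" using C[of a a] ab by auto
  fix x' y' assume "x' \<in> comp_word f lam w ` {a..b}" "y' \<in> comp_word f lam w ` {a..b}"
  then obtain x y where xy: "x \<in> {a..b}" "y \<in> {a..b}" "x' = comp_word f lam w x" "y' = comp_word f lam w y" by auto
  have "\<bar>word_slope lam w x y\<bar> * \<bar>x - y\<bar> \<le> C * (b - a)"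
    using xy by (intro mult_mono C C0) auto
  then show "norm (x' - y') \<le> C * (b - a)"
    using comp_word_diff_eq[OF assms(1,2) xy(1,2)] xy by (simp add: abs_mult)
qed (use ab in auto)

lemma dlam_nonneg: "0 \<le> dlam f {a..b} lam i j" if "lam \<in> {u0..u1}" "i \<in> space (SigmaM m)"
proof -
  have "bounded (comp_word f lam w ` {a..b})" if "w \<in> words m" for w
    using comp_word_in[OF \<open>lam \<in> {u0..u1}\<close> that] by (intro bounded_subset[OF bounded_closed_interval[of a b]]) auto
  then show ?thesis using that by (auto simp: dlam_def intro!: diameter_ge_0 prefix_word_in_words)
qed

text \<open>The length of the interval times the distortion in \<open>word_slope_ratio\<close> with
  equal parameters and \<open>e = b - a\<close>.\<close>

definition distortion_const :: real where "distortion_const = (b - a) * exp (K / \<gamma>1 * ((b - a) / (1 - \<gamma>2)))"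

lemma distortion_const_pos: "0 < distortion_const" using ab by (simp add: distortion_const_def)

text \<open>The link to the energy: an upper bound on the distance by |Q| makes the negative power
  of the distance at least a constant times that of |Q|.\<close>

lemma dlam_le_word_slope:
  assumes "lam \<in> {u0..u1}" "i \<in> space (SigmaM m)" "x \<in> {a..b}" "y \<in> {a..b}"
    and k: "prefix_word i k = prefix_word j k" "i k \<noteq> j k"
  shows "dlam f {a..b} lam i j \<le> distortion_const * \<bar>word_slope lam (prefix_word i k) x y\<bar>"
proof -
  have le: "(LEAST k. i k \<noteq> j k) = k"
    using k by (intro Least_equality) (auto simp: prefix_word_eq_iff not_less[symmetric])
  define w where "w = prefix_word i k"
  have w: "w \<in> words m" unfolding w_def by (intro prefix_word_in_words assms)
  let ?Q = "\<bar>word_slope lam w x y\<bar>"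
  let ?E = "exp (K / \<gamma>1 * ((b - a) / (1 - \<gamma>2)))"
  have "\<bar>word_slope lam w x' y'\<bar> \<le> ?Q * ?E" if "x' \<in> {a..b}" "y' \<in> {a..b}" for x' y'
  proof -
    have "\<bar>word_slope lam w x' y' - word_slope lam w x y\<bar> \<le> ?Q *
        (exp (K / \<gamma>1 * ((b - a) * (1 - \<gamma>2 ^ length w) / (1 - \<gamma>2) + real (length w) * (lip_const + 1) * \<bar>lam - lam\<bar>)) - 1)"
      by (rule word_slope_ratio) (use that assms w in auto)
    also have "\<dots> \<le> ?Q * (?E - 1)"
      using ab gam1 gam2 K by (intro mult_left_mono diff_right_mono)
        (auto intro!: mult_left_mono divide_right_mono mult_left_le divide_nonneg_pos)
    finally show ?thesis by (simp add: algebra_simps)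
  qed
  from diameter_comp_word_le[OF assms(1) w this] show ?thesis
    using k by (auto simp: dlam_def le w_def[symmetric] distortion_const_def algebra_simps)
qed

lemma dlam_le_power:
  assumes "lam \<in> {u0..u1}" "i \<in> space (SigmaM m)" "prefix_word i n = prefix_word j n"
  shows "dlam f {a..b} lam i j \<le> \<gamma>2 ^ n * (b - a)"
proof (cases "i = j")
  case True
  then show ?thesis using ab gam2 by (simp add: dlam_def)
next
  case False
  then obtain k0 where "i k0 \<noteq> j k0" by blast
  then have k: "i (LEAST k. i k \<noteq> j k) \<noteq> j (LEAST k. i k \<noteq> j k)" by (rule LeastI)
  define k where "k = (LEAST k. i k \<noteq> j k)"
  have "n \<le> k" using k assms(3) by (auto simp: prefix_word_eq_iff k_def not_less[symmetric])
  have w: "prefix_word i k \<in> words m" by (intro prefix_word_in_words assms)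
  have "diameter (comp_word f lam (prefix_word i k) ` {a..b}) \<le> \<gamma>2 ^ k * (b - a)"
    using word_slope_bounds[OF assms(1) w] by (intro diameter_comp_word_le assms w) simp
  also have "\<dots> \<le> \<gamma>2 ^ n * (b - a)"
    using \<open>n \<le> k\<close> ab gam2 by (intro mult_right_mono power_decreasing) auto
  finally show ?thesis using False by (simp add: dlam_def k_def)
qed

end

section \<open>Transversality and oscillation\<close>

text \<open>A Lipschitz cutoff that is 1 within distance \<open>r\<close> of \<open>l\<close> and 0
  beyond \<open>2 * r\<close>. On the interval of radius \<open>3 * r\<close> this leaves a margin:
  a neighbourhood of radius less than \<open>r\<close> around any point of the support stays
  inside.\<close>

definition trapezoid :: "real \<Rightarrow> real \<Rightarrow> real \<Rightarrow> real" where
  "trapezoid l r x = max 0 (min 1 (2 - \<bar>x - l\<bar> / r))"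

lemma trapezoid_bounds: "0 \<le> trapezoid l r x" "trapezoid l r x \<le> 1"
  by (auto simp: trapezoid_def)

lemma trapezoid_eq_1: "0 < r \<Longrightarrow> \<bar>x - l\<bar> \<le> r \<Longrightarrow> trapezoid l r x = 1"
  by (auto simp: trapezoid_def min_def max_def field_simps)

lemma trapezoid_eq_0: "0 < r \<Longrightarrow> 2 * r \<le> \<bar>x - l\<bar> \<Longrightarrow> trapezoid l r x = 0"
  by (auto simp: trapezoid_def min_def max_def field_simps)

lemma trapezoid_lipschitz:
  assumes "0 < r" shows "\<bar>trapezoid l r x - trapezoid l r y\<bar> \<le> \<bar>x - y\<bar> / r"
proof -
  have clip: "\<bar>max 0 (min 1 (2 - u)) - max 0 (min 1 (2 - v))\<bar> \<le> \<bar>u - v\<bar>" for u v :: real by linarith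
  have "\<bar>trapezoid l r x - trapezoid l r y\<bar> \<le> \<bar>\<bar>x - l\<bar> / r - \<bar>y - l\<bar> / r\<bar>"
    unfolding trapezoid_def using clip[of "\<bar>x - l\<bar> / r" "\<bar>y - l\<bar> / r"] .
  also have "\<dots> = \<bar>\<bar>x - l\<bar> - \<bar>y - l\<bar>\<bar> / r"
    using assms by (simp add: diff_divide_distrib[symmetric] abs_divide)
  also have "\<dots> \<le> \<bar>x - y\<bar> / r"
    using assms by (intro divide_right_mono) auto
  finally show ?thesis .
qed

lemma continuous_on_trapezoid [continuous_intros]:
  "0 < r \<Longrightarrow> continuous_on A g \<Longrightarrow> continuous_on A (\<lambda>x. trapezoid l r (g x))"
  unfolding trapezoid_def by (intro continuous_intros) auto

context parametrized_ifs
begin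

lemma continuous_on_comp_word_Proj:
  assumes "w \<in> words m" "i \<in> space (SigmaM m)"
  shows "continuous_on {u0..u1} (\<lambda>lam. comp_word f lam w (Proj f a lam i))"
proof (rule lipschitz_on_continuous_on[where L="2 * lip_const"], rule lipschitz_onI)
  fix x y assume x: "x \<in> {u0..u1}" and y: "y \<in> {u0..u1}"
  have "\<gamma>2 ^ length w * \<bar>Proj f a x i - Proj f a y i\<bar> \<le> 1 * (lip_const * \<bar>x - y\<bar>)"
    using gam2 by (intro mult_mono Proj_lipschitz x y assms) (auto simp: power_le_one)
  then show "dist (comp_word f x w (Proj f a x i)) (comp_word f y w (Proj f a y i)) \<le> 2 * lip_const * dist x y"
    using comp_word_lipschitz[OF x y assms(1) Proj_in[OF x assms(2)] Proj_in[OF y assms(2)]]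
    by (simp add: dist_real_def)
qed (use lip_const in auto)

text \<open>\<open>word_slope_ratio\<close> with
  \<open>e = lip_const * \<bar>lam - lam'\<bar>\<close>, the distance by which the projections move.
  As the prefix is shorter than \<open>n\<close>, also the geometric part is absorbed into a
  multiple of \<open>n\<close>.\<close>

definition slope_const :: real where "slope_const = K / \<gamma>1 * (lip_const / (1 - \<gamma>2) + lip_const + 1)"

lemma slope_const_nonneg: "0 \<le> slope_const"
  using K gam1 gam2 lip_const by (auto simp: slope_const_def)

lemma word_slope_Proj_ratio:
  assumes "lam \<in> {u0..u1}" "lam' \<in> {u0..u1}" "w \<in> words m" "i \<in> space (SigmaM m)" "j \<in> space (SigmaM m)" "length w < n"
  defines "Q \<equiv> \<lambda>l. word_slope l w (Proj f a l i) (Proj f a l j)"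
  shows "\<bar>Q lam - Q lam'\<bar> \<le> \<bar>Q lam'\<bar> * (exp (slope_const * real n * \<bar>lam - lam'\<bar>) - 1)"
    and "\<bar>Q lam\<bar> \<le> \<bar>Q lam'\<bar> * exp (slope_const * real n * \<bar>lam - lam'\<bar>)"
proof -
  let ?k = "length w" and ?d = "\<bar>lam - lam'\<bar>"
  have "\<bar>Q lam - Q lam'\<bar> \<le> \<bar>Q lam'\<bar> * (exp (K / \<gamma>1 * (lip_const * ?d * (1 - \<gamma>2 ^ ?k) / (1 - \<gamma>2) + real ?k * (lip_const + 1) * ?d)) - 1)"
    unfolding Q_def by (intro word_slope_ratio assms Proj_in Proj_lipschitz)
  also have "\<dots> \<le> \<bar>Q lam'\<bar> * (exp (slope_const * real n * ?d) - 1)"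
  proof -
    have "lip_const * ?d * (1 - \<gamma>2 ^ ?k) / (1 - \<gamma>2) \<le> lip_const * ?d * 1 / (1 - \<gamma>2)"
      using gam2 lip_const by (intro divide_right_mono mult_left_mono) auto
    also have "\<dots> \<le> real n * (lip_const / (1 - \<gamma>2) * ?d)"
      using mult_right_mono[of 1 "real n" "lip_const / (1 - \<gamma>2) * ?d"] assms(6) lip_const gam2 by simp
    finally have "lip_const * ?d * (1 - \<gamma>2 ^ ?k) / (1 - \<gamma>2) + real ?k * (lip_const + 1) * ?d
       \<le> real n * (lip_const / (1 - \<gamma>2) * ?d) + real n * (lip_const + 1) * ?d"
      using assms(6) lip_const by (intro add_mono mult_right_mono) auto
    then have "K / \<gamma>1 * (lip_const * ?d * (1 - \<gamma>2 ^ ?k) / (1 - \<gamma>2) + real ?k * (lip_const + 1) * ?d)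
       \<le> K / \<gamma>1 * (real n * (lip_const / (1 - \<gamma>2) * ?d) + real n * (lip_const + 1) * ?d)"
      using K gam1 by (intro mult_left_mono) auto
    also have "\<dots> = slope_const * real n * ?d" by (simp add: slope_const_def algebra_simps)
    finally show ?thesis by (intro mult_left_mono) auto
  qed
  finally show "\<bar>Q lam - Q lam'\<bar> \<le> \<bar>Q lam'\<bar> * (exp (slope_const * real n * ?d) - 1)" .
  then show "\<bar>Q lam\<bar> \<le> \<bar>Q lam'\<bar> * exp (slope_const * real n * ?d)" by (simp add: algebra_simps)
qed

end

locale transversal_ifs = parametrized_ifs +
  fixes \<eta> :: real
  assumes eta: "0 < \<eta>"
    and MT: "\<And>lam i j. lam \<in> {u0..u1} \<Longrightarrow> i \<in> space (SigmaM m) \<Longrightarrow> j \<in> space (SigmaM m) \<Longrightarrow> i 0 \<noteq> j 0 \<Longrightarrow>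
       \<bar>Proj f a lam i - Proj f a lam j\<bar> < \<eta> \<Longrightarrow>
       \<exists>D. ((\<lambda>l. Proj f a l i - Proj f a l j) has_real_derivative D) (at lam within {u0..u1}) \<and> \<eta> \<le> \<bar>D\<bar>"
begin

text \<open>While the difference stays below \<eta>, transversality bounds its derivative from below
  at every parameter, and the mean value theorem integrates this bound.\<close>

lemma Proj_diff_expanding:
  assumes ij: "i \<in> space (SigmaM m)" "j \<in> space (SigmaM m)" "i 0 \<noteq> j 0"
    and W: "{A..B} \<subseteq> {u0..u1}" and small: "\<And>lam. lam \<in> {A..B} \<Longrightarrow> \<bar>Proj f a lam i - Proj f a lam j\<bar> < \<eta>"
    and xy: "x \<in> {A..B}" "y \<in> {A..B}"
  shows "\<eta> * \<bar>x - y\<bar> \<le> \<bar>(Proj f a x i - Proj f a x j) - (Proj f a y i - Proj f a y j)\<bar>"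
proof -
  define p where "p l = Proj f a l i - Proj f a l j" for l
  have main: "\<eta> * \<bar>x - y\<bar> \<le> \<bar>p x - p y\<bar>" if xy: "x \<in> {A..B}" "y \<in> {A..B}" "x < y" for x y
  proof -
    have "\<exists>D. (p has_real_derivative D) (at l within {u0..u1}) \<and> \<eta> \<le> \<bar>D\<bar>" if "l \<in> {A..B}" for l
      using MT[OF _ ij small[OF that]] that W unfolding p_def by blast
    then obtain D where D: "\<And>l. l \<in> {A..B} \<Longrightarrow> (p has_real_derivative D l) (at l within {u0..u1})"
      "\<And>l. l \<in> {A..B} \<Longrightarrow> \<eta> \<le> \<bar>D l\<bar>" by metis
    have "\<exists>z\<in>{x<..<y}. p y - p x = D z * (y - x)"
    proof (rule mvt_simple[OF xy(3)])
      fix z assume "x \<le> z" "z \<le> y"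
      then show "(p has_derivative (*) (D z)) (at z within {x..y})"
        unfolding has_field_derivative_def[symmetric]
        using xy W by (intro DERIV_subset[OF D(1)]) auto
    qed
    then obtain z where z: "z \<in> {x<..<y}" "p y - p x = D z * (y - x)" by blast
    then have "\<bar>p y - p x\<bar> = \<bar>D z\<bar> * (y - x)" using xy by (simp add: abs_mult)
    also have "\<dots> \<ge> \<eta> * (y - x)" using z xy D(2)[of z] by (intro mult_right_mono) auto
    finally show ?thesis using xy by (simp add: abs_minus_commute)
  qed
  show ?thesis
    using main[of x y] main[of y x] xy unfolding p_def[symmetric]
    by (cases x y rule: linorder_cases) (auto simp: abs_minus_commute)
qed

text \<open>\<open>D\<close> arises from limits of subsequences. Its lower bound comes from
  comparing the expansion with \<open>Proj_diff_expanding\<close> at \<open>z + s\<close>, dividing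
  by \<open>s\<close> and letting \<open>s\<close> tend to 0 from the right; \<open>z < B\<close>
  leaves room for that.\<close>

lemma Proj_diff_taylor:
  assumes ij: "i \<in> space (SigmaM m)" "j \<in> space (SigmaM m)" "i 0 \<noteq> j 0"
    and W: "{A..B} \<subseteq> {u0..u1}" and small: "\<And>lam. lam \<in> {A..B} \<Longrightarrow> \<bar>Proj f a lam i - Proj f a lam j\<bar> < \<eta>"
    and z: "A \<le> z" "z < B"
  obtains D where "\<eta> \<le> \<bar>D\<bar>" "\<And>x. x \<in> {u0..u1} \<Longrightarrow>
    \<bar>(Proj f a x i - Proj f a x j) - (Proj f a z i - Proj f a z j) - D * (x - z)\<bar> \<le> 2 * taylor_const * \<bar>x - z\<bar> powr (1 + \<delta>)"
proof -
  define p where "p l = Proj f a l i - Proj f a l j" for l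
  have zU: "z \<in> {u0..u1}" using W z by auto
  obtain D1 where D1: "\<And>x. x \<in> {u0..u1} \<Longrightarrow>
    \<bar>Proj f a x i - Proj f a z i - D1 * (x - z)\<bar> \<le> taylor_const * \<bar>x - z\<bar> powr (1 + \<delta>)"
    using Proj_taylor[OF zU ij(1)] by blast
  obtain D2 where D2: "\<And>x. x \<in> {u0..u1} \<Longrightarrow>
    \<bar>Proj f a x j - Proj f a z j - D2 * (x - z)\<bar> \<le> taylor_const * \<bar>x - z\<bar> powr (1 + \<delta>)"
    using Proj_taylor[OF zU ij(2)] by blast
  define D where "D = D1 - D2"
  have D: "\<bar>p x - p z - D * (x - z)\<bar> \<le> 2 * taylor_const * \<bar>x - z\<bar> powr (1 + \<delta>)" if "x \<in> {u0..u1}" for x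
  proof -
    have "p x - p z - D * (x - z) = (Proj f a x i - Proj f a z i - D1 * (x - z)) - (Proj f a x j - Proj f a z j - D2 * (x - z))"
      by (simp add: p_def D_def algebra_simps)
    then show ?thesis using D1[OF that] D2[OF that] by linarith
  qed
  have "\<eta> \<le> \<bar>D\<bar>"
  proof (rule tendsto_lowerbound)
    have "((\<lambda>s::real. s powr \<delta>) \<longlongrightarrow> 0) (at_right 0)"
      using delta by (intro tendsto_zero_powrI[where b=\<delta>]) (auto intro!: tendsto_intros simp: eventually_at_filter)
    then have "((\<lambda>s. \<bar>D\<bar> + 2 * taylor_const * s powr \<delta>) \<longlongrightarrow> \<bar>D\<bar> + 2 * taylor_const * 0) (at_right 0)"
      by (intro tendsto_intros)
    then show "((\<lambda>s. \<bar>D\<bar> + 2 * taylor_const * s powr \<delta>) \<longlongrightarrow> \<bar>D\<bar>) (at_right 0)" by simp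
    have "\<eta> \<le> \<bar>D\<bar> + 2 * taylor_const * s powr \<delta>" if s: "0 < s" "s < B - z" for s
    proof -
      have x: "z + s \<in> {A..B}" "z \<in> {A..B}" using s z by auto
      have "\<eta> * s \<le> \<bar>p (z + s) - p z\<bar>"
        using Proj_diff_expanding[OF ij W small x] s by (simp add: p_def)
      also have "\<dots> \<le> \<bar>D * s\<bar> + 2 * taylor_const * s powr (1 + \<delta>)"
        using D[of "z + s"] x W s by force
      also have "\<dots> = (\<bar>D\<bar> + 2 * taylor_const * s powr \<delta>) * s"
        using s by (simp add: abs_mult powr_add algebra_simps)
      finally show ?thesis using s by simp
    qed
    moreover have "\<forall>\<^sub>F s in at_right 0. s \<in> {0<..<B - z}"
      using z by (intro eventually_at_right_real) auto
    ultimately show "\<forall>\<^sub>F s in at_right 0. \<eta> \<le> \<bar>D\<bar> + 2 * taylor_const * s powr \<delta>"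
      by (auto elim!: eventually_mono)
  qed simp
  with D show thesis by (intro that[of D]) (auto simp: p_def)
qed


text \<open>Write \<open>\<phi> = Q * p\<close> with \<open>p\<close> the difference of the projections of the tails. On the support of the
  integrand choose a point \<open>z\<close> and freeze \<open>F\<close> and \<open>Q\<close> there and \<open>p\<close> to first order; the frozen integral vanishes
  because the kernel has mean zero. The support has length of order \<open>R\<close>, the inverse of \<open>t * \<bar>Q z\<bar>\<close>, and
  freezing costs \<open>R powr min \<delta> \<theta>\<close>. If \<open>R\<close> exceeds \<open>r\<close>, then the trivial bound is good enough.\<close>

lemma oscillation_estimate:
  fixes c \<theta> q \<kappa> l r :: real
  assumes r: "0 < r" "6 * r \<le> 1" and W: "{l - 3 * r..l + 3 * r} \<subseteq> {u0..u1}"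
    and small: "12 * lip_const * r \<le> \<eta> / 2" "slope_const * (6 * r) \<le> \<kappa>" "2 * c * (6 * r) powr \<theta> \<le> \<kappa>"
    and c: "0 < c" and th: "0 < \<theta>" and q: "1 \<le> q" "q \<le> 2" "q \<le> 1 + min \<delta> \<theta>"
  defines "W \<equiv> {l - 3 * r..l + 3 * r}"
  defines "C3 \<equiv> 2 * (4 * (1 / r + 2 * c) + 64 / \<eta> * (2 * taylor_const + slope_const * (\<eta> / 2 + 2 * lip_const)))"
  defines "C \<equiv> 24 * (4 / (\<eta> * r)) powr q + C3 * (4 / \<eta>) powr q"
  assumes t: "0 < t" and w: "w \<in> words m" "length w < n"
    and ij: "i \<in> space (SigmaM m)" "j \<in> space (SigmaM m)" "i 0 \<noteq> j 0"
    and h: "continuous_on W h" "\<And>x. x \<in> W \<Longrightarrow> 0 \<le> h x"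
      "\<And>x y. x \<in> W \<Longrightarrow> y \<in> W \<Longrightarrow> h x \<le> exp (2 * c * \<bar>x - y\<bar> powr \<theta> * real n) * h y"
  defines "\<phi> \<equiv> \<lambda>x. comp_word f x w (Proj f a x i) - comp_word f x w (Proj f a x j)"
    and "Q \<equiv> \<lambda>x. word_slope x w (Proj f a x i) (Proj f a x j)"
  shows "\<bar>integral W (\<lambda>x. trapezoid l r x * h x * kernel (t * \<phi> x))\<bar>
     \<le> C * real n * exp (\<kappa> * real n) ^ 7 * (t * \<bar>Q l\<bar>) powr (- q) * h l"
proof -
  \<comment> \<open>\<open>B\<close> bounds the factor by which Q or \<open>h\<close> can vary over
    the window; all such losses are collected as powers of \<open>B\<close>.\<close>
  define B where "B = exp (\<kappa> * real n)"
  define F where "F x = trapezoid l r x * h x" for x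
  define p where "p x = Proj f a x i - Proj f a x j" for x
  have WU: "x \<in> {u0..u1}" if "x \<in> W" for x using that W by (auto simp: W_def)
  have lW: "l \<in> W" using r by (auto simp: W_def)
  have dW: "\<bar>x - y\<bar> \<le> 6 * r" if "x \<in> W" "y \<in> W" for x y using that by (auto simp: W_def)
  have n: "1 \<le> real n" using w by simp
  have kap: "0 \<le> \<kappa>" using small(2) slope_const_nonneg r by (meson mult_nonneg_nonneg order_trans less_imp_le zero_le_numeral)
  have B1: "1 \<le> B" using kap by (simp add: B_def)
  have \<phi>: "\<phi> x = Q x * p x" if "x \<in> W" for x
    unfolding \<phi>_def Q_def p_def by (intro comp_word_diff_eq WU that w Proj_in ij)
  have Qpos: "0 < \<bar>Q x\<bar>" if "x \<in> W" for x
    unfolding Q_def by (intro word_slope_bounds WU that w Proj_in ij)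
  have expB: "exp (slope_const * real n * d) \<le> B" if "d \<le> 6 * r" for d
  proof -
    have "slope_const * real n * d \<le> slope_const * (6 * r) * real n"
      using mult_left_mono[OF that, of "slope_const * real n"] slope_const_nonneg by (simp add: algebra_simps)
    also have "\<dots> \<le> \<kappa> * real n" using small(2) by (intro mult_right_mono) auto
    finally show ?thesis by (simp add: B_def)
  qed
  have QB: "\<bar>Q x\<bar> \<le> \<bar>Q y\<bar> * B" if "x \<in> W" "y \<in> W" for x y
  proof -
    have "\<bar>Q x\<bar> \<le> \<bar>Q y\<bar> * exp (slope_const * real n * \<bar>x - y\<bar>)"
      unfolding Q_def by (intro word_slope_Proj_ratio WU that w ij)
    also have "\<dots> \<le> \<bar>Q y\<bar> * B" by (intro mult_left_mono expB dW that) auto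
    finally show ?thesis .
  qed
  have expB2: "exp (2 * c * \<bar>x - y\<bar> powr \<theta> * real n) \<le> B" if "x \<in> W" "y \<in> W" for x y
  proof -
    have "2 * c * \<bar>x - y\<bar> powr \<theta> * real n \<le> 2 * c * (6 * r) powr \<theta> * real n"
      using c th dW[OF that] by (intro mult_right_mono mult_left_mono powr_mono2) auto
    also have "\<dots> \<le> \<kappa> * real n" using small(3) by (intro mult_right_mono) auto
    finally show ?thesis by (simp add: B_def)
  qed
  have hB: "h x \<le> B * h l" if "x \<in> W" for x
    using h(3)[OF that lW] mult_right_mono[OF expB2[OF that lW] h(2)[OF lW]] by linarith
  have hl: "0 \<le> h l" using h(2) lW by blast
  have F_bound: "0 \<le> F x" "F x \<le> B * h l" if "x \<in> W" for x
    using h(2)[OF that] hB[OF that] trapezoid_bounds[of l r x] mult_right_mono[of "trapezoid l r x" 1 "h x"]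
    by (auto simp: F_def)
  have cp: "continuous_on W \<phi>"
    unfolding \<phi>_def using W
    by (intro continuous_on_diff continuous_on_subset[OF continuous_on_comp_word_Proj] w ij) (auto simp: W_def)
  have cF: "continuous_on W F"
    unfolding F_def by (intro continuous_intros h r)
  have p_lip: "\<bar>p x - p y\<bar> \<le> 2 * lip_const * \<bar>x - y\<bar>" if "x \<in> W" "y \<in> W" for x y
    using Proj_lipschitz[OF WU[OF that(1)] WU[OF that(2)] ij(1)] Proj_lipschitz[OF WU[OF that(1)] WU[OF that(2)] ij(2)]
    unfolding p_def by linarith
  define G where "G x = F x * kernel (t * \<phi> x)" for x
  have GC: "continuous_on W G" unfolding G_def by (intro continuous_intros cF cp)
  have C3: "0 \<le> C3" unfolding C3_def using taylor_const slope_const_nonneg lip_const r c eta by (intro mult_nonneg_nonneg add_nonneg_nonneg) auto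
  have rhs: "0 \<le> real n * B ^ 7 * (t * \<bar>Q l\<bar>) powr (- q) * h l"
    using B1 hl by (intro mult_nonneg_nonneg) auto
  \<comment> \<open>One factor \<open>B\<close> stands in the numerator, another is the price of
    replacing \<open>Q z\<close> by \<open>Q l\<close>; since \<open>q \<le> 2\<close>, the power
    \<open>q\<close> of \<open>B ^ 2\<close> is at most \<open>B ^ 4\<close>.\<close>
  have Rpow: "(4 * B / (s * (t * \<bar>Q z\<bar>))) powr q \<le> (4 / s) powr q * B ^ 4 * (t * \<bar>Q l\<bar>) powr (- q)"
    if z: "z \<in> W" and s: "0 < s" for s z
  proof -
    have "4 * B / (s * (t * \<bar>Q z\<bar>)) \<le> (4 / s) * (B ^ 2) * inverse (t * \<bar>Q l\<bar>)"
      using QB[OF lW z] Qpos[OF z] Qpos[OF lW] t s B1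
      by (simp add: field_simps power2_eq_square)
    then have "(4 * B / (s * (t * \<bar>Q z\<bar>))) powr q \<le> ((4 / s) * (B ^ 2) * inverse (t * \<bar>Q l\<bar>)) powr q"
      using q t s B1 by (intro powr_mono2) auto
    also have "\<dots> = (4 / s) powr q * (B ^ 2) powr q * (t * \<bar>Q l\<bar>) powr (- q)"
    proof -
      define T where "T = inverse (t * \<bar>Q l\<bar>)"
      have T0: "0 \<le> T" using t by (simp add: T_def)
      have "T powr q = (t * \<bar>Q l\<bar>) powr (- q)"
        unfolding T_def using t by (simp add: powr_minus inverse_powr del: inverse_mult_distrib)
      then show ?thesis unfolding T_def[symmetric] using T0 s B1 by (simp only: powr_mult)
    qed
    also have "(B ^ 2) powr q \<le> (B ^ 2) powr 2"
      using B1 q by (intro powr_mono) auto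
    also have "(B ^ 2) powr 2 = B ^ 4" using B1 by (simp add: powr_numeral)
    finally show ?thesis by (simp add: mult_left_mono mult_right_mono)
  qed
  have "\<bar>integral W G\<bar> \<le> C * (real n * B ^ 7 * (t * \<bar>Q l\<bar>) powr (- q) * h l)"
  proof (cases "\<exists>z\<in>W. G z \<noteq> 0")
    case False
    then have "integral W G = integral W (\<lambda>x. 0)" by (intro integral_cong) auto
    then show ?thesis using rhs C3 by (auto simp: C_def)
  next
    case True
    then obtain z where z: "z \<in> W" "G z \<noteq> 0" by blast
    then have z2: "\<bar>z - l\<bar> < 2 * r" "\<bar>t * \<phi> z\<bar> < 2"
      using trapezoid_eq_0[OF r(1), of z l] kernel_eq_0[of "t * \<phi> z"] by (force simp: G_def F_def)+
    define Q1 where "Q1 = \<bar>Q z\<bar>"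
    \<comment> \<open>Where the kernel does not vanish, p is below \<open>2 * B / (t * Q1)\<close>.
      Two such values differ by less than \<open>4 * B / (t * Q1)\<close>, so expansion by \<eta>
      confines the support to distance \<open>R\<close> from \<open>z\<close>. The same
      \<open>R\<close> makes the linearised phase sweep across the support of the kernel.\<close>
    define R where "R = 4 * B / (\<eta> * (t * Q1))"
    have Q1: "0 < Q1" using Qpos z by (simp add: Q1_def)
    have tQR: "t * Q1 * R = 4 * B / \<eta>" using Q1 t by (simp add: R_def)
    have R0: "0 < R" using Q1 t B1 eta by (simp add: R_def)
    have pz: "\<bar>p z\<bar> < 2 / (t * Q1)"
      using z2(2) \<phi>[OF z(1)] Q1 t by (simp add: abs_mult Q1_def field_simps)
    have pzR: "2 / (t * Q1) \<le> \<eta> / 2 * R"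
      using Q1 t B1 eta by (simp add: R_def field_simps)
    show ?thesis
    proof (cases "r \<le> R")
      case True
      have "norm (integral W G) \<le> (B * h l * 4) * ((l + 3 * r) - (l - 3 * r))"
        unfolding W_def
      proof (rule integral_bound)
        fix x assume "x \<in> {l - 3 * r..l + 3 * r}"
        then have "x \<in> W" by (simp add: W_def)
        then show "norm (G x) \<le> B * h l * 4"
          unfolding G_def using F_bound[of x] abs_kernel_le[of "t * \<phi> x"] by (auto simp: abs_mult intro!: mult_mono)
      qed (use GC r in \<open>auto simp: W_def\<close>)
      then have "\<bar>integral W G\<bar> \<le> 24 * r * (B * h l)" by (simp add: algebra_simps)
      also have "\<dots> \<le> 24 * 1 * (B * h l)"
        using r B1 hl by (intro mult_right_mono) auto
      also have "\<dots> = 24 * (B * h l) * 1" by simp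
      also have "\<dots> \<le> 24 * (B * h l) * (R / r) powr q"
        using True r q B1 hl by (intro mult_left_mono ge_one_powr_ge_zero) auto
      also have "R / r = 4 * B / ((\<eta> * r) * (t * \<bar>Q z\<bar>))" by (simp add: R_def Q1_def field_simps)
      also have "24 * (B * h l) * (4 * B / ((\<eta> * r) * (t * \<bar>Q z\<bar>))) powr q
         \<le> 24 * (B * h l) * ((4 / (\<eta> * r)) powr q * B ^ 4 * (t * \<bar>Q l\<bar>) powr (- q))"
        using r eta B1 hl z by (intro mult_left_mono Rpow) auto
      also have "\<dots> = 24 * (4 / (\<eta> * r)) powr q * (1 * B ^ 5 * (t * \<bar>Q l\<bar>) powr (- q) * h l)"
        by (simp add: algebra_simps power_numeral_reduce)
      also have "\<dots> \<le> 24 * (4 / (\<eta> * r)) powr q * (real n * B ^ 7 * (t * \<bar>Q l\<bar>) powr (- q) * h l)"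
        using n B1 hl by (intro mult_left_mono mult_right_mono mult_mono power_increasing) auto
      also have "\<dots> \<le> C * (real n * B ^ 7 * (t * \<bar>Q l\<bar>) powr (- q) * h l)"
        unfolding C_def using C3 rhs by (intro mult_right_mono) auto
      finally show ?thesis .
    next
      case False
      then have Rr: "R < r" by simp
      then have R1: "R < 1" using r by simp
      define I where "I = {z - R..z + R}"
      have IW: "I \<subseteq> W" using Rr z2(1) by (auto simp: I_def W_def)
      \<comment> \<open>At \<open>z\<close> the difference is below \<eta> / 2 since
        \<open>R < 1\<close>, and across the window it moves by at most
        \<open>12 * lip_const * r \<le> \<eta> / 2\<close>. Hence transversality is available on all
        of \<open>W\<close>.\<close>
      have psmall: "\<bar>p x\<bar> < \<eta>" if "x \<in> W" for x
      proof -
        have "2 * lip_const * \<bar>x - z\<bar> \<le> 2 * lip_const * (6 * r)"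
          using dW[OF that z(1)] lip_const by (intro mult_left_mono) auto
        moreover have "\<eta> / 2 * R \<le> \<eta> / 2 * 1" using R1 eta by (intro mult_left_mono) auto
        ultimately show ?thesis using p_lip[OF that z(1)] pz pzR small(1) by linarith
      qed
      have expand: "\<eta> * \<bar>x - z\<bar> \<le> \<bar>p x - p z\<bar>" if "x \<in> W" for x
        using Proj_diff_expanding[OF ij W psmall[unfolded W_def p_def]] that z(1) unfolding W_def p_def by blast
      have zlt: "l - 3 * r \<le> z" "z < l + 3 * r" using z2(1) by auto
      obtain D where D: "\<eta> \<le> \<bar>D\<bar>"
        "\<And>x. x \<in> {u0..u1} \<Longrightarrow> \<bar>p x - p z - D * (x - z)\<bar> \<le> 2 * taylor_const * \<bar>x - z\<bar> powr (1 + \<delta>)"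
        using Proj_diff_taylor[OF ij W psmall[unfolded W_def p_def] zlt] unfolding p_def by blast
      have zero: "G x = 0" if x: "x \<in> W" "x \<notin> I" for x
      proof (rule ccontr)
        assume "G x \<noteq> 0"
        then have "\<bar>t * \<phi> x\<bar> < 2"
          using kernel_eq_0[of "t * \<phi> x"] by (force simp: G_def)
        then have "t * \<bar>Q x\<bar> * \<bar>p x\<bar> < 2" using \<phi>[OF x(1)] t by (simp add: abs_mult)
        then have "B * (t * \<bar>Q x\<bar> * \<bar>p x\<bar>) < B * 2" using B1 by simp
        moreover have "t * Q1 * \<bar>p x\<bar> \<le> t * (\<bar>Q x\<bar> * B) * \<bar>p x\<bar>"
          using QB[OF z(1) x(1)] t by (intro mult_right_mono mult_left_mono) (auto simp: Q1_def)
        ultimately have "t * Q1 * \<bar>p x\<bar> < 2 * B" by (simp add: algebra_simps)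
        then have "\<bar>p x\<bar> < 2 * B / (t * Q1)" using t Q1 by (simp add: pos_less_divide_eq mult.commute)
        moreover have "2 / (t * Q1) \<le> 2 * B / (t * Q1)" using t Q1 B1 by (simp add: divide_right_mono)
        ultimately have "\<eta> * \<bar>x - z\<bar> < 4 * B / (t * Q1)" using expand[OF x(1)] pz by linarith
        then have "\<bar>x - z\<bar> < R" using eta t Q1 by (simp add: R_def field_simps)
        then show False using x(2) by (auto simp: I_def)
      qed
      have "integral W G = integral W (\<lambda>x. if x \<in> I then G x else 0)"
        using zero by (intro integral_cong) auto
      also have "\<dots> = integral I G" using IW by (simp add: integral_restrict_Int Int_absorb2)
      finally have WI: "integral W G = integral I G" .
      \<comment> \<open>As \<open>R < 1\<close>, the smallest of the exponents 1, \<delta>, \<theta>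
        dominates every freezing error.\<close>
      define \<alpha> where "\<alpha> = min \<delta> \<theta>"
      have Ra: "R \<le> R powr \<alpha>" "R powr \<delta> \<le> R powr \<alpha>" "R powr \<theta> \<le> R powr \<alpha>"
        using powr_mono'[of \<alpha> 1 R] powr_mono'[of \<alpha> \<delta> R] powr_mono'[of \<alpha> \<theta> R] R0 R1 delta by (auto simp: \<alpha>_def)
      \<comment> \<open>\<open>e1\<close> adds the Taylor remainder of p to the variation of Q times
        the size of p, which is of order \<open>R\<close> on \<open>I\<close>; \<open>e2\<close>
        adds the Lipschitz error of the cutoff to the Hoelder error of the weights.\<close>
      define e1 where "e1 = Q1 * (2 * taylor_const * R powr (1 + \<delta>)) + Q1 * (slope_const * real n * R * B) * ((\<eta> / 2 + 2 * lip_const) * R)"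
      define e2 where "e2 = R / r * (B * h l) + 2 * c * R powr \<theta> * real n * B * (B * h l)"
      have IR: "\<bar>x - z\<bar> \<le> R" if "x \<in> I" for x using that by (auto simp: I_def)
      have "\<bar>integral {z - R..z + R} (\<lambda>x. F x * kernel (t * \<phi> x))\<bar> \<le> 2 * R * (4 * e2 + 16 * (B * h l) * (t * e1))"
      proof (rule kernel_almost_affine_bound[where D="Q z * D"])
        show "Q z * D \<noteq> 0" using Q1 D(1) eta by (auto simp: Q1_def)
        have "t * \<bar>Q z * D\<bar> * R = (t * Q1 * R) * \<bar>D\<bar>" by (simp add: abs_mult Q1_def)
        also have "\<dots> = 4 * B / \<eta> * \<bar>D\<bar>" unfolding tQR ..
        also have "\<dots> \<ge> 4 * B / \<eta> * \<eta>" using D(1) B1 eta by (intro mult_left_mono) auto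
        finally have "4 \<le> t * \<bar>Q z * D\<bar> * R" using eta B1 by simp
        moreover have "t * \<bar>\<phi> z\<bar> < 2" using z2(2) t by (simp add: abs_mult)
        ultimately show "t * \<bar>\<phi> z\<bar> + 2 \<le> t * \<bar>Q z * D\<bar> * R" by simp
        show "continuous_on {z - R..z + R} F" "continuous_on {z - R..z + R} \<phi>"
          using cF cp IW unfolding I_def by (auto intro: continuous_on_subset)
        show "\<bar>F z\<bar> \<le> B * h l" using F_bound[OF z(1)] by simp
        fix x assume "x \<in> {z - R..z + R}"
        then have xI: "x \<in> I" and xW: "x \<in> W" using IW by (auto simp: I_def)
        have "\<bar>p x\<bar> \<le> \<bar>p z\<bar> + 2 * lip_const * \<bar>x - z\<bar>" using p_lip[OF xW z(1)] by linarith
        also have "\<dots> \<le> \<eta> / 2 * R + 2 * lip_const * R"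
          using pz pzR IR[OF xI] lip_const by (intro add_mono mult_left_mono) auto
        finally have px: "\<bar>p x\<bar> \<le> (\<eta> / 2 + 2 * lip_const) * R" by (simp add: algebra_simps)
        have "\<bar>Q x - Q z\<bar> \<le> Q1 * (exp (slope_const * real n * \<bar>x - z\<bar>) - 1)"
          unfolding Q1_def Q_def by (intro word_slope_Proj_ratio WU xW z w ij)
        also have "\<dots> \<le> Q1 * (slope_const * real n * \<bar>x - z\<bar> * exp (slope_const * real n * \<bar>x - z\<bar>))"
          using Q1 by (intro mult_left_mono exp_minus_1_le) auto
        also have "\<dots> \<le> Q1 * (slope_const * real n * R * B)"
          using Q1 slope_const_nonneg IR[OF xI] R0 B1 by (intro mult_left_mono mult_mono expB dW xW z) auto
        finally have Qx: "\<bar>Q x - Q z\<bar> \<le> Q1 * (slope_const * real n * R * B)" .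
        have "\<phi> x - \<phi> z - Q z * D * (x - z) = Q z * (p x - p z - D * (x - z)) + (Q x - Q z) * p x"
          unfolding \<phi>[OF xW] \<phi>[OF z(1)] by (simp add: algebra_simps)
        also have "\<bar>\<dots>\<bar> \<le> Q1 * \<bar>p x - p z - D * (x - z)\<bar> + \<bar>Q x - Q z\<bar> * \<bar>p x\<bar>"
          unfolding Q1_def abs_mult[symmetric] by (rule abs_triangle_ineq)
        also have "\<dots> \<le> Q1 * (2 * taylor_const * \<bar>x - z\<bar> powr (1 + \<delta>)) + Q1 * (slope_const * real n * R * B) * ((\<eta> / 2 + 2 * lip_const) * R)"
          using Q1 slope_const_nonneg R0 B1 by (intro add_mono mult_mono D WU xW Qx px) auto
        also have "\<dots> \<le> e1"
          unfolding e1_def using Q1 taylor_const IR[OF xI] delta by (intro add_right_mono mult_left_mono powr_mono2) auto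
        finally show "\<bar>\<phi> x - \<phi> z - Q z * D * (x - z)\<bar> \<le> e1" .
        have hd: "h u - h v \<le> 2 * c * R powr \<theta> * real n * B * (B * h l)" if uv: "u \<in> W" "v \<in> W" "\<bar>u - v\<bar> \<le> R" for u v
        proof -
          let ?y = "2 * c * \<bar>u - v\<bar> powr \<theta> * real n"
          have "h u - h v \<le> (exp ?y - 1) * h v" using h(3)[OF uv(1,2)] by (simp add: algebra_simps)
          also have "\<dots> \<le> (?y * exp ?y) * h v"
            using h(2)[OF uv(2)] by (intro mult_right_mono exp_minus_1_le)
          also have "\<dots> \<le> (2 * c * R powr \<theta> * real n * B) * (B * h l)"
            using c th uv hB[OF uv(2)] h(2)[OF uv(2)] B1
            by (intro mult_mono mult_right_mono mult_left_mono powr_mono2 expB2) auto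
          finally show ?thesis .
        qed
        have hxz: "\<bar>h x - h z\<bar> \<le> 2 * c * R powr \<theta> * real n * B * (B * h l)"
          using hd[OF xW z(1) IR[OF xI]] hd[OF z(1) xW] IR[OF xI] by (simp add: abs_minus_commute abs_le_iff)
        have "F x - F z = (trapezoid l r x - trapezoid l r z) * h x + trapezoid l r z * (h x - h z)"
          by (simp add: F_def algebra_simps)
        also have "\<bar>\<dots>\<bar> \<le> \<bar>trapezoid l r x - trapezoid l r z\<bar> * h x + trapezoid l r z * \<bar>h x - h z\<bar>"
          using h(2)[OF xW] trapezoid_bounds[of l r z] by (intro order_trans[OF abs_triangle_ineq]) (simp add: abs_mult)
        also have "\<dots> \<le> (\<bar>x - z\<bar> / r) * (B * h l) + 1 * (2 * c * R powr \<theta> * real n * B * (B * h l))"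
          using h(2)[OF xW] trapezoid_bounds[of l r z] r
          by (intro add_mono mult_mono hxz trapezoid_lipschitz hB xW) auto
        also have "\<dots> \<le> e2"
          unfolding e2_def using IR[OF xI] r B1 hl by (auto intro!: mult_right_mono divide_right_mono)
        finally show "\<bar>F x - F z\<bar> \<le> e2" .
      qed (use R0 t in auto)
      then have "\<bar>integral W G\<bar> \<le> 2 * R * (4 * e2 + 16 * (B * h l) * (t * e1))"
        unfolding WI by (simp add: I_def G_def[abs_def])
      also have "\<dots> \<le> 2 * R * (4 * ((1 / r + 2 * c) * (real n * B ^ 3 * R powr \<alpha> * h l))
          + 16 * (B * h l) * (4 / \<eta> * (2 * taylor_const + slope_const * (\<eta> / 2 + 2 * lip_const)) * (real n * B ^ 2 * R powr \<alpha>)))"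
      proof -
        have "e2 = (1 / r) * (1 * B * R * h l) + 2 * c * (real n * (B * B) * R powr \<theta> * h l)"
          by (simp add: e2_def algebra_simps)
        also have "\<dots> \<le> (1 / r) * (real n * B ^ 3 * R powr \<alpha> * h l) + 2 * c * (real n * B ^ 3 * R powr \<alpha> * h l)"
          using r c n B1 hl Ra R0 power_increasing[of 1 3 B] power_increasing[of 2 3 B]
          by (intro add_mono mult_left_mono mult_right_mono mult_mono) (auto simp: power2_eq_square)
        finally have E2: "e2 \<le> (1 / r + 2 * c) * (real n * B ^ 3 * R powr \<alpha> * h l)" by (simp add: algebra_simps)
        \<comment> \<open>One factor \<open>R\<close> of \<open>e1\<close> cancels against
          \<open>t * Q1\<close>, leaving order \<open>R powr \<alpha>\<close>; the interval length
          supplies the remaining factor \<open>R\<close>.\<close>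
        have "t * e1 = (t * Q1 * R) * (2 * taylor_const * R powr \<delta> + slope_const * (\<eta> / 2 + 2 * lip_const) * (real n * B * R))"
          using R0 by (simp add: e1_def powr_add algebra_simps)
        also have "\<dots> = (4 / \<eta>) * (2 * taylor_const * (B * R powr \<delta>) + slope_const * (\<eta> / 2 + 2 * lip_const) * (real n * (B * B) * R))"
          unfolding tQR by (simp add: algebra_simps)
        also have "\<dots> \<le> (4 / \<eta>) * (2 * taylor_const * (real n * B ^ 2 * R powr \<alpha>) + slope_const * (\<eta> / 2 + 2 * lip_const) * (real n * B ^ 2 * R powr \<alpha>))"
        proof -
          have "1 * B \<le> real n * B ^ 2" using n B1 power_increasing[of 1 2 B] by (intro mult_mono) auto
          then have "B * R powr \<delta> \<le> real n * B ^ 2 * R powr \<alpha>" using Ra B1 by (intro mult_mono) auto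
          moreover have "real n * (B * B) * R \<le> real n * B ^ 2 * R powr \<alpha>"
            unfolding power2_eq_square using Ra B1 by (intro mult_left_mono) auto
          ultimately show ?thesis
            using eta taylor_const slope_const_nonneg lip_const by (intro mult_left_mono add_mono mult_nonneg_nonneg add_nonneg_nonneg) auto
        qed
        also have "\<dots> = 4 / \<eta> * (2 * taylor_const + slope_const * (\<eta> / 2 + 2 * lip_const)) * (real n * B ^ 2 * R powr \<alpha>)"
          by (simp only: distrib_left distrib_right mult.assoc)
        finally have E1: "t * e1 \<le> 4 / \<eta> * (2 * taylor_const + slope_const * (\<eta> / 2 + 2 * lip_const)) * (real n * B ^ 2 * R powr \<alpha>)" .
        show ?thesis
          using R0 B1 hl by (intro mult_left_mono add_mono E1 E2) auto
      qed
      also have "\<dots> = C3 * (R powr (1 + \<alpha>) * (real n * B ^ 3 * h l))"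
        using R0 by (simp add: C3_def powr_add algebra_simps power_numeral_reduce)
      also have "\<dots> \<le> C3 * (R powr q * (real n * B ^ 3 * h l))"
        using R0 R1 q(3) hl B1 C3 by (intro mult_left_mono mult_right_mono powr_mono') (auto simp: \<alpha>_def)
      \<comment> \<open>Three factors \<open>B\<close> from freezing and four from
        \<open>Rpow\<close> make the seventh power in the statement.\<close>
      also have "\<dots> \<le> C3 * (((4 / \<eta>) powr q * B ^ 4 * (t * \<bar>Q l\<bar>) powr (- q)) * (real n * B ^ 3 * h l))"
        unfolding R_def Q1_def using hl B1 C3 z eta by (intro mult_left_mono mult_right_mono Rpow) auto
      also have "\<dots> = C3 * (4 / \<eta>) powr q * (real n * B ^ 7 * (t * \<bar>Q l\<bar>) powr (- q) * h l)"
        by (simp add: algebra_simps power_numeral_reduce)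
      also have "\<dots> \<le> C * (real n * B ^ 7 * (t * \<bar>Q l\<bar>) powr (- q) * h l)"
        unfolding C_def using rhs by (intro mult_right_mono) auto
      finally show ?thesis .
    qed
  qed
  moreover have "G = (\<lambda>x. trapezoid l r x * h x * kernel (t * \<phi> x))"
    by (simp add: G_def F_def fun_eq_iff)
  ultimately show ?thesis by (simp add: B_def mult.assoc)
qed

end

section \<open>Discretisation in Fourier space\<close>

definition words_of_length :: "nat \<Rightarrow> nat \<Rightarrow> nat list set" where
  "words_of_length m n = {w \<in> words m. length w = n}"

lemma finite_words_of_length [simp]: "finite (words_of_length m n)"
proof -
  have "words_of_length m n = {w. set w \<subseteq> {..<m} \<and> length w = n}"
    by (auto simp: words_of_length_def words_def)
  then show ?thesis by (simp add: finite_lists_length_eq)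
qed

text \<open>Padding by the letter 0 selects a sequence in each cylinder. It is admissible only for a
  nonempty alphabet, which is why the case \<open>m = 0\<close> is treated separately at the
  end.\<close>

definition extend_word :: "nat list \<Rightarrow> nat \<Rightarrow> nat" where
  "extend_word w k = (if k < length w then w ! k else 0)"

lemma prefix_extend_word [simp]: "prefix_word (extend_word w) (length w) = w"
  by (rule nth_equalityI) (auto simp: extend_word_def)

lemma extend_word_in: "0 < m \<Longrightarrow> w \<in> words m \<Longrightarrow> extend_word w \<in> space (SigmaM m)"
  by (auto simp: space_SigmaM extend_word_def words_def)

text \<open>Cylinders of a fixed length partition the space, so a single summand survives. Functions
  of the prefix thereby become finite sums of indicators.\<close>

lemma sum_if_cyl:
  fixes g :: "nat list \<Rightarrow> 'b :: comm_monoid_add"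
  assumes "i \<in> space (SigmaM m)"
  shows "(\<Sum>w\<in>words_of_length m n. if i \<in> cyl m w then g w else 0) = g (prefix_word i n)"
proof -
  have p: "prefix_word i n \<in> words_of_length m n"
    using assms by (simp add: words_of_length_def prefix_word_in_words)
  have "(\<Sum>w\<in>words_of_length m n. if i \<in> cyl m w then g w else 0)
      = (\<Sum>w\<in>words_of_length m n. if prefix_word i n = w then g w else 0)"
    using assms by (intro sum.cong) (auto simp: mem_cyl_iff words_of_length_def)
  then show ?thesis using p by simp
qed

lemma sum_indicator_cyl_scaleR:
  fixes g :: "nat list \<Rightarrow> 'b :: real_vector"
  assumes "i \<in> space (SigmaM m)"
  shows "(\<Sum>w\<in>words_of_length m n. indicator (cyl m w) i *\<^sub>R g w) = g (prefix_word i n)"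
  by (subst sum_if_cyl[OF assms, symmetric], rule sum.cong) (auto simp: indicator_def)

lemma sum_indicator_cyl_mult:
  fixes g :: "nat list \<Rightarrow> 'b :: semiring_1"
  assumes "i \<in> space (SigmaM m)"
  shows "(\<Sum>w\<in>words_of_length m n. indicator (cyl m w) i * g w) = g (prefix_word i n)"
  by (subst sum_if_cyl[OF assms, symmetric], rule sum.cong) (auto simp: indicator_def)

lemma sum_norm_cis_square:
  fixes p x :: "'a \<Rightarrow> real"
  shows "(cmod (\<Sum>w\<in>A. p w *\<^sub>R cis (x w)))\<^sup>2 = (\<Sum>v\<in>A. \<Sum>w\<in>A. p v * p w * cos (x v - x w))"
proof -
  have "(cmod (\<Sum>w\<in>A. p w *\<^sub>R cis (x w)))\<^sup>2 = (\<Sum>w\<in>A. p w * cos (x w)) * (\<Sum>w\<in>A. p w * cos (x w))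
     + (\<Sum>w\<in>A. p w * sin (x w)) * (\<Sum>w\<in>A. p w * sin (x w))"
    unfolding cmod_power2 by (simp add: power2_eq_square)
  also have "\<dots> = (\<Sum>v\<in>A. \<Sum>w\<in>A. p v * p w * cos (x v - x w))"
    unfolding sum_product sum.distrib[symmetric]
    by (intro sum.cong refl) (simp add: cos_diff algebra_simps)
  finally show ?thesis .
qed

lemma norm_cis_diff_le: "cmod (cis x - cis y) \<le> \<bar>x - y\<bar>"
proof -
  have "cis x - cis y = cis y * (cis (x - y) - 1)" by (simp add: algebra_simps cis_mult)
  then have "cmod (cis x - cis y) = cmod (cis (x - y) - 1)" by (simp add: norm_mult)
  also have "\<dots> = cmod (exp (\<i> * of_real (x - y)) - 1)" by (simp add: cis_conv_exp)
  also have "\<dots> \<le> \<bar>x - y\<bar>"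
    using norm_triangle_ineq4[of 1 1] iexp_approx1[of "x - y" 0] by simp
  finally show ?thesis .
qed

lemma (in finite_measure) norm_integral_le:
  fixes g :: "'a \<Rightarrow> 'b :: {banach, second_countable_topology}"
  assumes "integrable M g" "\<And>x. x \<in> space M \<Longrightarrow> norm (g x) \<le> C"
  shows "norm (\<integral>x. g x \<partial>M) \<le> C * measure M (space M)"
proof -
  have "norm (\<integral>x. g x \<partial>M) \<le> (\<integral>x. norm (g x) \<partial>M)" by (rule integral_norm_bound)
  also have "\<dots> \<le> (\<integral>x. C \<partial>M)" using assms by (intro integral_mono) auto
  finally show ?thesis by (simp add: mult.commute)
qed

lemma nn_integral_continuous_atLeastAtMost:
  fixes g :: "real \<Rightarrow> real"
  assumes "continuous_on {x..y} g" "\<And>z. z \<in> {x..y} \<Longrightarrow> 0 \<le> g z"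
  shows "(\<integral>\<^sup>+ z \<in> {x..y}. ennreal (g z) \<partial>lborel) = ennreal (integral {x..y} g)"
proof -
  have "(\<integral>\<^sup>+ z \<in> {x..y}. ennreal (g z) \<partial>lborel) = (\<integral>\<^sup>+ z. ennreal (indicator {x..y} z *\<^sub>R g z) \<partial>lborel)"
    by (intro nn_integral_cong) (auto split: split_indicator)
  also have "\<dots> = ennreal (integral {x..y} g)"
  proof (rule nn_integral_has_integral_lborel)
    show "(\<lambda>z. indicator {x..y} z *\<^sub>R g z) \<in> borel_measurable borel"
      by (intro borel_measurable_continuous_on_indicator assms) auto
    show "((\<lambda>z. indicator {x..y} z *\<^sub>R g z) has_integral integral {x..y} g) UNIV"
      unfolding indicator_scaleR_eq_if has_integral_restrict_UNIV
      using assms by (intro integrable_integral integrable_continuous_interval)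
  qed (use assms in \<open>auto split: split_indicator\<close>)
  finally show ?thesis .
qed

locale measured_ifs = transversal_ifs +
  fixes \<mu> :: "real \<Rightarrow> (nat \<Rightarrow> nat) measure" and c \<theta> :: real
  assumes m: "0 < m"
    and meas: "\<And>lam. lam \<in> {u0..u1} \<Longrightarrow> finite_measure (\<mu> lam) \<and> sets (\<mu> lam) = sets (SigmaM m)"
    and c: "0 < c" and theta: "0 < \<theta>"
    and M: "\<And>w lam lam'. w \<in> words m \<Longrightarrow> lam \<in> {u0..u1} \<Longrightarrow> lam' \<in> {u0..u1} \<Longrightarrow>
              exp (- c * \<bar>lam - lam'\<bar> powr \<theta> * real (length w)) * measure (\<mu> lam') (cyl m w)
                \<le> measure (\<mu> lam) (cyl m w)
            \<and> measure (\<mu> lam) (cyl m w)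
                \<le> exp (c * \<bar>lam - lam'\<bar> powr \<theta> * real (length w)) * measure (\<mu> lam') (cyl m w)"
begin

definition mass :: "real \<Rightarrow> nat list \<Rightarrow> real" where
  "mass lam w = measure (\<mu> lam) (cyl m w)"

definition pt :: "real \<Rightarrow> nat list \<Rightarrow> real" where
  "pt lam w = Proj f a lam (extend_word w)"

lemma mass_nonneg: "0 \<le> mass lam w" by (simp add: mass_def)

lemma space_mu: "lam \<in> {u0..u1} \<Longrightarrow> space (\<mu> lam) = space (SigmaM m)"
  using meas by (auto dest: sets_eq_imp_space_eq)

lemma mass_le:
  assumes "w \<in> words m" "lam \<in> {u0..u1}" "lam' \<in> {u0..u1}"
  shows "mass lam w \<le> exp (c * \<bar>lam - lam'\<bar> powr \<theta> * real (length w)) * mass lam' w"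
  using M[OF assms] by (simp add: mass_def)

lemma continuous_on_mass:
  assumes "w \<in> words m" shows "continuous_on {u0..u1} (\<lambda>lam. mass lam w)"
  unfolding continuous_on_def
proof
  fix y assume y: "y \<in> {u0..u1}"
  have "((\<lambda>x. \<bar>x - y\<bar>) \<longlongrightarrow> \<bar>y - y\<bar>) (at y within {u0..u1})" by (intro tendsto_intros)
  then have z: "((\<lambda>x. \<bar>x - y\<bar> powr \<theta>) \<longlongrightarrow> 0) (at y within {u0..u1})"
    using theta by (intro tendsto_zero_powrI[where b=\<theta>]) auto
  have "((\<lambda>x. exp (- c * \<bar>x - y\<bar> powr \<theta> * real (length w)) * mass y w) \<longlongrightarrow> exp (- c * 0 * real (length w)) * mass y w) (at y within {u0..u1})"
    by (intro tendsto_intros z)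
  moreover have "((\<lambda>x. exp (c * \<bar>x - y\<bar> powr \<theta> * real (length w)) * mass y w) \<longlongrightarrow> exp (c * 0 * real (length w)) * mass y w) (at y within {u0..u1})"
    by (intro tendsto_intros z)
  ultimately show "((\<lambda>x. mass x w) \<longlongrightarrow> mass y w) (at y within {u0..u1})"
    using M[OF assms _ y] by (intro tendsto_sandwich[of "\<lambda>x. exp (- c * \<bar>x - y\<bar> powr \<theta> * real (length w)) * mass y w"
        "\<lambda>x. mass x w" _ "\<lambda>x. exp (c * \<bar>x - y\<bar> powr \<theta> * real (length w)) * mass y w"])
      (auto simp: eventually_at_filter mass_def)
qed

lemma continuous_on_pt:
  assumes "w \<in> words m" shows "continuous_on {u0..u1} (\<lambda>lam. pt lam w)"
  using continuous_on_comp_word_Proj[of "[]" "extend_word w"] extend_word_in[OF m assms]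
  by (simp add: pt_def words_def)

text \<open>For the empty word the exponentials in (M) equal 1, so the total mass is the same for
  all parameters; \<open>mass u0 []\<close> serves as its name.\<close>

lemma mass_Nil: "lam \<in> {u0..u1} \<Longrightarrow> mass lam [] = mass u0 []"
  using mass_le[of "[]" lam u0] mass_le[of "[]" u0 lam] U by (simp add: words_def)

lemma measure_space: "lam \<in> {u0..u1} \<Longrightarrow> measure (\<mu> lam) (space (\<mu> lam)) = mass u0 []"
  using mass_Nil[of lam] by (simp add: mass_def cyl_def space_mu)

definition fourier_approx :: "real \<Rightarrow> nat \<Rightarrow> real \<Rightarrow> complex" where
  "fourier_approx lam n \<xi> = (\<Sum>w\<in>words_of_length m n. mass lam w *\<^sub>R cis (\<xi> * pt lam w))"

lemma fourier_eq:
  assumes "lam \<in> {u0..u1}"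
  shows "fourier (distr (\<mu> lam) lborel (Proj f a lam)) \<xi> = (\<integral>i. cis (\<xi> * Proj f a lam i) \<partial>\<mu> lam)"
proof -
  have "Proj f a lam \<in> \<mu> lam \<rightarrow>\<^sub>M lborel"
    using measurable_Proj[OF assms] meas[OF assms] by (simp add: measurable_cong_sets[of "\<mu> lam" "SigmaM m"])
  moreover have "(\<lambda>x. cis (\<xi> * x)) \<in> borel_measurable lborel"
    using borel_measurable_continuous_onI[of "\<lambda>x. cis (\<xi> * x)"] by (simp add: continuous_intros)
  ultimately show ?thesis unfolding fourier_def by (rule integral_distr)
qed

lemma integrable_cis_Proj:
  assumes "lam \<in> {u0..u1}"
  shows "integrable (\<mu> lam) (\<lambda>i. cis (\<xi> * Proj f a lam i))"
proof -
  interpret finite_measure "\<mu> lam" using meas assms by auto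
  have P: "Proj f a lam \<in> borel_measurable (\<mu> lam)"
    using measurable_Proj[OF assms] meas[OF assms] by (simp add: measurable_cong_sets[of "\<mu> lam" "SigmaM m"])
  have "(\<lambda>x. cis (\<xi> * x)) \<in> borel_measurable borel"
    by (intro borel_measurable_continuous_onI continuous_intros)
  from measurable_compose[OF P this] show ?thesis
    by (intro integrable_const_bound[of _ 1]) auto
qed

lemma norm_fourier_le:
  assumes "lam \<in> {u0..u1}"
  shows "cmod (fourier (distr (\<mu> lam) lborel (Proj f a lam)) \<xi>) \<le> mass u0 []"
proof -
  interpret finite_measure "\<mu> lam" using meas assms by auto
  have "cmod (\<integral>i. cis (\<xi> * Proj f a lam i) \<partial>\<mu> lam) \<le> 1 * measure (\<mu> lam) (space (\<mu> lam))"
    by (intro norm_integral_le integrable_cis_Proj assms) auto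
  then show ?thesis by (simp add: fourier_eq[OF assms] measure_space[OF assms])
qed

text \<open>Within a cylinder of length \<open>n\<close> the projection varies by at most
  \<open>\<gamma>2 ^ n * (b - a)\<close>, and \<open>cis\<close> is 1-Lipschitz. The error is linear
  in the frequency, so a length proportional to its logarithm suffices.\<close>

lemma fourier_approx_error:
  assumes "lam \<in> {u0..u1}"
  shows "cmod (fourier (distr (\<mu> lam) lborel (Proj f a lam)) \<xi> - fourier_approx lam n \<xi>)
    \<le> \<bar>\<xi>\<bar> * (\<gamma>2 ^ n * (b - a)) * mass u0 []"
proof -
  interpret finite_measure "\<mu> lam" using meas assms by auto
  let ?g = "\<lambda>i. \<Sum>w\<in>words_of_length m n. indicator (cyl m w) i *\<^sub>R cis (\<xi> * pt lam w)"
  have cyl: "cyl m w \<in> sets (\<mu> lam)" for w using sets_cyl meas[OF assms] by auto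
  have "has_bochner_integral (\<mu> lam) (\<lambda>i. indicator (cyl m w) i *\<^sub>R cis (\<xi> * pt lam w)) (mass lam w *\<^sub>R cis (\<xi> * pt lam w))" for w
    using has_bochner_integral_scaleR_left[OF has_bochner_integral_real_indicator[OF cyl[of w]]]
    by (simp add: mass_def emeasure_eq_measure)
  then have "has_bochner_integral (\<mu> lam) ?g (fourier_approx lam n \<xi>)"
    unfolding fourier_approx_def by (intro has_bochner_integral_sum)
  then have g: "integrable (\<mu> lam) ?g" "fourier_approx lam n \<xi> = (\<integral>i. ?g i \<partial>\<mu> lam)"
    by (auto simp: has_bochner_integral_iff)
  have "cmod (\<integral>i. cis (\<xi> * Proj f a lam i) - ?g i \<partial>\<mu> lam) \<le> \<bar>\<xi>\<bar> * (\<gamma>2 ^ n * (b - a)) * measure (\<mu> lam) (space (\<mu> lam))"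
  proof (intro norm_integral_le Bochner_Integration.integrable_diff integrable_cis_Proj assms g)
    fix i assume "i \<in> space (\<mu> lam)"
    then have i: "i \<in> space (SigmaM m)" using space_mu[OF assms] by simp
    define w where "w = prefix_word i n"
    have w: "w \<in> words m" "length w = n" using i by (auto simp: w_def prefix_word_in_words)
    have "?g i = cis (\<xi> * pt lam w)" unfolding w_def by (rule sum_indicator_cyl_scaleR[OF i])
    then have "cmod (cis (\<xi> * Proj f a lam i) - ?g i) \<le> \<bar>\<xi> * Proj f a lam i - \<xi> * pt lam w\<bar>"
      using norm_cis_diff_le by simp
    also have "\<dots> = \<bar>\<xi>\<bar> * \<bar>Proj f a lam i - Proj f a lam (extend_word w)\<bar>"
      by (simp add: pt_def abs_mult right_diff_distrib[symmetric])
    also have "\<dots> \<le> \<bar>\<xi>\<bar> * (\<gamma>2 ^ n * (b - a))"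
      using prefix_extend_word[of w] w
      by (intro mult_left_mono Proj_prefix assms i extend_word_in m) (auto simp: w_def)
    finally show "cmod (cis (\<xi> * Proj f a lam i) - ?g i) \<le> \<bar>\<xi>\<bar> * (\<gamma>2 ^ n * (b - a))" .
  qed
  then show ?thesis
    using g integrable_cis_Proj[OF assms] by (simp add: fourier_eq[OF assms] measure_space[OF assms] mult.commute)
qed

definition kernel_energy :: "real \<Rightarrow> nat \<Rightarrow> real \<Rightarrow> real" where
  "kernel_energy t n lam = (\<Sum>v\<in>words_of_length m n. \<Sum>w\<in>words_of_length m n.
     mass lam v * mass lam w * kernel (t * (pt lam v - pt lam w)))"

text \<open>The squared exponential sum expands into cosines of differences, each of which
  integrates to a value of the kernel. So up to the factor \<open>pi * t\<close> the pair sum is a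
  weighted L2 norm on the Fourier side.\<close>

lemma has_bochner_integral_kernel_energy:
  assumes "0 < t"
  shows "has_bochner_integral lborel (\<lambda>\<xi>. (2 - 2 * cos (\<xi> / t))\<^sup>2 / (\<xi> / t)\<^sup>2 * (cmod (fourier_approx lam n \<xi>))\<^sup>2)
     (pi * t * kernel_energy t n lam)"
proof -
  let ?W = "words_of_length m n"
  have "has_bochner_integral lborel (\<lambda>\<xi>. \<Sum>v\<in>?W. \<Sum>w\<in>?W. mass lam v * mass lam w *
       ((2 - 2 * cos (\<xi> / t))\<^sup>2 / (\<xi> / t)\<^sup>2 * cos (\<xi> * (pt lam v - pt lam w))))
     (\<Sum>v\<in>?W. \<Sum>w\<in>?W. mass lam v * mass lam w * (pi * t * kernel (t * (pt lam v - pt lam w))))"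
    by (intro has_bochner_integral_sum has_bochner_integral_mult_right has_bochner_integral_kernel_cos assms)
  moreover have "(\<Sum>v\<in>?W. \<Sum>w\<in>?W. mass lam v * mass lam w *
       ((2 - 2 * cos (\<xi> / t))\<^sup>2 / (\<xi> / t)\<^sup>2 * cos (\<xi> * (pt lam v - pt lam w))))
     = (2 - 2 * cos (\<xi> / t))\<^sup>2 / (\<xi> / t)\<^sup>2 * (cmod (fourier_approx lam n \<xi>))\<^sup>2" for \<xi>
    unfolding fourier_approx_def sum_norm_cis_square sum_distrib_left
    by (intro sum.cong refl) (simp add: right_diff_distrib)
  moreover have "(\<Sum>v\<in>?W. \<Sum>w\<in>?W. mass lam v * mass lam w * (pi * t * kernel (t * (pt lam v - pt lam w))))
     = pi * t * kernel_energy t n lam"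
    unfolding kernel_energy_def sum_distrib_left by (intro sum.cong refl) (simp add: algebra_simps)
  ultimately show ?thesis by simp
qed

text \<open>Invisible from the sign-changing kernel, but clear on the Fourier side. Thanks to this
  an integral over the small window is bounded by one against the cutoff.\<close>

lemma kernel_energy_nonneg: "0 < t \<Longrightarrow> 0 \<le> kernel_energy t n lam"
proof -
  assume t: "0 < t"
  have "0 \<le> pi * t * kernel_energy t n lam"
    unfolding has_bochner_integral_integral_eq[OF has_bochner_integral_kernel_energy[OF t], symmetric]
    by (intro integral_nonneg_AE) auto
  moreover have "0 < pi * t" using t by simp
  ultimately show ?thesis by (meson mult_pos_neg not_le)
qed

lemma continuous_on_kernel_energy: "continuous_on {u0..u1} (kernel_energy t n)"
  unfolding kernel_energy_def
  by (intro continuous_intros continuous_on_mass continuous_on_pt) (auto simp: words_of_length_def)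

text \<open>The symbol on the shell is bounded below by its numerator at 1 over its denominator at
  2, that is (2 - 2 cos 1)^2 / 2^2.\<close>

definition symbol_floor :: real where "symbol_floor = (1 - cos 1)\<^sup>2"

lemma symbol_floor_pos: "0 < symbol_floor"
  using cos_monotone_0_pi[of 0 1] pi_gt3 by (simp add: symbol_floor_def)

lemma symbol_floor_le:
  assumes "1 \<le> \<bar>x\<bar>" "\<bar>x\<bar> \<le> 2" shows "symbol_floor \<le> (2 - 2 * cos x)\<^sup>2 / x\<^sup>2"
proof -
  have "cos \<bar>x\<bar> \<le> cos 1" using assms pi_gt3 by (intro cos_monotone_0_pi_le) auto
  then have "cos x \<le> cos 1" by simp
  then have "(2 - 2 * cos 1)\<^sup>2 \<le> (2 - 2 * cos x)\<^sup>2"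
    by (intro power_mono) auto
  moreover have "x\<^sup>2 \<le> 2\<^sup>2" using assms by (metis abs_ge_zero power2_abs power_mono)
  moreover have "0 < x\<^sup>2" using assms by auto
  ultimately have le: "(2 - 2 * cos 1)\<^sup>2 / 2\<^sup>2 \<le> (2 - 2 * cos x)\<^sup>2 / x\<^sup>2"
    by (intro frac_le) auto
  have eq: "(2 - 2 * cos 1)\<^sup>2 / 2\<^sup>2 = symbol_floor"
    unfolding symbol_floor_def power_divide[symmetric] by (simp add: diff_divide_distrib)
  show ?thesis using le unfolding eq .
qed

text \<open>The leading 4 is 2 from squaring a sum of two terms times 2 from
  \<open>2 powr (2 * \<gamma>) \<le> 2\<close>. In the second summand \<open>4 * t\<close> is the
  length of the interval from \<open>- 2 * t\<close> to \<open>2 * t\<close>, and the square is that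
  of the discretisation error at frequency \<open>2 * t\<close>.\<close>

definition shell_bound :: "real \<Rightarrow> nat \<Rightarrow> real \<Rightarrow> real \<Rightarrow> real" where
  "shell_bound \<gamma> n t lam = 4 * t powr (2 * \<gamma>) * (pi * t / symbol_floor * kernel_energy t n lam
      + 4 * t * (2 * t * (\<gamma>2 ^ n * (b - a)) * mass u0 [])\<^sup>2)"

lemma shell_bound_nonneg: "0 < t \<Longrightarrow> 0 \<le> shell_bound \<gamma> n t lam"
  unfolding shell_bound_def using kernel_energy_nonneg symbol_floor_pos
  by (intro mult_nonneg_nonneg add_nonneg_nonneg) auto

text \<open>Frequencies up to 1 are bounded by the total mass; beyond, the shell containing \<xi>
  decides which discretisation is used, so each shell may have its own word length
  \<open>n N\<close>.\<close>

lemma sobolev_sq_le: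
  assumes lam: "lam \<in> {u0..u1}" and \<gamma>: "0 < \<gamma>" "2 * \<gamma> \<le> 1"
  shows "sobolev_sq (distr (\<mu> lam) lborel (Proj f a lam)) \<gamma>
     \<le> ennreal (2 * (mass u0 [])\<^sup>2) + (\<Sum>N. ennreal (shell_bound \<gamma> (n N) (2 ^ N) lam))"
proof -
  define F where "F \<xi> = cmod (fourier (distr (\<mu> lam) lborel (Proj f a lam)) \<xi>)" for \<xi>
  define k where "k x = (2 - 2 * cos x)\<^sup>2 / x\<^sup>2" for x :: real
  define err where "err N = 2 * 2 ^ N * (\<gamma>2 ^ n N * (b - a)) * mass u0 []" for N
  \<comment> \<open>\<open>A N\<close> is a nonnegative majorant that has to be effective on the
    shell \<open>N\<close> only; elsewhere it just adds to the sum. Its integral over the whole line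
    is known exactly.\<close>
  define A where "A N \<xi> = 4 * (2 ^ N) powr (2 * \<gamma>) * (k (\<xi> / 2 ^ N) * (cmod (fourier_approx lam (n N) \<xi>))\<^sup>2 / symbol_floor
      + indicator {- 2 * 2 ^ N..2 * 2 ^ N} \<xi> * (err N)\<^sup>2)" for N \<xi>
  have A0: "0 \<le> A N \<xi>" for N \<xi>
    unfolding A_def k_def using symbol_floor_pos by (intro mult_nonneg_nonneg add_nonneg_nonneg divide_nonneg_nonneg) auto
  have hA: "has_bochner_integral lborel (A N) (shell_bound \<gamma> (n N) (2 ^ N) lam)" for N
  proof -
    have "has_bochner_integral lborel (indicator {- 2 * 2 ^ N..2 * 2 ^ N} :: real \<Rightarrow> real) (measure lborel {- 2 * 2 ^ N..2 * 2 ^ N :: real})"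
      by (intro has_bochner_integral_real_indicator) auto
    then have "has_bochner_integral lborel (indicator {- 2 * 2 ^ N..2 * 2 ^ N} :: real \<Rightarrow> real) (4 * 2 ^ N)"
      by simp
    then have "has_bochner_integral lborel (A N) (4 * (2 ^ N) powr (2 * \<gamma>) * (pi * 2 ^ N * kernel_energy (2 ^ N) (n N) lam / symbol_floor
        + 4 * 2 ^ N * (err N)\<^sup>2))"
      unfolding A_def k_def
      by (intro has_bochner_integral_mult_right has_bochner_integral_add has_bochner_integral_divide
          has_bochner_integral_mult_left has_bochner_integral_kernel_energy) auto
    then show ?thesis by (simp add: shell_bound_def err_def)
  qed
  have nA: "(\<integral>\<^sup>+\<xi>. ennreal (A N \<xi>) \<partial>lborel) = ennreal (shell_bound \<gamma> (n N) (2 ^ N) lam)" for N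
    using hA[of N] A0 by (simp add: nn_integral_eq_integral has_bochner_integral_iff)
  have F0: "0 \<le> F \<xi>" "F \<xi> \<le> mass u0 []" for \<xi>
    unfolding F_def using norm_fourier_le[OF lam] by auto
  have pw: "ennreal ((F \<xi>)\<^sup>2 * \<bar>\<xi>\<bar> powr (2 * \<gamma>)) \<le> ennreal ((mass u0 [])\<^sup>2) * indicator {-1..1} \<xi> + (\<Sum>N. ennreal (A N \<xi>))" for \<xi>
  proof (cases "\<bar>\<xi>\<bar> \<le> 1")
    case True
    have "(F \<xi>)\<^sup>2 * \<bar>\<xi>\<bar> powr (2 * \<gamma>) \<le> (mass u0 [])\<^sup>2 * 1"
      using F0 True \<gamma> by (intro mult_mono power_mono powr_le1) auto
    moreover have "\<xi> \<in> {-1..1}" using True by auto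
    ultimately show ?thesis by (auto intro!: add_increasing2 ennreal_leI)
  next
    case False
    then have "\<exists>N. \<bar>\<xi>\<bar> < 2 ^ N" using real_arch_pow[of 2 "\<bar>\<xi>\<bar>"] by auto
    \<comment> \<open>\<open>N1\<close> is positive since \<open>1 < \<bar>\<xi>\<bar>\<close>, so
      its predecessor \<open>N\<close> satisfies \<open>2 ^ N \<le> \<bar>\<xi>\<bar>\<close>: this
      is the shell of \<xi>.\<close>
    define N1 where "N1 = (LEAST N. \<bar>\<xi>\<bar> < 2 ^ N)"
    have N1: "\<bar>\<xi>\<bar> < 2 ^ N1" unfolding N1_def by (rule LeastI_ex) fact
    with False obtain N where N: "N1 = Suc N" by (cases N1) auto
    have lo: "2 ^ N \<le> \<bar>\<xi>\<bar>" using not_less_Least[of N "\<lambda>N. \<bar>\<xi>\<bar> < 2 ^ N"] N by (simp add: N1_def[symmetric] not_less)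
    have hi: "\<bar>\<xi>\<bar> \<le> 2 * 2 ^ N" using N1 N by simp
    define a' where "a' = cmod (fourier_approx lam (n N) \<xi>)"
    have "F \<xi> \<le> a' + \<bar>\<xi>\<bar> * (\<gamma>2 ^ n N * (b - a)) * mass u0 []"
      using fourier_approx_error[OF lam, of \<xi> "n N"] norm_triangle_sub[of "fourier (distr (\<mu> lam) lborel (Proj f a lam)) \<xi>" "fourier_approx lam (n N) \<xi>"]
      unfolding F_def a'_def by linarith
    also have "\<dots> \<le> a' + err N"
      unfolding err_def using hi gam2 ab mass_nonneg[of u0 "[]"] by (intro add_left_mono mult_right_mono) auto
    finally have "(F \<xi>)\<^sup>2 \<le> (a' + err N)\<^sup>2" using F0 by (intro power_mono) auto
    also have "\<dots> \<le> 2 * (a'\<^sup>2 + (err N)\<^sup>2)"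
      using sum_squares_bound[of a' "err N"] by (simp add: power2_sum)
    also have "\<dots> \<le> 2 * (k (\<xi> / 2 ^ N) * a'\<^sup>2 / symbol_floor + indicator {- 2 * 2 ^ N..2 * 2 ^ N} \<xi> * (err N)\<^sup>2)"
    proof -
      have "symbol_floor \<le> k (\<xi> / 2 ^ N)"
        unfolding k_def using lo hi by (intro symbol_floor_le) (auto simp: field_simps)
      then have "symbol_floor * a'\<^sup>2 \<le> k (\<xi> / 2 ^ N) * a'\<^sup>2" by (intro mult_right_mono) auto
      then have "a'\<^sup>2 \<le> k (\<xi> / 2 ^ N) * a'\<^sup>2 / symbol_floor" using symbol_floor_pos by (simp add: field_simps)
      moreover have "\<xi> \<in> {- 2 * 2 ^ N..2 * 2 ^ N}" using hi by auto
      ultimately show ?thesis by simp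
    qed
    finally have F2: "(F \<xi>)\<^sup>2 \<le> 2 * (k (\<xi> / 2 ^ N) * a'\<^sup>2 / symbol_floor + indicator {- 2 * 2 ^ N..2 * 2 ^ N} \<xi> * (err N)\<^sup>2)" .
    have "\<bar>\<xi>\<bar> powr (2 * \<gamma>) \<le> (2 * 2 ^ N) powr (2 * \<gamma>)" using hi \<gamma> by (intro powr_mono2) auto
    also have "\<dots> = 2 powr (2 * \<gamma>) * (2 ^ N) powr (2 * \<gamma>)" by (rule powr_mult)
    also have "\<dots> \<le> 2 powr 1 * (2 ^ N) powr (2 * \<gamma>)" using \<gamma> by (intro mult_right_mono powr_mono) auto
    finally have "\<bar>\<xi>\<bar> powr (2 * \<gamma>) \<le> 2 * (2 ^ N) powr (2 * \<gamma>)" by simp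
    then have "(F \<xi>)\<^sup>2 * \<bar>\<xi>\<bar> powr (2 * \<gamma>) \<le> 2 * (k (\<xi> / 2 ^ N) * a'\<^sup>2 / symbol_floor + indicator {- 2 * 2 ^ N..2 * 2 ^ N} \<xi> * (err N)\<^sup>2)
        * (2 * (2 ^ N) powr (2 * \<gamma>))"
      by (intro mult_mono order_trans[OF zero_le_power2 F2] F2) auto
    also have "\<dots> = A N \<xi>" by (simp add: A_def a'_def algebra_simps)
    finally have "ennreal ((F \<xi>)\<^sup>2 * \<bar>\<xi>\<bar> powr (2 * \<gamma>)) \<le> ennreal (A N \<xi>)" by (rule ennreal_leI)
    also have "\<dots> \<le> (\<Sum>N. ennreal (A N \<xi>))"
      using sum_le_suminf[of "\<lambda>N. ennreal (A N \<xi>)" "{N}"] by (simp add: summableI)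
    finally show ?thesis by (simp add: add_increasing)
  qed
  have mA: "A N \<in> borel_measurable lborel" for N using hA[of N] by (auto simp: has_bochner_integral_iff)
  have "sobolev_sq (distr (\<mu> lam) lborel (Proj f a lam)) \<gamma>
     \<le> (\<integral>\<^sup>+\<xi>. ennreal ((mass u0 [])\<^sup>2) * indicator {-1..1} \<xi> + (\<Sum>N. ennreal (A N \<xi>)) \<partial>lborel)"
    unfolding sobolev_sq_def F_def[symmetric] by (intro nn_integral_mono pw)
  also have "\<dots> = (\<integral>\<^sup>+\<xi>. ennreal ((mass u0 [])\<^sup>2) * indicator {-1..1::real} \<xi> \<partial>lborel) + (\<integral>\<^sup>+\<xi>. (\<Sum>N. ennreal (A N \<xi>)) \<partial>lborel)"
    using mA by (intro nn_integral_add) auto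
  also have "(\<integral>\<^sup>+\<xi>. (\<Sum>N. ennreal (A N \<xi>)) \<partial>lborel) = (\<Sum>N. ennreal (shell_bound \<gamma> (n N) (2 ^ N) lam))"
    using mA by (subst nn_integral_suminf) (auto simp: nA)
  also have "(\<integral>\<^sup>+\<xi>. ennreal ((mass u0 [])\<^sup>2) * indicator {-1..1::real} \<xi> \<partial>lborel) = ennreal (2 * (mass u0 [])\<^sup>2)"
  proof -
    have "emeasure lborel {-1..1::real} = ennreal 2" by (subst emeasure_lborel_Icc) auto
    then have "(\<integral>\<^sup>+\<xi>. ennreal ((mass u0 [])\<^sup>2) * indicator {-1..1::real} \<xi> \<partial>lborel)
        = ennreal ((mass u0 [])\<^sup>2) * ennreal 2"
      by (subst nn_integral_cmult_indicator) simp_all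
    also have "\<dots> = ennreal ((mass u0 [])\<^sup>2 * 2)" by (rule ennreal_mult[symmetric]) auto
    finally show ?thesis by (simp only: mult.commute)
  qed
  finally show ?thesis .
qed

end

section \<open>Summation against the energy\<close>

lemma measurable_continuous_atLeastAtMost:
  fixes g :: "real \<Rightarrow> real"
  assumes "continuous_on {x..y} g"
  shows "(\<lambda>z. ennreal (g z) * indicator {x..y} z) \<in> borel_measurable lborel"
proof -
  have "(\<lambda>z. indicator {x..y} z *\<^sub>R g z) \<in> borel_measurable borel"
    by (intro borel_measurable_continuous_on_indicator assms) auto
  then have "(\<lambda>z. ennreal (indicator {x..y} z *\<^sub>R g z)) \<in> borel_measurable lborel" by simp
  moreover have "(\<lambda>z. ennreal (indicator {x..y} z *\<^sub>R g z)) = (\<lambda>z. ennreal (g z) * indicator {x..y} z)"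
    by (auto split: split_indicator)
  ultimately show ?thesis by simp
qed

context measured_ifs
begin

text \<open>Comparison of the energy integrand with a step function constant on products of
  cylinders of length \<open>n\<close>, whose double integral is a finite sum.\<close>

lemma energy_ge:
  assumes lam: "lam \<in> {u0..u1}"
    and e0: "\<And>v w. v \<in> words_of_length m n \<Longrightarrow> w \<in> words_of_length m n \<Longrightarrow> 0 \<le> e v w"
    and e: "\<And>v w i j. v \<in> words_of_length m n \<Longrightarrow> w \<in> words_of_length m n \<Longrightarrow> i \<in> cyl m v \<Longrightarrow> j \<in> cyl m w \<Longrightarrow>
       ennreal (e v w) \<le> (if d i j = 0 then \<infinity> else ennreal (d i j powr (- s)))"
  shows "ennreal (\<Sum>v\<in>words_of_length m n. \<Sum>w\<in>words_of_length m n. e v w * (mass lam v * mass lam w)) \<le> energy (\<mu> lam) d s"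
proof -
  interpret finite_measure "\<mu> lam" using meas lam by auto
  let ?W = "words_of_length m n"
  let ?h = "\<lambda>i j. \<Sum>v\<in>?W. indicator (cyl m v) i * (\<Sum>w\<in>?W. indicator (cyl m w) j * ennreal (e v w))"
  have cyl [measurable]: "cyl m w \<in> sets (\<mu> lam)" for w using sets_cyl meas[OF lam] by auto
  have em: "emeasure (\<mu> lam) (cyl m w) = ennreal (mass lam w)" for w
    by (simp add: emeasure_eq_measure mass_def)
  have "(\<integral>\<^sup>+i. \<integral>\<^sup>+j. ?h i j \<partial>\<mu> lam \<partial>\<mu> lam) \<le> energy (\<mu> lam) d s"
    unfolding energy_def
  proof (intro nn_integral_mono)
    fix i j assume "i \<in> space (\<mu> lam)" "j \<in> space (\<mu> lam)"
    then have ij: "i \<in> space (SigmaM m)" "j \<in> space (SigmaM m)" by (auto simp: space_mu[OF lam])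
    have "?h i j = ennreal (e (prefix_word i n) (prefix_word j n))"
      by (simp only: sum_indicator_cyl_mult[OF ij(1)] sum_indicator_cyl_mult[OF ij(2)])
    also have "\<dots> \<le> (if d i j = 0 then \<infinity> else ennreal (d i j powr (- s)))"
      using ij by (intro e) (auto simp: words_of_length_def prefix_word_in_words mem_cyl_iff)
    finally show "?h i j \<le> (if d i j = 0 then \<infinity> else ennreal (d i j powr (- s)))" .
  qed
  moreover have "(\<integral>\<^sup>+j. ?h i j \<partial>\<mu> lam) = (\<Sum>v\<in>?W. indicator (cyl m v) i * (\<Sum>w\<in>?W. ennreal (mass lam w) * ennreal (e v w)))" for i
    by (simp add: nn_integral_sum nn_integral_cmult nn_integral_multc em del: sum_indicator_mult)
  moreover have "(\<integral>\<^sup>+i. (\<Sum>v\<in>?W. indicator (cyl m v) i * (\<Sum>w\<in>?W. ennreal (mass lam w) * ennreal (e v w))) \<partial>\<mu> lam)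
      = (\<Sum>v\<in>?W. ennreal (mass lam v) * (\<Sum>w\<in>?W. ennreal (mass lam w) * ennreal (e v w)))"
    by (simp add: nn_integral_sum nn_integral_multc em del: sum_indicator_mult)
  moreover have "(\<Sum>v\<in>?W. ennreal (mass lam v) * (\<Sum>w\<in>?W. ennreal (mass lam w) * ennreal (e v w)))
      = ennreal (\<Sum>v\<in>?W. \<Sum>w\<in>?W. e v w * (mass lam v * mass lam w))"
  proof -
    have "ennreal (\<Sum>v\<in>?W. \<Sum>w\<in>?W. e v w * (mass lam v * mass lam w)) = (\<Sum>v\<in>?W. \<Sum>w\<in>?W. ennreal (e v w * (mass lam v * mass lam w)))"
      using e0 mass_nonneg by (simp add: sum_ennreal sum_nonneg)
    also have "\<dots> = (\<Sum>v\<in>?W. ennreal (mass lam v) * (\<Sum>w\<in>?W. ennreal (mass lam w) * ennreal (e v w)))"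
      unfolding sum_distrib_left using e0 mass_nonneg
      by (intro sum.cong refl) (simp add: ennreal_mult mult_ac)
    finally show ?thesis ..
  qed
  ultimately show ?thesis by simp
qed

text \<open>The constant \<open>C\<close> of \<open>oscillation_estimate\<close>; it depends on the
  window and on \<open>q\<close>, but not on the words or the frequency.\<close>

definition osc_const :: "real \<Rightarrow> real \<Rightarrow> real" where
  "osc_const r q = 24 * (4 / (\<eta> * r)) powr q
     + 2 * (4 * (1 / r + 2 * c) + 64 / \<eta> * (2 * taylor_const + slope_const * (\<eta> / 2 + 2 * lip_const))) * (4 / \<eta>) powr q"

lemma osc_const_nonneg: "0 < r \<Longrightarrow> 0 \<le> osc_const r q"
  unfolding osc_const_def using taylor_const slope_const_nonneg lip_const c eta by (intro mult_nonneg_nonneg add_nonneg_nonneg) auto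

text \<open>Here \<open>e\<close> is a lower bound for the energy integrand on the product of the
  two cylinders. Distinct words oscillate. For equal words the kernel is constantly 4; the trivial
  bound suffices there, because \<open>t * \<gamma>2 ^ n \<le> 1\<close> makes distances within the
  cylinder at most a constant over \<open>t\<close>.\<close>

lemma pair_estimate:
  fixes q s \<kappa> l r :: real
  assumes r: "0 < r" "6 * r \<le> 1" and W: "{l - 3 * r..l + 3 * r} \<subseteq> {u0..u1}"
    and small: "12 * lip_const * r \<le> \<eta> / 2" "slope_const * (6 * r) \<le> \<kappa>" "2 * c * (6 * r) powr \<theta> \<le> \<kappa>"
    and q: "1 \<le> q" "q \<le> 2" "q \<le> 1 + min \<delta> \<theta>" and s: "q \<le> s"
    and t: "1 \<le> t" "t * \<gamma>2 ^ n \<le> 1" and n: "1 \<le> n"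
    and vw: "v \<in> words_of_length m n" "w \<in> words_of_length m n"
  obtains e where "0 \<le> e"
    "\<And>i j. i \<in> cyl m v \<Longrightarrow> j \<in> cyl m w \<Longrightarrow>
       ennreal e \<le> (if dlam f {a..b} l i j = 0 then \<infinity> else ennreal (dlam f {a..b} l i j powr (- s)))"
    "\<bar>integral {l - 3 * r..l + 3 * r} (\<lambda>x. trapezoid l r x * (mass x v * mass x w) * kernel (t * (pt x v - pt x w)))\<bar>
      \<le> (osc_const r q * distortion_const powr s + 24 * (b - a) powr s) * (real n * exp (\<kappa> * real n) ^ 7 * t powr (- q))
        * (e * (mass l v * mass l w))"
proof -
  let ?W = "{l - 3 * r..l + 3 * r}"
  define B where "B = exp (\<kappa> * real n)"
  define X where "X = real n * B ^ 7 * t powr (- q)"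
  have lU: "l \<in> {u0..u1}" using W r by auto
  have v: "v \<in> words m" "length v = n" and w: "w \<in> words m" "length w = n"
    using vw by (auto simp: words_of_length_def)
  \<comment> \<open>At distance 0 the energy integrand is infinite by definition, since the value of
    \<open>0 powr (- s)\<close> would be 0; the case split follows that convention.\<close>
  have cb: "ennreal (C powr (- s)) \<le> (if d = 0 then \<infinity> else ennreal (d powr (- s)))" if "0 \<le> d" "d \<le> C" for d C :: real
    using that powr_mono2'[of "- s" d C] q s by (auto intro!: ennreal_leI)
  have kap: "0 \<le> \<kappa>" using small(2) slope_const_nonneg r by (meson mult_nonneg_nonneg order_trans less_imp_le zero_le_numeral)
  have B1: "1 \<le> B" using kap by (simp add: B_def)
  have X0: "0 \<le> X" using B1 by (simp add: X_def)
  define h where "h x = mass x v * mass x w" for x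
  have h0: "0 \<le> h x" for x by (simp add: h_def mass_nonneg)
  have hc: "continuous_on ?W h"
    unfolding h_def using W by (intro continuous_intros continuous_on_subset[OF continuous_on_mass] v w)
  have hM: "h x \<le> exp (2 * c * \<bar>x - y\<bar> powr \<theta> * real n) * h y" if "x \<in> ?W" "y \<in> ?W" for x y
  proof -
    let ?E = "exp (c * \<bar>x - y\<bar> powr \<theta> * real n)"
    have "h x \<le> (?E * mass y v) * (?E * mass y w)"
      unfolding h_def using mass_le[OF v(1), of x y] mass_le[OF w(1), of x y] that W v w
      by (intro mult_mono) (auto simp: mass_nonneg)
    also have "\<dots> = (?E * ?E) * h y" by (simp add: h_def)
    also have "?E * ?E = exp (2 * c * \<bar>x - y\<bar> powr \<theta> * real n)"
      by (simp add: exp_add[symmetric] algebra_simps)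
    finally show ?thesis .
  qed
  show thesis
  proof (cases "v = w")
    case True
    define e where "e = (\<gamma>2 ^ n * (b - a)) powr (- s)"
    \<comment> \<open>\<open>1 / \<gamma>2 ^ n\<close> is at least \<open>t\<close> and at least 1,
      so its power \<open>s\<close> dominates \<open>t powr q\<close>.\<close>
    have le1: "1 \<le> t powr (- q) * (b - a) powr s * e"
    proof -
      have "t powr q \<le> (1 / \<gamma>2 ^ n) powr q"
        using t q gam2 by (intro powr_mono2) (auto simp: field_simps)
      also have "\<dots> \<le> (1 / \<gamma>2 ^ n) powr s"
        using s gam2 by (intro powr_mono) (auto simp: power_le_one)
      finally have "1 \<le> t powr (- q) * (1 / \<gamma>2 ^ n) powr s"
        using t by (simp add: powr_minus field_simps)
      moreover have "(1 / \<gamma>2 ^ n) powr s = (b - a) powr s * e"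
        unfolding e_def powr_minus powr_mult powr_divide using ab by (simp add: divide_inverse)
      ultimately show ?thesis by (simp add: mult.assoc)
    qed
    have F0: "\<bar>trapezoid l r x * h x * 4\<bar> \<le> B * h l * 4" if x: "x \<in> ?W" for x
    proof -
      have "2 * c * \<bar>x - l\<bar> powr \<theta> * real n \<le> 2 * c * (6 * r) powr \<theta> * real n"
        using c theta x r by (intro mult_right_mono mult_left_mono powr_mono2) auto
      also have "\<dots> \<le> \<kappa> * real n" using small(3) by (intro mult_right_mono) auto
      finally have "exp (2 * c * \<bar>x - l\<bar> powr \<theta> * real n) * h l \<le> B * h l"
        unfolding B_def using h0 by (intro mult_right_mono) auto
      moreover have "h x \<le> exp (2 * c * \<bar>x - l\<bar> powr \<theta> * real n) * h l" using x r by (intro hM) auto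
      moreover have "trapezoid l r x * h x \<le> 1 * h x" using h0 trapezoid_bounds[of l r x] by (intro mult_right_mono) auto
      ultimately show ?thesis using h0[of x] trapezoid_bounds[of l r x] by (simp add: abs_mult)
    qed
    have "norm (integral ?W (\<lambda>x. trapezoid l r x * h x * 4)) \<le> (B * h l * 4) * (l + 3 * r - (l - 3 * r))"
      by (rule integral_bound) (use F0 r hc in \<open>auto intro!: continuous_intros\<close>)
    then have "\<bar>integral ?W (\<lambda>x. trapezoid l r x * h x * 4)\<bar> \<le> 24 * r * (B * h l)" by (simp add: algebra_simps)
    also have "\<dots> \<le> 24 * 1 * (B * h l)"
      using r B1 h0 by (intro mult_right_mono) auto
    also have "\<dots> \<le> 24 * (real n * B ^ 7 * h l)"
      using n B1 h0 power_increasing[of 1 7 B] mult_mono[of 1 "real n" B "B ^ 7"] by (simp add: mult_right_mono)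
    also have "\<dots> = 24 * (real n * B ^ 7 * h l) * 1" by simp
    also have "\<dots> \<le> 24 * (real n * B ^ 7 * h l) * (t powr (- q) * (b - a) powr s * e)"
      using B1 h0 le1 by (intro mult_left_mono) auto
    also have "\<dots> = 24 * (b - a) powr s * X * (e * h l)" by (simp add: X_def algebra_simps)
    also have "\<dots> \<le> (osc_const r q * distortion_const powr s + 24 * (b - a) powr s) * X * (e * h l)"
      using osc_const_nonneg[OF r(1)] X0 h0 by (intro mult_right_mono) (auto simp: e_def)
    finally have "\<bar>integral ?W (\<lambda>x. trapezoid l r x * h x * 4)\<bar> \<le> (osc_const r q * distortion_const powr s + 24 * (b - a) powr s) * X * (e * h l)" .
    then show thesis
    proof (intro that[of e])
      fix i j assume "i \<in> cyl m v" "j \<in> cyl m w"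
      then have "i \<in> space (SigmaM m)" "prefix_word i n = prefix_word j n"
        using v w True by (auto simp: mem_cyl_iff)
      then show "ennreal e \<le> (if dlam f {a..b} l i j = 0 then \<infinity> else ennreal (dlam f {a..b} l i j powr (- s)))"
        unfolding e_def by (intro cb dlam_nonneg dlam_le_power lU)
    qed (auto simp: True h_def X_def B_def e_def kernel_0)
  next
    case False
    define k where "k = (LEAST k. v ! k \<noteq> w ! k)"
    have "\<exists>k<n. v ! k \<noteq> w ! k" using False v(2) w(2) nth_equalityI[of v w] by auto
    then obtain k' where k': "k' < n" "v ! k' \<noteq> w ! k'" by blast
    have k: "v ! k \<noteq> w ! k" unfolding k_def using k'(2) by (rule LeastI)
    have kn: "k < n" using Least_le[of "\<lambda>k. v ! k \<noteq> w ! k" k'] k' by (simp add: k_def)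
    have kl: "v ! l' = w ! l'" if "l' < k" for l' using not_less_Least that unfolding k_def by blast
    let ?i = "extend_word v" and ?j = "extend_word w"
    have ij: "?i \<in> space (SigmaM m)" "?j \<in> space (SigmaM m)" using v w by (auto intro: extend_word_in m)
    define \<sigma> where "\<sigma> = prefix_word ?i k"
    have pj: "prefix_word ?j k = \<sigma>"
      unfolding \<sigma>_def prefix_word_eq_iff using kl kn v w by (auto simp: extend_word_def)
    have \<sigma>: "\<sigma> \<in> words m" "length \<sigma> < n" using ij kn by (auto simp: \<sigma>_def prefix_word_in_words)
    \<comment> \<open>Cutting off the common prefix, of length \<open>k\<close>, leaves tails with
      distinct first letters, to which transversality applies.\<close>
    define i' j' where "i' = (\<lambda>l. ?i (k + l))" and "j' = (\<lambda>l. ?j (k + l))"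
    have ij': "i' \<in> space (SigmaM m)" "j' \<in> space (SigmaM m)" "i' 0 \<noteq> j' 0"
      using ij k kn v w by (auto simp: i'_def j'_def space_SigmaM) (simp add: extend_word_def)
    have pt: "pt x v - pt x w = comp_word f x \<sigma> (Proj f a x i') - comp_word f x \<sigma> (Proj f a x j')" if "x \<in> ?W" for x
      using Proj_split[OF _ ij(1), of x k] Proj_split[OF _ ij(2), of x k] that W
      by (auto simp: pt_def i'_def j'_def pj \<sigma>_def[symmetric])
    define Q where "Q = \<bar>word_slope l \<sigma> (Proj f a l i') (Proj f a l j')\<bar>"
    have Q: "0 < Q" "Q \<le> 1"
      using word_slope_bounds[OF lU \<sigma>(1) Proj_in[OF lU ij'(1)] Proj_in[OF lU ij'(2)]] gam2
        power_le_one[of \<gamma>2 "length \<sigma>"] by (auto simp: Q_def)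
    define e where "e = (distortion_const * Q) powr (- s)"
    have "\<bar>integral ?W (\<lambda>x. trapezoid l r x * h x * kernel (t * (pt x v - pt x w)))\<bar>
      = \<bar>integral ?W (\<lambda>x. trapezoid l r x * h x * kernel (t * (comp_word f x \<sigma> (Proj f a x i') - comp_word f x \<sigma> (Proj f a x j'))))\<bar>"
      using pt by (intro arg_cong[where f=abs] integral_cong) auto
    also have "\<dots> \<le> osc_const r q * real n * B ^ 7 * (t * Q) powr (- q) * h l"
      unfolding osc_const_def B_def Q_def
      by (rule oscillation_estimate[OF r W small c theta q _ \<sigma> ij' hc h0 hM]) (use t in auto)
    also have "\<dots> = osc_const r q * X * (Q powr (- q) * h l)"
      by (simp add: powr_mult X_def)
    \<comment> \<open>Here \<open>Q \<le> 1\<close> and \<open>q \<le> s\<close> raise the exponent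
      from the one gained by oscillation to the one of the energy.\<close>
    also have "\<dots> \<le> osc_const r q * X * (Q powr (- s) * h l)"
      using Q s osc_const_nonneg[OF r(1)] X0 h0 by (intro mult_left_mono mult_right_mono powr_mono') auto
    also have "Q powr (- s) = distortion_const powr s * e"
      using distortion_const_pos by (simp add: e_def powr_mult powr_minus)
    also have "osc_const r q * X * (distortion_const powr s * e * h l) = osc_const r q * distortion_const powr s * X * (e * h l)"
      by (simp add: algebra_simps)
    also have "\<dots> \<le> (osc_const r q * distortion_const powr s + 24 * (b - a) powr s) * X * (e * h l)"
      using osc_const_nonneg[OF r(1)] X0 h0 by (intro mult_right_mono) (auto simp: e_def)
    finally have fin: "\<bar>integral ?W (\<lambda>x. trapezoid l r x * h x * kernel (t * (pt x v - pt x w)))\<bar>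
      \<le> (osc_const r q * distortion_const powr s + 24 * (b - a) powr s) * X * (e * h l)" .
    show thesis
    proof (rule that[of e])
      fix i j assume i: "i \<in> cyl m v" and j: "j \<in> cyl m w"
      then have ii: "i \<in> space (SigmaM m)" by (simp add: mem_cyl_iff)
      have nth: "i l' = v ! l'" "j l' = w ! l'" if "l' < n" for l'
        using i j that v w by (auto simp: cyl_def)
      have "prefix_word i k = \<sigma>" "prefix_word i k = prefix_word j k" "i k \<noteq> j k"
        unfolding \<sigma>_def prefix_word_eq_iff using nth kn kl k v by (auto simp: extend_word_def)
      then have "dlam f {a..b} l i j \<le> distortion_const * Q"
        using dlam_le_word_slope[OF lU ii Proj_in[OF lU ij'(1)] Proj_in[OF lU ij'(2)], of k j] by (simp add: Q_def)
      then show "ennreal e \<le> (if dlam f {a..b} l i j = 0 then \<infinity> else ennreal (dlam f {a..b} l i j powr (- s)))"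
        unfolding e_def by (intro cb dlam_nonneg lU ii)
    qed (use fin in \<open>auto simp: h_def X_def B_def e_def\<close>)
  qed
qed

text \<open>The pair bounds add up to a step function integrated against the weights at the centre
  \<open>l\<close>, and \<open>energy_ge\<close> compares that with the energy.\<close>

lemma integral_kernel_energy_le:
  fixes q s \<kappa> l r :: real
  assumes r: "0 < r" "6 * r \<le> 1" and W: "{l - 3 * r..l + 3 * r} \<subseteq> {u0..u1}"
    and small: "12 * lip_const * r \<le> \<eta> / 2" "slope_const * (6 * r) \<le> \<kappa>" "2 * c * (6 * r) powr \<theta> \<le> \<kappa>"
    and q: "1 \<le> q" "q \<le> 2" "q \<le> 1 + min \<delta> \<theta>" and s: "q \<le> s"
    and t: "1 \<le> t" "t * \<gamma>2 ^ n \<le> 1" and n: "1 \<le> n"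
    and E: "energy (\<mu> l) (dlam f {a..b} l) s = ennreal E" "0 \<le> E"
  shows "integral {l - 3 * r..l + 3 * r} (\<lambda>x. trapezoid l r x * kernel_energy t n x)
    \<le> (osc_const r q * distortion_const powr s + 24 * (b - a) powr s) * (real n * exp (\<kappa> * real n) ^ 7 * t powr (- q)) * E"
proof -
  let ?W = "{l - 3 * r..l + 3 * r}" and ?L = "words_of_length m n"
  define Y where "Y = (osc_const r q * distortion_const powr s + 24 * (b - a) powr s) * (real n * exp (\<kappa> * real n) ^ 7 * t powr (- q))"
  have Y0: "0 \<le> Y" unfolding Y_def using osc_const_nonneg[OF r(1)] by (intro mult_nonneg_nonneg add_nonneg_nonneg) auto
  have lU: "l \<in> {u0..u1}" using W r by auto
  define I where "I v w = (\<lambda>x. trapezoid l r x * (mass x v * mass x w) * kernel (t * (pt x v - pt x w)))" for v w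
  \<comment> \<open>Bundling the three properties lets one choice function \<open>e\<close> for all
    pairs of words be extracted at once.\<close>
  define P where "P v w e \<longleftrightarrow> 0 \<le> e \<and> (\<forall>i\<in>cyl m v. \<forall>j\<in>cyl m w.
       ennreal e \<le> (if dlam f {a..b} l i j = 0 then \<infinity> else ennreal (dlam f {a..b} l i j powr (- s))))
      \<and> \<bar>integral ?W (I v w)\<bar> \<le> Y * (e * (mass l v * mass l w))" for v w e
  have "\<exists>e. P v w e" if "v \<in> ?L" "w \<in> ?L" for v w
  proof (rule pair_estimate[OF r W small q s t n that])
    fix e
    assume "0 \<le> e" and "\<And>i j. i \<in> cyl m v \<Longrightarrow> j \<in> cyl m w \<Longrightarrow>
       ennreal e \<le> (if dlam f {a..b} l i j = 0 then \<infinity> else ennreal (dlam f {a..b} l i j powr (- s)))"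
    and "\<bar>integral ?W (\<lambda>x. trapezoid l r x * (mass x v * mass x w) * kernel (t * (pt x v - pt x w)))\<bar>
      \<le> (osc_const r q * distortion_const powr s + 24 * (b - a) powr s) * (real n * exp (\<kappa> * real n) ^ 7 * t powr (- q))
        * (e * (mass l v * mass l w))"
    then have "P v w e" unfolding P_def I_def Y_def by (intro conjI ballI)
    then show "\<exists>e. P v w e" ..
  qed
  then obtain e where "\<And>v w. v \<in> ?L \<Longrightarrow> w \<in> ?L \<Longrightarrow> P v w (e v w)"
    by metis
  then have e: "\<And>v w. v \<in> ?L \<Longrightarrow> w \<in> ?L \<Longrightarrow> 0 \<le> e v w"
    "\<And>v w i j. v \<in> ?L \<Longrightarrow> w \<in> ?L \<Longrightarrow> i \<in> cyl m v \<Longrightarrow> j \<in> cyl m w \<Longrightarrow>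
       ennreal (e v w) \<le> (if dlam f {a..b} l i j = 0 then \<infinity> else ennreal (dlam f {a..b} l i j powr (- s)))"
    "\<And>v w. v \<in> ?L \<Longrightarrow> w \<in> ?L \<Longrightarrow> \<bar>integral ?W (I v w)\<bar> \<le> Y * (e v w * (mass l v * mass l w))"
    unfolding P_def by blast+
  have Ii: "I v w integrable_on ?W" if "v \<in> ?L" "w \<in> ?L" for v w
    unfolding I_def using W that
    by (intro integrable_continuous_interval continuous_intros r
        continuous_on_subset[OF continuous_on_mass] continuous_on_subset[OF continuous_on_pt]) (auto simp: words_of_length_def)
  have "integral ?W (\<lambda>x. trapezoid l r x * kernel_energy t n x) = integral ?W (\<lambda>x. \<Sum>v\<in>?L. \<Sum>w\<in>?L. I v w x)"
    unfolding kernel_energy_def I_def sum_distrib_left by (simp add: mult.assoc)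
  also have "\<dots> = (\<Sum>v\<in>?L. \<Sum>w\<in>?L. integral ?W (I v w))"
    using Ii by (subst integral_sum) (auto intro!: integrable_sum sum.cong integral_sum)
  also have "\<dots> \<le> (\<Sum>v\<in>?L. \<Sum>w\<in>?L. Y * (e v w * (mass l v * mass l w)))"
    using e(3) by (intro sum_mono) (simp add: abs_le_iff)
  also have "\<dots> = Y * (\<Sum>v\<in>?L. \<Sum>w\<in>?L. e v w * (mass l v * mass l w))"
    by (simp add: sum_distrib_left)
  also have "\<dots> \<le> Y * E"
  proof (intro mult_left_mono Y0)
    have "ennreal (\<Sum>v\<in>?L. \<Sum>w\<in>?L. e v w * (mass l v * mass l w)) \<le> ennreal E"
      unfolding E(1)[symmetric] by (intro energy_ge lU e)
    then show "(\<Sum>v\<in>?L. \<Sum>w\<in>?L. e v w * (mass l v * mass l w)) \<le> E"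
      using E(2) by (simp add: ennreal_le_iff)
  qed
  finally show ?thesis by (simp add: Y_def)
qed


text \<open>The budget for t = 2^N: the Sobolev weight, the factor t of the shell and the
  oscillation give t^(2 \<gamma> + 1 - q), at most t^(-\<epsilon>). The value of \<kappa> lets the
  losses in \<open>n\<close> consume only half of this exponent, up to a constant, and the choice of
  \<open>p\<close> makes the discretisation errors summable.\<close>

lemma sobolev_integral_finite:
  fixes q s \<kappa> l r \<gamma> \<epsilon> :: real and p :: nat
  assumes r: "0 < r" "6 * r \<le> 1" and W: "{l - 3 * r..l + 3 * r} \<subseteq> {u0..u1}"
    and small: "12 * lip_const * r \<le> \<eta> / 2" "slope_const * (6 * r) \<le> \<kappa>" "2 * c * (6 * r) powr \<theta> \<le> \<kappa>"
    and q: "1 \<le> q" "q \<le> 1 + min \<delta> \<theta>" "1 + 2 * \<gamma> + \<epsilon> \<le> q" and s: "q \<le> s"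
    and \<gamma>: "0 < \<gamma>" and \<epsilon>: "0 < \<epsilon>" and p: "\<gamma>2 ^ p \<le> 1 / 8" and \<kappa>: "\<kappa> = \<epsilon> * ln 2 / (16 * real p)"
    and E: "energy (\<mu> l) (dlam f {a..b} l) s < \<infinity>" and \<rho>: "\<And>x. \<rho> x \<le> 1"
  shows "(\<integral>\<^sup>+ lam \<in> {l - r<..<l + r}. sobolev_sq (distr (\<mu> lam) lborel (Proj f a lam)) \<gamma> * ennreal (\<rho> lam) \<partial>lborel) < \<infinity>"
proof -
  let ?W = "{l - 3 * r..l + 3 * r}"
  define E' where "E' = enn2real (energy (\<mu> l) (dlam f {a..b} l) s)"
  have E': "energy (\<mu> l) (dlam f {a..b} l) s = ennreal E'" "0 \<le> E'"
    using E by (auto simp: E'_def)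
  have q2: "q \<le> 2" "2 * \<gamma> \<le> 1" using q delta \<epsilon> by auto
  have p1: "1 \<le> p" using p by (cases p) auto
  have kap: "0 < \<kappa>" using \<epsilon> p1 by (simp add: \<kappa>)
  \<comment> \<open>Words of this length resolve points at scale \<open>8 powr - N\<close>, much finer than the frequency \<open>2 ^ N\<close> can see.\<close>
  define n where "n N = p * (N + 1)" for N
  \<comment> \<open>The \<open>+ 1\<close> in the word length matters at \<open>N = 0\<close>: the
    pair estimates absorb constants into \<open>real n\<close>.\<close>
  have n1: "1 \<le> n N" for N using p1 by (simp add: n_def)
  have gn: "\<gamma>2 ^ n N \<le> 1 / (2 ^ N) ^ 3" for N
  proof -
    have "\<gamma>2 ^ n N = (\<gamma>2 ^ p) ^ (N + 1)" by (simp only: n_def power_mult)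
    also have "\<dots> \<le> (1 / 8) ^ (N + 1)" using p gam2 by (intro power_mono) auto
    also have "\<dots> \<le> (1 / 8) ^ N" by (intro power_decreasing) auto
    also have "\<dots> = 1 / (2 ^ N) ^ 3" by (simp add: power_one_over power_mult[symmetric] mult.commute[of N 3] power_mult)
    finally show ?thesis .
  qed
  \<comment> \<open>The ratio of the geometric series that remains when half of the gain has been
    spent.\<close>
  define y where "y = 2 powr (- \<epsilon> / 2)"
  have y: "0 < y" "y < 1" using \<epsilon> powr_less_mono[of "- \<epsilon> / 2" 0 2] by (auto simp: y_def)
  define M1 where "M1 = osc_const r q * distortion_const powr s + 24 * (b - a) powr s"
  have M1: "0 \<le> M1" unfolding M1_def using osc_const_nonneg[OF r(1)] by auto
  define M2 where "M2 = (b - a) * mass u0 []"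
  define K1 where "K1 = 4 * (pi / symbol_floor) * M1 * E' / (\<kappa> * y)"
  define K2 where "K2 = 64 * M2\<^sup>2"
  have sb_cont: "continuous_on ?W (\<lambda>x. trapezoid l r x * shell_bound \<gamma> (n N) (2 ^ N) x)" for N
    unfolding shell_bound_def using W
    by (intro continuous_intros r continuous_on_subset[OF continuous_on_kernel_energy]) auto
  have sb0: "0 \<le> trapezoid l r x * shell_bound \<gamma> (n N) (2 ^ N) x" for N x
    using trapezoid_bounds[of l r x] by (intro mult_nonneg_nonneg shell_bound_nonneg) auto
  have main: "integral ?W (\<lambda>x. trapezoid l r x * shell_bound \<gamma> (n N) (2 ^ N) x) \<le> K1 * y ^ N + K2 * (1 / 4) ^ N" for N
  proof -
    define t :: real where "t = 2 ^ N"
    have t1: "1 \<le> t" by (simp add: t_def)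
    have gn': "\<gamma>2 ^ n N \<le> 1 / t ^ 3" using gn by (simp add: t_def)
    have "t * \<gamma>2 ^ n N \<le> t * (1 / t ^ 3)" using gn' t1 by (intro mult_left_mono) auto
    also have "\<dots> \<le> 1" using t1 power_increasing[of 1 3 t] by (simp add: field_simps)
    finally have t2: "t * \<gamma>2 ^ n N \<le> 1" .
    have iT: "(\<lambda>x. trapezoid l r x) integrable_on ?W"
      by (intro integrable_continuous_interval continuous_intros r)
    have iG: "(\<lambda>x. trapezoid l r x * kernel_energy t (n N) x) integrable_on ?W"
      using W by (intro integrable_continuous_interval continuous_intros r continuous_on_subset[OF continuous_on_kernel_energy]) auto
    define err where "err = 4 * t * (2 * t * (\<gamma>2 ^ n N * (b - a)) * mass u0 [])\<^sup>2"
    have "integral ?W (trapezoid l r) \<le> integral ?W (\<lambda>x. 1)"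
      using iT trapezoid_bounds by (intro integral_le) auto
    also have "\<dots> \<le> 1" using r by simp
    finally have T1: "integral ?W (trapezoid l r) \<le> 1" .
    have "integral ?W (\<lambda>x. trapezoid l r x * shell_bound \<gamma> (n N) t x)
       = integral ?W (\<lambda>x. 4 * t powr (2 * \<gamma>) * (pi * t / symbol_floor * (trapezoid l r x * kernel_energy t (n N) x) + err * trapezoid l r x))"
      unfolding shell_bound_def err_def by (intro integral_cong) (simp add: algebra_simps)
    also have "\<dots> = 4 * t powr (2 * \<gamma>) * (pi * t / symbol_floor * integral ?W (\<lambda>x. trapezoid l r x * kernel_energy t (n N) x) + err * integral ?W (trapezoid l r))"
      by (intro integral_unique has_integral_mult_right has_integral_add integrable_integral iG iT)
    also have "\<dots> \<le> 4 * t powr (2 * \<gamma>) * (pi * t / symbol_floor * (M1 * (real (n N) * exp (\<kappa> * real (n N)) ^ 7 * t powr (- q)) * E') + err * 1)"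
      unfolding M1_def using t1 symbol_floor_pos T1
      by (intro mult_left_mono add_mono integral_kernel_energy_le[OF r W small q(1) q2(1) q(2) s t1 t2 n1 E']) (auto simp: err_def)
    also have "\<dots> = 4 * (pi / symbol_floor) * M1 * E' * ((t powr (2 * \<gamma>) * t * t powr (- q)) * (real (n N) * exp (\<kappa> * real (n N)) ^ 7)) + 4 * t powr (2 * \<gamma>) * err"
      by (simp add: algebra_simps)
    also have "\<dots> \<le> 4 * (pi / symbol_floor) * M1 * E' * (y ^ N / (\<kappa> * y)) + K2 * (1 / 4) ^ N"
    proof (rule add_mono, rule mult_left_mono)
      have "t powr (2 * \<gamma>) * t * t powr (- q) = t powr (2 * \<gamma> + 1 - q)"
        using t1 by (simp add: powr_add[symmetric] powr_mult_base algebra_simps)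
      also have "\<dots> \<le> t powr (- \<epsilon>)" using t1 q by (intro powr_mono) auto
      also have "\<dots> = y ^ N * y ^ N"
        by (simp add: t_def y_def powr_realpow[symmetric] powr_powr powr_add[symmetric] algebra_simps)
      finally have A: "t powr (2 * \<gamma>) * t * t powr (- q) \<le> y ^ N * y ^ N" .
      \<comment> \<open>The factor \<open>n N\<close> costs an eighth exponential. With
        \<open>n N = p * (N + 1)\<close> the 16 in \<kappa> turns the eighth power into
        \<open>2 powr (\<epsilon> / 2 * (N + 1))\<close>, which is
        \<open>(1 / y) ^ (N + 1)\<close>.\<close>
      have "\<kappa> * real (n N) \<le> exp (\<kappa> * real (n N))" using exp_ge_add_one_self[of "\<kappa> * real (n N)"] by linarith
      then have "real (n N) \<le> exp (\<kappa> * real (n N)) / \<kappa>" using kap by (simp add: field_simps)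
      then have "real (n N) * exp (\<kappa> * real (n N)) ^ 7 \<le> exp (\<kappa> * real (n N)) / \<kappa> * exp (\<kappa> * real (n N)) ^ 7"
        by (intro mult_right_mono) auto
      also have "\<dots> = exp (\<kappa> * real (n N)) ^ 8 / \<kappa>" by (simp add: power_numeral_reduce)
      also have "exp (\<kappa> * real (n N)) ^ 8 = exp (8 * (\<kappa> * real (n N)))" by (simp add: exp_of_nat_mult[symmetric])
      also have "8 * (\<kappa> * real (n N)) = real (N + 1) * (\<epsilon> / 2 * ln 2)"
        using p1 by (simp add: n_def \<kappa> field_simps)
      also have "exp (real (N + 1) * (\<epsilon> / 2 * ln 2)) = (1 / y) ^ (N + 1)"
      proof -
        have "exp (\<epsilon> / 2 * ln 2) = 1 / y" by (simp add: y_def powr_def exp_minus inverse_eq_divide)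
        then show ?thesis by (simp only: exp_of_nat_mult)
      qed
      finally have Bd: "real (n N) * exp (\<kappa> * real (n N)) ^ 7 \<le> (1 / y) ^ (N + 1) / \<kappa>" .
      have "(t powr (2 * \<gamma>) * t * t powr (- q)) * (real (n N) * exp (\<kappa> * real (n N)) ^ 7)
         \<le> (y ^ N * y ^ N) * ((1 / y) ^ (N + 1) / \<kappa>)"
        using y by (intro mult_mono A Bd) auto
      also have "\<dots> = y ^ N / (\<kappa> * y)" using y by (simp add: power_one_over field_simps)
      finally show "(t powr (2 * \<gamma>) * t * t powr (- q)) * (real (n N) * exp (\<kappa> * real (n N)) ^ 7) \<le> y ^ N / (\<kappa> * y)" .
      show "0 \<le> 4 * (pi / symbol_floor) * M1 * E'" using symbol_floor_pos M1 E'(2) by auto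
      \<comment> \<open>The error is of order t^3 times the square of
        \<open>\<gamma>2 ^ n N\<close>, hence t^(-3). The Sobolev weight costs at most one further
        power of t, so t^(-2) = 4^(-N) remains.\<close>
      have "t powr (2 * \<gamma>) \<le> t powr 1" using t1 q2 by (intro powr_mono) auto
      then have tg: "t powr (2 * \<gamma>) \<le> t" using t1 by simp
      have "err = 16 * t ^ 3 * (\<gamma>2 ^ n N)\<^sup>2 * M2\<^sup>2"
        by (simp add: err_def M2_def power2_eq_square power3_eq_cube)
      also have "\<dots> \<le> 16 * t ^ 3 * (1 / t ^ 3)\<^sup>2 * M2\<^sup>2"
        using gn' gam2 t1 by (intro mult_right_mono mult_left_mono power_mono) auto
      also have "\<dots> = 16 * M2\<^sup>2 / t ^ 3" using t1 by (simp add: field_simps power_numeral_reduce)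
      finally have "t powr (2 * \<gamma>) * err \<le> t * (16 * M2\<^sup>2 / t ^ 3)"
        using tg t1 by (intro mult_mono) (auto simp: err_def)
      also have "\<dots> = 16 * M2\<^sup>2 * (1 / t ^ 2)" using t1 by (simp add: power3_eq_cube power2_eq_square)
      also have "1 / t ^ 2 = (1 / 4) ^ N" by (simp add: t_def power_one_over power_mult[symmetric] mult.commute[of N 2] power_mult)
      finally show "4 * t powr (2 * \<gamma>) * err \<le> K2 * (1 / 4) ^ N" by (simp add: K2_def algebra_simps)
    qed
    finally show ?thesis by (simp add: t_def K1_def)
  qed
  have summ: "summable (\<lambda>N. K1 * y ^ N + K2 * (1 / 4) ^ N)"
    using y by (intro summable_add summable_mult summable_geometric) auto
  have pw: "sobolev_sq (distr (\<mu> lam) lborel (Proj f a lam)) \<gamma> * ennreal (\<rho> lam) * indicator {l - r<..<l + r} lam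
     \<le> ennreal (2 * (mass u0 [])\<^sup>2) * indicator ?W lam
        + (\<Sum>N. ennreal (trapezoid l r lam * shell_bound \<gamma> (n N) (2 ^ N) lam) * indicator ?W lam)" for lam
  proof (cases "lam \<in> {l - r<..<l + r}")
    case True
    then have lW: "lam \<in> ?W" using r by auto
    have T: "trapezoid l r lam = 1" using True r by (intro trapezoid_eq_1) auto
    have "sobolev_sq (distr (\<mu> lam) lborel (Proj f a lam)) \<gamma> * ennreal (\<rho> lam) \<le> sobolev_sq (distr (\<mu> lam) lborel (Proj f a lam)) \<gamma> * 1"
      using \<rho>[of lam] by (intro mult_left_mono) (auto simp: ennreal_le_1)
    also have "\<dots> \<le> ennreal (2 * (mass u0 [])\<^sup>2) + (\<Sum>N. ennreal (shell_bound \<gamma> (n N) (2 ^ N) lam))"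
      using sobolev_sq_le[of lam \<gamma> n] lW W \<gamma> q2 by auto
    finally show ?thesis using True lW T by simp
  qed simp
  have mS: "(\<lambda>lam. ennreal (trapezoid l r lam * shell_bound \<gamma> (n N) (2 ^ N) lam) * indicator ?W lam) \<in> borel_measurable lborel" for N
    by (rule measurable_continuous_atLeastAtMost[OF sb_cont])
  have mSum: "(\<lambda>lam. \<Sum>N. ennreal (trapezoid l r lam * shell_bound \<gamma> (n N) (2 ^ N) lam) * indicator ?W lam) \<in> borel_measurable lborel"
    by (intro borel_measurable_suminf_order mS)
  have "(\<integral>\<^sup>+ lam \<in> {l - r<..<l + r}. sobolev_sq (distr (\<mu> lam) lborel (Proj f a lam)) \<gamma> * ennreal (\<rho> lam) \<partial>lborel)
    \<le> (\<integral>\<^sup>+ lam. ennreal (2 * (mass u0 [])\<^sup>2) * indicator ?W lam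
        + (\<Sum>N. ennreal (trapezoid l r lam * shell_bound \<gamma> (n N) (2 ^ N) lam) * indicator ?W lam) \<partial>lborel)"
    by (intro nn_integral_mono pw)
  also have "\<dots> = (\<integral>\<^sup>+ lam. ennreal (2 * (mass u0 [])\<^sup>2) * indicator ?W lam \<partial>lborel)
     + (\<integral>\<^sup>+ lam. (\<Sum>N. ennreal (trapezoid l r lam * shell_bound \<gamma> (n N) (2 ^ N) lam) * indicator ?W lam) \<partial>lborel)"
    by (rule nn_integral_add[OF _ mSum]) simp
  also have "(\<integral>\<^sup>+ lam. (\<Sum>N. ennreal (trapezoid l r lam * shell_bound \<gamma> (n N) (2 ^ N) lam) * indicator ?W lam) \<partial>lborel)
     = (\<Sum>N. ennreal (integral ?W (\<lambda>x. trapezoid l r x * shell_bound \<gamma> (n N) (2 ^ N) x)))"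
    by (subst nn_integral_suminf[OF mS]) (simp only: nn_integral_continuous_atLeastAtMost[OF sb_cont sb0])
  also have "(\<integral>\<^sup>+ lam. ennreal (2 * (mass u0 [])\<^sup>2) * indicator ?W lam \<partial>lborel) = ennreal (2 * (mass u0 [])\<^sup>2) * emeasure lborel ?W"
    by (subst nn_integral_cmult_indicator) auto
  also have "ennreal (2 * (mass u0 [])\<^sup>2) * emeasure lborel ?W + (\<Sum>N. ennreal (integral ?W (\<lambda>x. trapezoid l r x * shell_bound \<gamma> (n N) (2 ^ N) x)))
     \<le> ennreal (2 * (mass u0 [])\<^sup>2) * emeasure lborel ?W + (\<Sum>N. ennreal (K1 * y ^ N + K2 * (1 / 4) ^ N))"
    by (intro add_left_mono suminf_le ennreal_leI main summableI)
  also have "\<dots> < \<infinity>"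
  proof -
    have K: "0 \<le> K1 * y ^ N + K2 * (1 / 4) ^ N" for N
      using y symbol_floor_pos M1 E'(2) kap by (auto simp: K1_def K2_def)
    have "(\<Sum>N. ennreal (K1 * y ^ N + K2 * (1 / 4) ^ N)) = ennreal (\<Sum>N. K1 * y ^ N + K2 * (1 / 4) ^ N)"
      by (rule suminf_ennreal2[OF K summ])
    moreover have "emeasure lborel ?W < \<infinity>" using r by simp
    ultimately show ?thesis by (simp add: ennreal_mult_less_top)
  qed
  finally show ?thesis .
qed

text \<open>Every requirement holds for all sufficiently small \<open>r\<close>, so a minimum of
  thresholds works. The \<open>+ 1\<close> in two denominators covers vanishing constants; the last
  entry solves \<open>2 * c * (6 * r) powr \<theta> = \<kappa>\<close>.\<close>

lemma window_exists:
  fixes l \<kappa> :: real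
  assumes l: "l \<in> {u0<..<u1}" and \<kappa>: "0 < \<kappa>"
  obtains r where "0 < r" "6 * r \<le> 1" "{l - 3 * r..l + 3 * r} \<subseteq> {u0..u1}"
    "12 * lip_const * r \<le> \<eta> / 2" "slope_const * (6 * r) \<le> \<kappa>" "2 * c * (6 * r) powr \<theta> \<le> \<kappa>"
proof -
  define r where "r = Min {1 / 6, (l - u0) / 3, (u1 - l) / 3, \<eta> / (24 * (lip_const + 1)), \<kappa> / (6 * (slope_const + 1)), (\<kappa> / (2 * c)) powr (1 / \<theta>) / 6}"
  have le: "r \<le> 1 / 6" "r \<le> (l - u0) / 3" "r \<le> (u1 - l) / 3" "r \<le> \<eta> / (24 * (lip_const + 1))" "r \<le> \<kappa> / (6 * (slope_const + 1))" "r \<le> (\<kappa> / (2 * c)) powr (1 / \<theta>) / 6"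
    unfolding r_def by (rule Min_le; simp)+
  have r0: "0 < r"
    unfolding r_def using l \<kappa> eta c lip_const slope_const_nonneg by (subst Min_gr_iff) (auto intro!: divide_pos_pos)
  show thesis
  proof (rule that[OF r0])
    have "r * (24 * (lip_const + 1)) \<le> \<eta>" using le(4) lip_const by (simp add: pos_le_divide_eq)
    then show "12 * lip_const * r \<le> \<eta> / 2" using r0 by (simp add: algebra_simps)
    have "r * (6 * (slope_const + 1)) \<le> \<kappa>" using le(5) slope_const_nonneg by (simp add: pos_le_divide_eq)
    then show "slope_const * (6 * r) \<le> \<kappa>" using r0 by (simp add: algebra_simps)
    have "(6 * r) powr \<theta> \<le> ((\<kappa> / (2 * c)) powr (1 / \<theta>)) powr \<theta>"
      using le(6) r0 theta by (intro powr_mono2) auto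
    also have "\<dots> = \<kappa> / (2 * c)" using theta \<kappa> c by (simp add: powr_powr)
    finally show "2 * c * (6 * r) powr \<theta> \<le> \<kappa>" using c by (simp add: field_simps)
  qed (use le l in auto)
qed

end

section \<open>From (MA1)-(MA4) to increments\<close>

text \<open>(MA1), (MA3) and (MA4) each supply their own derivative in the point. Uniqueness, also
  at the endpoints, identifies them.\<close>

lemma DERIV_atLeastAtMost_unique:
  fixes a b x :: real
  assumes "a < b" "x \<in> {a..b}" "(g has_real_derivative D) (at x within {a..b})" "(g has_real_derivative D') (at x within {a..b})"
  shows "D = D'"
proof -
  have "x islimpt {a..b}" using assms by (intro connected_imp_perfect) auto
  then have "at x within {a..b} \<noteq> bot" by (simp add: trivial_limit_within)
  then show ?thesis using assms(3,4) has_field_derivative_unique by blast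
qed

lemma mvt_atLeastAtMost:
  fixes g g' :: "real \<Rightarrow> real"
  assumes "\<And>z. z \<in> {a..b} \<Longrightarrow> (g has_real_derivative g' z) (at z within {a..b})" "x \<in> {a..b}" "y \<in> {a..b}"
  obtains z where "z \<in> {a..b}" "\<bar>z - y\<bar> \<le> \<bar>x - y\<bar>" "g x - g y = g' z * (x - y)"
proof -
  have *: "\<exists>z\<in>{x..y}. g y - g x = g' z * (y - x)" if "x \<le> y" "x \<in> {a..b}" "y \<in> {a..b}" for x y
  proof (rule mvt_very_simple[OF that(1)])
    fix z assume "x \<le> z" "z \<le> y"
    then show "(g has_derivative (*) (g' z)) (at z within {x..y})"
      unfolding has_field_derivative_def[symmetric]
      using that by (intro DERIV_subset[OF assms(1)]) auto
  qed
  show thesis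
  proof (cases "x \<le> y")
    case True
    then obtain z where z: "z \<in> {x..y}" "g y - g x = g' z * (y - x)" using * assms by blast
    then have "g x - g y = g' z * (x - y)" by (simp add: algebra_simps)
    then show ?thesis using z assms True by (intro that[of z]) auto
  next
    case False
    then obtain z where "z \<in> {y..x}" "g x - g y = g' z * (x - y)" using *[of y x] assms by auto
    then show ?thesis using assms False by (intro that[of z]) auto
  qed
qed

text \<open>The derivative is Lipschitz in the point by the bound on the second derivative and in
  the parameter by the bound on the mixed partial. The Taylor estimate is the mean value theorem
  plus Hoelder continuity of \<open>fl\<close>.\<close>

lemma parametrized_ifs_exists:
  fixes m :: nat and a b u0 u1 \<delta> :: real and f :: "real \<Rightarrow> nat \<Rightarrow> real \<Rightarrow> real"
  assumes X: "a < b"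
    and U: "u0 < u1"
    and delta: "0 < \<delta>" "\<delta> < 1"
    and maps: "\<And>lam j x. lam \<in> {u0..u1} \<Longrightarrow> j < m \<Longrightarrow> x \<in> {a..b} \<Longrightarrow> f lam j x \<in> {a..b}"
    and MA1: "\<exists>f1 f2 K. (\<forall>lam\<in>{u0..u1}. \<forall>j<m. \<forall>x\<in>{a..b}.
              (f lam j has_real_derivative f1 lam j x) (at x within {a..b})
            \<and> (f1 lam j has_real_derivative f2 lam j x) (at x within {a..b})
            \<and> \<bar>f2 lam j x\<bar> \<le> K)"
    and MA2: "\<exists>fl K. (\<forall>lam\<in>{u0..u1}. \<forall>j<m. \<forall>x\<in>{a..b}.
              ((\<lambda>l. f l j x) has_real_derivative fl lam j x) (at lam within {u0..u1}))
          \<and> (\<forall>lam\<in>{u0..u1}. \<forall>lam'\<in>{u0..u1}. \<forall>j<m. \<forall>x\<in>{a..b}.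
              \<bar>fl lam j x - fl lam' j x\<bar> \<le> K * \<bar>lam - lam'\<bar> powr \<delta>)"
    and MA3: "\<exists>f1 g K. (\<forall>lam\<in>{u0..u1}. \<forall>j<m. \<forall>x\<in>{a..b}.
              (f lam j has_real_derivative f1 lam j x) (at x within {a..b})
            \<and> ((\<lambda>l. f1 l j x) has_real_derivative g lam j x) (at lam within {u0..u1})
            \<and> \<bar>g lam j x\<bar> \<le> K)"
    and MA4: "\<exists>\<gamma>1 \<gamma>2. 0 < \<gamma>1 \<and> \<gamma>2 < 1 \<and> (\<forall>lam\<in>{u0..u1}. \<forall>j<m. \<forall>x\<in>{a..b}.
              \<exists>D. (f lam j has_real_derivative D) (at x within {a..b}) \<and> \<gamma>1 \<le> \<bar>D\<bar> \<and> \<bar>D\<bar> \<le> \<gamma>2)"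
  shows "\<exists>f1 fl K \<gamma>1 \<gamma>2. parametrized_ifs m a b u0 u1 f f1 fl K \<gamma>1 \<gamma>2 \<delta>"
proof -
  from MA1 obtain f1 f2 K1 where d1: "\<And>lam j x. lam \<in> {u0..u1} \<Longrightarrow> j < m \<Longrightarrow> x \<in> {a..b} \<Longrightarrow> (f lam j has_real_derivative f1 lam j x) (at x within {a..b})"
    and d2: "\<And>lam j x. lam \<in> {u0..u1} \<Longrightarrow> j < m \<Longrightarrow> x \<in> {a..b} \<Longrightarrow> (f1 lam j has_real_derivative f2 lam j x) (at x within {a..b})"
    and K1: "\<And>lam j x. lam \<in> {u0..u1} \<Longrightarrow> j < m \<Longrightarrow> x \<in> {a..b} \<Longrightarrow> \<bar>f2 lam j x\<bar> \<le> K1"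
    by blast
  from MA2 obtain fl K2 where dl: "\<And>lam j x. lam \<in> {u0..u1} \<Longrightarrow> j < m \<Longrightarrow> x \<in> {a..b} \<Longrightarrow> ((\<lambda>l. f l j x) has_real_derivative fl lam j x) (at lam within {u0..u1})"
    and K2: "\<And>lam lam' j x. lam \<in> {u0..u1} \<Longrightarrow> lam' \<in> {u0..u1} \<Longrightarrow> j < m \<Longrightarrow> x \<in> {a..b} \<Longrightarrow> \<bar>fl lam j x - fl lam' j x\<bar> \<le> K2 * \<bar>lam - lam'\<bar> powr \<delta>"
    by blast
  from MA3 obtain h g K3 where d3: "\<And>lam j x. lam \<in> {u0..u1} \<Longrightarrow> j < m \<Longrightarrow> x \<in> {a..b} \<Longrightarrow> (f lam j has_real_derivative h lam j x) (at x within {a..b})"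
    and dg: "\<And>lam j x. lam \<in> {u0..u1} \<Longrightarrow> j < m \<Longrightarrow> x \<in> {a..b} \<Longrightarrow> ((\<lambda>l. h l j x) has_real_derivative g lam j x) (at lam within {u0..u1})"
    and K3: "\<And>lam j x. lam \<in> {u0..u1} \<Longrightarrow> j < m \<Longrightarrow> x \<in> {a..b} \<Longrightarrow> \<bar>g lam j x\<bar> \<le> K3"
    by blast
  from MA4 obtain \<gamma>1 \<gamma>2 where g12: "0 < \<gamma>1" "\<gamma>2 < 1" and d4: "\<And>lam j x. lam \<in> {u0..u1} \<Longrightarrow> j < m \<Longrightarrow> x \<in> {a..b} \<Longrightarrow>
      \<exists>D. (f lam j has_real_derivative D) (at x within {a..b}) \<and> \<gamma>1 \<le> \<bar>D\<bar> \<and> \<bar>D\<bar> \<le> \<gamma>2"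
    by blast
  have heq: "h lam j x = f1 lam j x" if "lam \<in> {u0..u1}" "j < m" "x \<in> {a..b}" for lam j x
    using DERIV_atLeastAtMost_unique[OF X that(3) d3[OF that] d1[OF that]] .
  have f1b: "\<gamma>1 \<le> \<bar>f1 lam j x\<bar> \<and> \<bar>f1 lam j x\<bar> \<le> \<gamma>2" if "lam \<in> {u0..u1}" "j < m" "x \<in> {a..b}" for lam j x
    using d4[OF that] DERIV_atLeastAtMost_unique[OF X that(3) _ d1[OF that]] by blast
  \<comment> \<open>A bound on \<open>fl\<close> follows from its Hoelder continuity and one good
    point: as \<open>f\<close> takes values in an interval of length \<open>b - a\<close>, the mean
    value theorem yields a parameter where \<open>fl\<close> is at most
    \<open>(b - a) / (u1 - u0)\<close>.\<close>
  define K0 where "K0 = (b - a) / (u1 - u0) + \<bar>K2\<bar> * (u1 - u0) powr \<delta>"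
  have K0: "0 \<le> K0" using X U by (simp add: K0_def)
  have flb: "\<bar>fl lam j x\<bar> \<le> K0" if lam: "lam \<in> {u0..u1}" "j < m" "x \<in> {a..b}" for lam j x
  proof -
    have "((\<lambda>l. f l j x) has_real_derivative fl z j x) (at z within {u0..u1})" if "z \<in> {u0..u1}" for z
      using dl[OF that lam(2,3)] .
    then obtain z where z: "z \<in> {u0..u1}" "f u1 j x - f u0 j x = fl z j x * (u1 - u0)"
      using mvt_atLeastAtMost[of u0 u1 "\<lambda>l. f l j x" "\<lambda>l. fl l j x" u1 u0] U
      by (metis atLeastAtMost_iff less_imp_le order_refl)
    have "\<bar>f u1 j x - f u0 j x\<bar> \<le> b - a"
      using maps[of u1 j x] maps[of u0 j x] that U by auto
    then have 1: "\<bar>fl z j x\<bar> \<le> (b - a) / (u1 - u0)"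
      using U z(2) by (simp add: abs_mult field_simps)
    have "K2 * \<bar>lam - z\<bar> powr \<delta> \<le> \<bar>K2\<bar> * (u1 - u0) powr \<delta>"
      using lam z delta by (intro mult_mono powr_mono2) auto
    then show ?thesis using K2[OF lam(1) z(1) lam(2,3)] 1 by (simp add: K0_def)
  qed
  define K where "K = \<bar>K1\<bar> + \<bar>K2\<bar> + \<bar>K3\<bar> + K0"
  have KK: "\<bar>K1\<bar> \<le> K" "\<bar>K2\<bar> \<le> K" "\<bar>K3\<bar> \<le> K" "K0 \<le> K" "0 \<le> K" using K0 by (auto simp: K_def)
  \<comment> \<open>For an empty alphabet (MA4) is vacuous and does not force \<gamma>2 to be
    positive; the maximum does, and stays below 1.\<close>
  define G2 where "G2 = max \<gamma>2 (1/2)"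
  have "parametrized_ifs m a b u0 u1 f f1 fl K \<gamma>1 G2 \<delta>"
  proof
    show "0 < G2" "G2 < 1" using g12 by (auto simp: G2_def)
    fix lam j x assume A: "lam \<in> {u0..u1}" "j < m" "x \<in> {a..b}"
    show "f lam j x \<in> {a..b}" using maps A by blast
    show "(f lam j has_real_derivative f1 lam j x) (at x within {a..b})" using d1 A by blast
    show "\<gamma>1 \<le> \<bar>f1 lam j x\<bar>" "\<bar>f1 lam j x\<bar> \<le> G2" using f1b[OF A] by (auto simp: G2_def)
    show "\<bar>fl lam j x\<bar> \<le> K" using flb[OF A] KK by simp
  next
    fix lam lam' j x x' assume A: "lam \<in> {u0..u1}" "lam' \<in> {u0..u1}" "j < m" "x \<in> {a..b}" "x' \<in> {a..b}"
    obtain z where z: "z \<in> {a..b}" "\<bar>z - x'\<bar> \<le> \<bar>x - x'\<bar>" "f1 lam j x - f1 lam j x' = f2 lam j z * (x - x')"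
      by (rule mvt_atLeastAtMost[OF d2[OF A(1,3)] A(4,5)])
    have "((\<lambda>l. h l j x') has_real_derivative g y j x') (at y within {u0..u1})" if "y \<in> {u0..u1}" for y
      using dg[OF that A(3,5)] .
    from this A(1,2) obtain y where y: "y \<in> {u0..u1}" "\<bar>y - lam'\<bar> \<le> \<bar>lam - lam'\<bar>"
        "h lam j x' - h lam' j x' = g y j x' * (lam - lam')"
      by (rule mvt_atLeastAtMost)
    have "\<bar>f1 lam j x - f1 lam j x'\<bar> \<le> K * \<bar>x - x'\<bar>"
      unfolding z(3) abs_mult using K1[OF A(1,3) z(1)] KK by (intro mult_right_mono) auto
    moreover have "\<bar>f1 lam j x' - f1 lam' j x'\<bar> \<le> K * \<bar>lam - lam'\<bar>"
      using y(3) K3[OF y(1) A(3,5)] KK unfolding heq[OF A(1,3,5)] heq[OF A(2,3,5)]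
      by (simp add: abs_mult mult_right_mono)
    ultimately show "\<bar>f1 lam j x - f1 lam' j x'\<bar> \<le> K * (\<bar>x - x'\<bar> + \<bar>lam - lam'\<bar>)"
      unfolding distrib_left by linarith
  next
    fix lam lam' j x assume A: "lam \<in> {u0..u1}" "lam' \<in> {u0..u1}" "j < m" "x \<in> {a..b}"
    have "((\<lambda>l. f l j x) has_real_derivative fl y j x) (at y within {u0..u1})" if "y \<in> {u0..u1}" for y
      using dl[OF that A(3,4)] .
    from this A(1,2) obtain y where y: "y \<in> {u0..u1}" "\<bar>y - lam'\<bar> \<le> \<bar>lam - lam'\<bar>"
        "f lam j x - f lam' j x = fl y j x * (lam - lam')"
      by (rule mvt_atLeastAtMost)
    show "\<bar>f lam j x - f lam' j x\<bar> \<le> K * \<bar>lam - lam'\<bar>"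
      unfolding y(3) abs_mult using flb[OF y(1) A(3,4)] KK by (intro mult_right_mono) auto
    have "\<bar>f lam j x - f lam' j x - fl lam' j x * (lam - lam')\<bar> = \<bar>fl y j x - fl lam' j x\<bar> * \<bar>lam - lam'\<bar>"
      unfolding y(3) abs_mult[symmetric] by (simp add: algebra_simps)
    also have "\<dots> \<le> (K * \<bar>lam - lam'\<bar> powr \<delta>) * \<bar>lam - lam'\<bar>"
    proof (intro mult_right_mono)
      have "K2 * \<bar>y - lam'\<bar> powr \<delta> \<le> K * \<bar>lam - lam'\<bar> powr \<delta>"
        using y KK delta by (intro mult_mono powr_mono2) auto
      then show "\<bar>fl y j x - fl lam' j x\<bar> \<le> K * \<bar>lam - lam'\<bar> powr \<delta>"
        using K2[OF y(1) A(2,3,4)] by linarith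
    qed simp
    also have "\<dots> = K * \<bar>lam - lam'\<bar> powr (1 + \<delta>)"
      by (cases "lam = lam'") (auto simp: powr_add)
    finally show "\<bar>f lam j x - f lam' j x - fl lam' j x * (lam - lam')\<bar> \<le> K * \<bar>lam - lam'\<bar> powr (1 + \<delta>)" .
  qed (use X U delta KK g12 in auto)
  then show ?thesis by blast
qed

theorem mainTheorem8:
  fixes m :: nat and a b u0 u1 :: real
    and f :: "real \<Rightarrow> nat \<Rightarrow> real \<Rightarrow> real"
    and \<mu> :: "real \<Rightarrow> (nat \<Rightarrow> nat) measure"
    and \<delta> c \<theta> lam0 \<beta> \<gamma> \<epsilon> q :: real
  assumes X: "a < b"
    and U: "u0 < u1"
    and delta: "0 < \<delta>" "\<delta> < 1"
    and maps: "\<And>lam j x. lam \<in> {u0..u1} \<Longrightarrow> j < m \<Longrightarrow> x \<in> {a..b} \<Longrightarrow> f lam j x \<in> {a..b}"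
    \<comment> \<open>(MA1)\<close>
    and MA1: "\<exists>f1 f2 K. (\<forall>lam\<in>{u0..u1}. \<forall>j<m. \<forall>x\<in>{a..b}.
              (f lam j has_real_derivative f1 lam j x) (at x within {a..b})
            \<and> (f1 lam j has_real_derivative f2 lam j x) (at x within {a..b})
            \<and> \<bar>f2 lam j x\<bar> \<le> K)
          \<and> (\<forall>lam\<in>{u0..u1}. \<forall>lam'\<in>{u0..u1}. \<forall>j<m. \<forall>x\<in>{a..b}. \<forall>x'\<in>{a..b}.
              \<bar>f2 lam j x - f2 lam' j x'\<bar> \<le> K * (\<bar>x - x'\<bar> powr \<delta> + \<bar>lam - lam'\<bar> powr \<delta>))"
    \<comment> \<open>(MA2)\<close>
    and MA2: "\<exists>fl K. (\<forall>lam\<in>{u0..u1}. \<forall>j<m. \<forall>x\<in>{a..b}.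
              ((\<lambda>l. f l j x) has_real_derivative fl lam j x) (at lam within {u0..u1}))
          \<and> (\<forall>lam\<in>{u0..u1}. \<forall>lam'\<in>{u0..u1}. \<forall>j<m. \<forall>x\<in>{a..b}.
              \<bar>fl lam j x - fl lam' j x\<bar> \<le> K * \<bar>lam - lam'\<bar> powr \<delta>)"
    \<comment> \<open>(MA3): mixed partial d/dlam (d/dx f)\<close>
    and MA3: "\<exists>f1 g K. (\<forall>lam\<in>{u0..u1}. \<forall>j<m. \<forall>x\<in>{a..b}.
              (f lam j has_real_derivative f1 lam j x) (at x within {a..b})
            \<and> ((\<lambda>l. f1 l j x) has_real_derivative g lam j x) (at lam within {u0..u1})
            \<and> \<bar>g lam j x\<bar> \<le> K)
          \<and> (\<forall>j<m. continuous_on ({u0..u1} \<times> {a..b}) (\<lambda>(l, x). g l j x))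
          \<and> (\<forall>lam\<in>{u0..u1}. \<forall>lam'\<in>{u0..u1}. \<forall>j<m. \<forall>x\<in>{a..b}. \<forall>x'\<in>{a..b}.
              \<bar>g lam j x - g lam' j x'\<bar> \<le> K * (\<bar>x - x'\<bar> powr \<delta> + \<bar>lam - lam'\<bar> powr \<delta>))"
    \<comment> \<open>(MA4)\<close>
    and MA4: "\<exists>\<gamma>1 \<gamma>2. 0 < \<gamma>1 \<and> \<gamma>2 < 1 \<and> (\<forall>lam\<in>{u0..u1}. \<forall>j<m. \<forall>x\<in>{a..b}.
              \<exists>D. (f lam j has_real_derivative D) (at x within {a..b}) \<and> \<gamma>1 \<le> \<bar>D\<bar> \<and> \<bar>D\<bar> \<le> \<gamma>2)"
    \<comment> \<open>(MT) transversality\<close>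
    and MT: "\<exists>\<eta>>0. \<forall>lam\<in>{u0..u1}. \<forall>i\<in>space (SigmaM m). \<forall>j\<in>space (SigmaM m).
              i 0 \<noteq> j 0 \<longrightarrow> \<bar>Proj f a lam i - Proj f a lam j\<bar> < \<eta> \<longrightarrow>
              (\<exists>D. ((\<lambda>l. Proj f a l i - Proj f a l j) has_real_derivative D) (at lam within {u0..u1})
                   \<and> \<eta> \<le> \<bar>D\<bar>)"
    \<comment> \<open>finite Borel measures on Sigma\<close>
    and meas: "\<And>lam. lam \<in> {u0..u1} \<Longrightarrow> finite_measure (\<mu> lam) \<and> sets (\<mu> lam) = sets (SigmaM m)"
    \<comment> \<open>(M) with constants c, theta\<close>
    and c: "0 < c" and theta: "0 < \<theta>" "\<theta> \<le> 1"
    and M: "\<And>w lam lam'. w \<in> words m \<Longrightarrow> lam \<in> {u0..u1} \<Longrightarrow> lam' \<in> {u0..u1} \<Longrightarrow>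
              exp (- c * \<bar>lam - lam'\<bar> powr \<theta> * real (length w)) * measure (\<mu> lam') (cyl m w)
                \<le> measure (\<mu> lam) (cyl m w)
            \<and> measure (\<mu> lam) (cyl m w)
                \<le> exp (c * \<bar>lam - lam'\<bar> powr \<theta> * real (length w)) * measure (\<mu> lam') (cyl m w)"
    and lam0: "lam0 \<in> {u0<..<u1}"
    and pos: "0 < \<beta>" "0 < \<gamma>" "0 < \<epsilon>"
    and q: "1 < q" "1 + 2 * \<gamma> + \<epsilon> < q" "q < 1 + min \<delta> \<theta>"
  shows "\<exists>j0 j1. {j0<..<j1} \<subseteq> {u0<..<u1} \<and> lam0 \<in> {j0<..<j1} \<and>
           (\<forall>\<rho>. smooth_fun \<rho> \<and> (\<forall>x. 0 \<le> \<rho> x \<and> \<rho> x \<le> 1)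
                 \<and> closure {x. \<rho> x \<noteq> 0} \<subseteq> {j0<..<j1} \<longrightarrow>
              (\<exists>C1 C2. 0 < C1 \<and> 0 < C2 \<and>
                 (\<integral>\<^sup>+ lam \<in> {j0<..<j1}.
                     sobolev_sq (distr (\<mu> lam) lborel (Proj f a lam)) \<gamma> * ennreal (\<rho> lam) \<partial>lborel)
                 \<le> ennreal C1 * energy (\<mu> lam0) (dlam f {a..b} lam0)
                        (q * (1 + ((8 + 4 * \<delta>) / (1 + min \<delta> \<theta>)) * \<beta>))
                   + ennreal C2))"
proof -
  \<comment> \<open>The constants may depend on the energy, so only finiteness of the left side for finite energy is at stake.\<close>
  define s where "s = q * (1 + ((8 + 4 * \<delta>) / (1 + min \<delta> \<theta>)) * \<beta>)"
  have qs: "q \<le> s"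
    unfolding s_def using q delta theta pos by (simp add: mult_le_cancel_left1)
  let ?L = "\<lambda>j0 j1 \<rho>. \<integral>\<^sup>+ lam \<in> {j0<..<j1}. sobolev_sq (distr (\<mu> lam) lborel (Proj f a lam)) \<gamma> * ennreal (\<rho> lam) \<partial>lborel"
  let ?E = "energy (\<mu> lam0) (dlam f {a..b} lam0) s"
  have "\<exists>j0 j1. {j0<..<j1} \<subseteq> {u0<..<u1} \<and> lam0 \<in> {j0<..<j1} \<and>
     (\<forall>\<rho>. (\<forall>x. \<rho> x \<le> 1) \<longrightarrow> ?E < \<infinity> \<longrightarrow> ?L j0 j1 \<rho> < \<infinity>)"
  \<comment> \<open>Without letters the sequence space is empty, every Fourier transform vanishes
    and any admissible interval serves.\<close>
  proof (cases "m = 0")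
    case True
    have "sobolev_sq (distr (\<mu> lam) lborel (Proj f a lam)) \<gamma> = 0" if "lam \<in> {u0..u1}" for lam
    proof -
      have "space (\<mu> lam) = {}"
        using sets_eq_imp_space_eq[of "\<mu> lam" "SigmaM m"] meas[OF that] True by (simp add: space_SigmaM)
      then have "Proj f a lam \<in> \<mu> lam \<rightarrow>\<^sub>M lborel" and "AE i in \<mu> lam. cis (\<xi> * Proj f a lam i) = 0" for \<xi>
        by (auto simp: measurable_def)
      moreover have "(\<lambda>x. cis (\<xi> * x)) \<in> borel_measurable lborel" for \<xi>
        using borel_measurable_continuous_onI[of "\<lambda>x. cis (\<xi> * x)"] by (simp add: continuous_intros)
      ultimately have "fourier (distr (\<mu> lam) lborel (Proj f a lam)) \<xi> = 0" for \<xi>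
        unfolding fourier_def by (simp add: integral_distr integral_eq_zero_AE)
      then show ?thesis by (simp add: sobolev_sq_def)
    qed
    then have "?L u0 u1 \<rho> = (\<integral>\<^sup>+ lam. 0 \<partial>(lborel :: real measure))" for \<rho>
      by (intro nn_integral_cong) (auto split: split_indicator)
    then show ?thesis using lam0 by - (rule exI[of _ u0], rule exI[of _ u1], auto)
  next
    case False
    have "\<exists>f1 fl K \<gamma>1 \<gamma>2. parametrized_ifs m a b u0 u1 f f1 fl K \<gamma>1 \<gamma>2 \<delta>"
    proof (rule parametrized_ifs_exists[OF X U delta _ _ MA2 _ MA4], goal_cases)
      case (1 lam j x)
      then show ?case by (rule maps)
    next
      case 2
      then show ?case using MA1 by - ((erule ex_forward)+, erule conjunct1)
    next
      case 3
      then show ?case using MA3 by - ((erule ex_forward)+, erule conjunct1)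
    qed
    then obtain f1 fl K \<gamma>1 \<gamma>2 where "parametrized_ifs m a b u0 u1 f f1 fl K \<gamma>1 \<gamma>2 \<delta>"
      by (elim exE)
    then interpret parametrized_ifs m a b u0 u1 f f1 fl K \<gamma>1 \<gamma>2 \<delta> .
    from MT obtain \<eta> where \<eta>: "0 < \<eta>" "\<forall>lam\<in>{u0..u1}. \<forall>i\<in>space (SigmaM m). \<forall>j\<in>space (SigmaM m).
              i 0 \<noteq> j 0 \<longrightarrow> \<bar>Proj f a lam i - Proj f a lam j\<bar> < \<eta> \<longrightarrow>
              (\<exists>D. ((\<lambda>l. Proj f a l i - Proj f a l j) has_real_derivative D) (at lam within {u0..u1})
                   \<and> \<eta> \<le> \<bar>D\<bar>)"
      by (elim exE conjE)
    have "transversal_ifs m a b u0 u1 f f1 fl K \<gamma>1 \<gamma>2 \<delta> \<eta>"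
    proof
      show "0 < \<eta>" by fact
      fix lam i j
      assume "lam \<in> {u0..u1}" "i \<in> space (SigmaM m)" "j \<in> space (SigmaM m)" "i 0 \<noteq> j 0"
        "\<bar>Proj f a lam i - Proj f a lam j\<bar> < \<eta>"
      then show "\<exists>D. ((\<lambda>l. Proj f a l i - Proj f a l j) has_real_derivative D) (at lam within {u0..u1}) \<and> \<eta> \<le> \<bar>D\<bar>"
        by (rule \<eta>(2)[THEN bspec, THEN bspec, THEN bspec, THEN mp, THEN mp])
    qed
    then interpret transversal_ifs m a b u0 u1 f f1 fl K \<gamma>1 \<gamma>2 \<delta> \<eta> .
    interpret measured_ifs m a b u0 u1 f f1 fl K \<gamma>1 \<gamma>2 \<delta> \<eta> \<mu> c \<theta>
      using False meas c theta M by unfold_locales auto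
    obtain p where p: "\<gamma>2 ^ p < 1 / 8" using real_arch_pow_inv[of "1 / 8" \<gamma>2] gam2 by auto
    then have p0: "0 < p" by (cases p) auto
    define \<kappa> where "\<kappa> = \<epsilon> * ln 2 / (16 * real p)"
    have kap: "0 < \<kappa>" using pos p0 by (simp add: \<kappa>_def)
    obtain r where r: "0 < r" "6 * r \<le> 1" "{lam0 - 3 * r..lam0 + 3 * r} \<subseteq> {u0..u1}"
      "12 * lip_const * r \<le> \<eta> / 2" "slope_const * (6 * r) \<le> \<kappa>" "2 * c * (6 * r) powr \<theta> \<le> \<kappa>"
      by (rule window_exists[OF lam0 kap])
    \<comment> \<open>The interval J is the middle third of the window, where the cutoff equals
      1.\<close>
    show ?thesis
    proof (rule exI[of _ "lam0 - r"], rule exI[of _ "lam0 + r"], intro conjI allI impI)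
      have "lam0 - 3 * r \<in> {u0..u1}" "lam0 + 3 * r \<in> {u0..u1}" using r(1,3) by auto
      then show "{lam0 - r<..<lam0 + r} \<subseteq> {u0<..<u1}" using r(1) by auto
      show "lam0 \<in> {lam0 - r<..<lam0 + r}" using r(1) by simp
      fix \<rho> :: "real \<Rightarrow> real" assume "\<forall>x. \<rho> x \<le> 1" "?E < \<infinity>"
      then show "?L (lam0 - r) (lam0 + r) \<rho> < \<infinity>"
        using q pos qs p by (intro sobolev_integral_finite[OF r, where q=q and s=s and \<epsilon>=\<epsilon> and p=p]) (auto simp: \<kappa>_def)
    qed
  qed
  then obtain j0 j1 where J: "{j0<..<j1} \<subseteq> {u0<..<u1}" "lam0 \<in> {j0<..<j1}"
    and fin: "\<And>\<rho>. (\<And>x. \<rho> x \<le> 1) \<Longrightarrow> ?E < \<infinity> \<Longrightarrow> ?L j0 j1 \<rho> < \<infinity>"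
    by blast
  have "\<exists>C1 C2. 0 < C1 \<and> 0 < C2 \<and> ?L j0 j1 \<rho> \<le> ennreal C1 * ?E + ennreal C2" if "\<And>x. \<rho> x \<le> 1" for \<rho>
  \<comment> \<open>For finite energy take \<open>C1 = 1\<close> and for \<open>C2\<close> the value
    of the integral plus 1, to have it positive. For infinite energy a positive \<open>C1\<close>
    makes the right-hand side infinite.\<close>
  proof (cases "?E < \<infinity>")
    case True
    then have L: "?L j0 j1 \<rho> < \<infinity>" by (rule fin[OF that])
    have "?L j0 j1 \<rho> = ennreal (enn2real (?L j0 j1 \<rho>))" using L by simp
    also have "\<dots> \<le> ennreal (enn2real (?L j0 j1 \<rho>) + 1)" by (intro ennreal_leI) simp
    also have "\<dots> \<le> ennreal 1 * ?E + ennreal (enn2real (?L j0 j1 \<rho>) + 1)" by (rule add_increasing) auto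
    finally show ?thesis
      by - (rule exI[of _ 1], rule exI[of _ "enn2real (?L j0 j1 \<rho>) + 1"], simp add: add_nonneg_pos)
  next
    case False
    then have "?E = \<infinity>" by (simp add: less_top[symmetric])
    then show ?thesis by (intro exI[of _ 1]) auto
  qed
  then have "\<forall>\<rho>. smooth_fun \<rho> \<and> (\<forall>x. 0 \<le> \<rho> x \<and> \<rho> x \<le> 1) \<and> closure {x. \<rho> x \<noteq> 0} \<subseteq> {j0<..<j1} \<longrightarrow>
      (\<exists>C1 C2. 0 < C1 \<and> 0 < C2 \<and> ?L j0 j1 \<rho> \<le> ennreal C1 * ?E + ennreal C2)"
    by simp
  with J show ?thesis unfolding s_def by (intro exI conjI)
qed

end
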